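(* Let $L:\mathbb{R}\times\mathbb{R}^n\times\mathbb{R}^n\times\mathbb{R}\to\mathbb{R}$ be of class $C^1$ and satisfy conditions (L1), (L2), (L3), (L4') listed in the context. Let $a<b$, $x,y\in\mathbb{R}^n$, $u\in\mathbb{R}$, and let $\xi\in\Gamma^{a,b}_{x,y}$ be a minimizer of $J$ over $\mathcal{A}$, with $u_\xi$ the corresponding solution of the Carathéodory equation. Then the function $s\mapsto L_v(s,\xi(s),\dot\xi(s),u_\xi(s))$ is absolutely continuous on $[a,b]$ (i.e. it agrees almost everywhere with an absolutely continuous function), and $(\xi,u_\xi)$ satisfies the Carathéodory equation $$\dot u_\xi(s)=L(s,\xi(s),\dot\xi(s),u_\xi(s))\ \text{ a.e. } s\in[a,b],\qquad u_\xi(a)=u,$$ and the Herglotz equation $$\frac{d}{ds}L_v(s,\xi(s),\dot\xi(s),u_\xi(s))=L_x(s,\xi(s),\dot\xi(s),u_\xi(s))+L_u(s,\xi(s),\dot\xi(s),u_\xi(s))\,L_v(s,\xi(s),\dot\xi(s),u_\xi(s))$$ for almost all $s\in[a,b]$.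
   Context: Write $L=L(t,x,v,r)$; $L_t,L_x,L_v$ are the partial derivatives in $t,x,v$, and $L_r=L_u$ denotes the partial derivative in the last (real) variable. A function $\theta:[0,+\infty)\to[0,+\infty)$ is superlinear if $\theta(r)/r\to+\infty$ as $r\to+\infty$. Conditions: (L1) $L(t,x,\cdot,r)$ is strictly convex for all $(t,x,r)$. (L2) There exist two superlinear functions $\overline\theta_0,\theta_0:[0,+\infty)\to[0,+\infty)$ and two $L^\infty_{\rm loc}$ functions $c_0,c_1:\mathbb{R}\to[0,+\infty)$ such that $\overline\theta_0(|v|)+c_1(t)\geqslant L(t,x,v,0)\geqslant\theta_0(|v|)-c_0(t)$ for all $(t,x,v)\in\mathbb{R}\times\mathbb{R}^n\times\mathbb{R}^n$. (L3) There exists an $L^\infty_{\rm loc}$ function $K:\mathbb{R}\to[0,+\infty)$ such that $|L_r(t,x,v,r)|\leqslant K(t)$ for all $(t,x,v,r)$. (L4') There exist two $L^\infty_{\rm loc}$ functions $C_1,C_2:\mathbb{R}\to[0,+\infty)$ such that $\max\{|L_x(t,x,v,r)|,|L_v(t,x,v,r)|\}\leqslant C_1(t)+C_2(t)L(t,x,v,r)$ for all $(t,x,v,r)$. $\Gamma^{a,b}_{x,y}=\{\xi\in W^{1,1}([a,b],\mathbb{R}^n):\xi(a)=x,\ \xi(b)=y\}$; $\mathcal{A}=\mathcal{A}^{a,b,u}_{x,y}$ is the set of $\xi\in\Gamma^{a,b}_{x,y}$ for which the problem $\dot u_\xi(s)=L(s,\xi(s),\dot\xi(s),u_\xi(s))$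 a.e. on $[a,b]$, $u_\xi(a)=u$, admits an absolutely continuous solution $u_\xi$ (which is then unique); and $J(\xi)=\int_a^bL(s,\xi(s),\dot\xi(s),u_\xi(s))\,ds$ for $\xi\in\mathcal{A}$. *)

theory Defs
  imports "HOL-Analysis.Analysis"
begin

section \<open>Absolute continuity and local essential boundedness\<close>

text \<open>The usual \<open>\<epsilon>\<close>-\<open>\<delta>\<close> definition: \<open>d\<close> ranges over the finite families of closed
  subintervals \<open>k = {Inf k..Sup k}\<close> of \<open>{a..b}\<close> with pairwise disjoint interiors.\<close>

definition absolutely_continuous_on_ivl ::
    "real \<Rightarrow> real \<Rightarrow> (real \<Rightarrow> 'a::real_normed_vector) \<Rightarrow> bool" where
  "absolutely_continuous_on_ivl a b f \<longleftrightarrow>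
     (\<forall>\<epsilon>>0. \<exists>\<delta>>0. \<forall>d. d division_of \<Union>d \<and> \<Union>d \<subseteq> {a..b} \<and> (\<Sum>k\<in>d. Sup k - Inf k) < \<delta> \<longrightarrow>
        (\<Sum>k\<in>d. norm (f (Sup k) - f (Inf k))) < \<epsilon>)"

definition Linf_loc :: "(real \<Rightarrow> real) \<Rightarrow> bool" where
  "Linf_loc f \<longleftrightarrow> f \<in> borel_measurable lebesgue \<and>
     (\<forall>S. compact S \<longrightarrow> (\<exists>M. AE t\<in>S in lebesgue. \<bar>f t\<bar> \<le> M))"

definition Linf_loc_nonneg :: "(real \<Rightarrow> real) \<Rightarrow> bool" where
  "Linf_loc_nonneg f \<longleftrightarrow> Linf_loc f \<and> (\<forall>t. 0 \<le> f t)"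


section \<open>Assumptions on the Lagrangian\<close>

type_synonym 'n lagrangian = "real \<Rightarrow> real^'n \<Rightarrow> real^'n \<Rightarrow> real \<Rightarrow> real"

definition C1_map :: "('a::real_normed_vector \<Rightarrow> 'b::real_normed_vector) \<Rightarrow> bool" where
  "C1_map f \<longleftrightarrow>
     (\<exists>f'. (\<forall>p. (f has_derivative blinfun_apply (f' p)) (at p)) \<and> continuous_on UNIV f')"

definition C1_lagrangian :: "'n::finite lagrangian \<Rightarrow> bool" where
  "C1_lagrangian L \<longleftrightarrow> C1_map (\<lambda>(t, x, v, r). L t x v r)"

definition grad :: "('a::real_inner \<Rightarrow> real) \<Rightarrow> 'a \<Rightarrow> 'a" where
  "grad f x = (THE D. GDERIV f x :> D)"

lemma grad_eqI:
  assumes "GDERIV f x :> D"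
  shows "grad f x = D"
  unfolding grad_def
proof (rule the_equality[where a = D])
  show "GDERIV f x :> D" by (rule assms)
next
  fix D' assume "GDERIV f x :> D'"
  then have "(\<lambda>h. h \<bullet> D') = (\<lambda>h. h \<bullet> D)"
    using assms has_derivative_unique unfolding gderiv_def by blast
  then show "D' = D"
    by (metis vector_eq_ldot)
qed

definition L_x :: "'n::finite lagrangian \<Rightarrow> real \<Rightarrow> real^'n \<Rightarrow> real^'n \<Rightarrow> real \<Rightarrow> real^'n" where
  "L_x L t x v r = grad (\<lambda>z. L t z v r) x"

definition L_v :: "'n::finite lagrangian \<Rightarrow> real \<Rightarrow> real^'n \<Rightarrow> real^'n \<Rightarrow> real \<Rightarrow> real^'n" where
  "L_v L t x v r = grad (\<lambda>z. L t x z r) v"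

definition L_r :: "'n::finite lagrangian \<Rightarrow> real \<Rightarrow> real^'n \<Rightarrow> real^'n \<Rightarrow> real \<Rightarrow> real" where
  "L_r L t x v r = deriv (\<lambda>z. L t x v z) r"

definition strictly_convex :: "('a::real_vector \<Rightarrow> real) \<Rightarrow> bool" where
  "strictly_convex f \<longleftrightarrow>
     (\<forall>v w. \<forall>\<mu>\<in>{0<..<1}. v \<noteq> w \<longrightarrow>
        f ((1 - \<mu>) *\<^sub>R v + \<mu> *\<^sub>R w) < (1 - \<mu>) * f v + \<mu> * f w)"

text \<open>Functions \<open>[0,\<infinity>) \<rightarrow> [0,\<infinity>)\<close> are represented by total functions whose values at
  negative arguments are irrelevant.\<close>

definition superlinear :: "(real \<Rightarrow> real) \<Rightarrow> bool" where
  "superlinear \<theta> \<longleftrightarrow> (\<forall>r\<ge>0. 0 \<le> \<theta> r) \<and> filterlim (\<lambda>r. \<theta> r / r) at_top at_top"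

definition cond_L1 :: "'n::finite lagrangian \<Rightarrow> bool" where
  "cond_L1 L \<longleftrightarrow> (\<forall>t x r. strictly_convex (\<lambda>v. L t x v r))"

definition cond_L2 :: "'n::finite lagrangian \<Rightarrow> bool" where
  "cond_L2 L \<longleftrightarrow>
     (\<exists>\<theta>' \<theta> c\<^sub>0 c\<^sub>1. superlinear \<theta>' \<and> superlinear \<theta> \<and> Linf_loc_nonneg c\<^sub>0 \<and> Linf_loc_nonneg c\<^sub>1 \<and>
        (\<forall>t x v. \<theta>' (norm v) + c\<^sub>1 t \<ge> L t x v 0 \<and> L t x v 0 \<ge> \<theta> (norm v) - c\<^sub>0 t))"

definition cond_L3 :: "'n::finite lagrangian \<Rightarrow> bool" where
  "cond_L3 L \<longleftrightarrow> (\<exists>K. Linf_loc_nonneg K \<and> (\<forall>t x v r. \<bar>L_r L t x v r\<bar> \<le> K t))"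

definition cond_L4' :: "'n::finite lagrangian \<Rightarrow> bool" where
  "cond_L4' L \<longleftrightarrow>
     (\<exists>C\<^sub>1 C\<^sub>2. Linf_loc_nonneg C\<^sub>1 \<and> Linf_loc_nonneg C\<^sub>2 \<and>
        (\<forall>t x v r. max (norm (L_x L t x v r)) (norm (L_v L t x v r)) \<le> C\<^sub>1 t + C\<^sub>2 t * L t x v r))"


section \<open>Curves, the Caratheodory problem and the action functional\<close>

text \<open>Curves on \<open>[a,b]\<close> are total functions of which only the values on \<open>{a..b}\<close> matter;
  accordingly derivatives are taken within \<open>{a..b}\<close>. Elements of \<open>W\<^sup>1\<^sup>,\<^sup>1([a,b])\<close> are identified
  with their absolutely continuous representatives, so the weak derivative is the pointwise
  derivative, which exists almost everywhere.\<close>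

definition velocity :: "real \<Rightarrow> real \<Rightarrow> (real \<Rightarrow> real^'n::finite) \<Rightarrow> real \<Rightarrow> real^'n" where
  "velocity a b \<xi> s = vector_derivative \<xi> (at s within {a..b})"

definition curves :: "real \<Rightarrow> real \<Rightarrow> real^'n::finite \<Rightarrow> real^'n \<Rightarrow> (real \<Rightarrow> real^'n) set" where
  "curves a b x y = {\<xi>. absolutely_continuous_on_ivl a b \<xi> \<and> \<xi> a = x \<and> \<xi> b = y}"

definition caratheodory_solution ::
    "'n::finite lagrangian \<Rightarrow> real \<Rightarrow> real \<Rightarrow> real \<Rightarrow> (real \<Rightarrow> real^'n) \<Rightarrow> (real \<Rightarrow> real) \<Rightarrow> bool" where
  "caratheodory_solution L a b u \<xi> w \<longleftrightarrow>
     absolutely_continuous_on_ivl a b w \<and>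
     (AE s\<in>{a..b} in lebesgue.
        (w has_real_derivative L s (\<xi> s) (velocity a b \<xi> s) (w s)) (at s within {a..b})) \<and>
     w a = u"

definition admissible ::
    "'n::finite lagrangian \<Rightarrow> real \<Rightarrow> real \<Rightarrow> real^'n \<Rightarrow> real^'n \<Rightarrow> real \<Rightarrow> (real \<Rightarrow> real^'n) set" where
  "admissible L a b x y u = {\<xi> \<in> curves a b x y. \<exists>w. caratheodory_solution L a b u \<xi> w}"

text \<open>For admissible \<open>\<xi>\<close> the solution \<open>u\<^sub>\<xi>\<close> is unique on \<open>{a..b}\<close>; the choice only concerns its
  irrelevant values outside \<open>{a..b}\<close>.\<close>

definition u_sol ::
    "'n::finite lagrangian \<Rightarrow> real \<Rightarrow> real \<Rightarrow> real \<Rightarrow> (real \<Rightarrow> real^'n) \<Rightarrow> real \<Rightarrow> real" where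
  "u_sol L a b u \<xi> = (SOME w. caratheodory_solution L a b u \<xi> w)"

definition J ::
    "'n::finite lagrangian \<Rightarrow> real \<Rightarrow> real \<Rightarrow> real \<Rightarrow> (real \<Rightarrow> real^'n) \<Rightarrow> real" where
  "J L a b u \<xi> =
     set_lebesgue_integral lebesgue {a..b} (\<lambda>s. L s (\<xi> s) (velocity a b \<xi> s) (u_sol L a b u \<xi> s))"

end

theory Submission
  imports Defs
begin

text \<open>The minimizer \<open>\<xi>\<close> is compared with \<open>\<xi> + \<epsilon> \<eta>\<close>, where \<open>\<eta>\<close> is Lipschitz and vanishes at \<open>a\<close> and
  \<open>b\<close>. By (L4') and Gronwall, \<open>L\<close> along the perturbed curve differs from \<open>L\<close> along \<open>\<xi>\<close> by at
  most \<open>\<epsilon>\<close> times an integrable function. Since \<open>L\<close> is Lipschitz in \<open>r\<close> by (L3), the perturbed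
  Caratheodory problem is therefore solvable by a contraction argument, and its solution \<open>w\<^sub>\<epsilon>\<close>
  is within \<open>O(\<epsilon>)\<close> of \<open>w = u\<^sub>\<xi>\<close>. Minimality says \<open>w\<^sub>\<epsilon> b \<ge> w b\<close>. Multiplying \<open>w\<^sub>\<epsilon> - w\<close> by the
  integrating factor \<open>E = exp (- \<integral> L\<^sub>r)\<close> turns this into an integral inequality without linear
  term in \<open>w\<^sub>\<epsilon> - w\<close>, and dominated convergence yields
  \<open>\<integral> E (L\<^sub>x \<bullet> \<eta> + L\<^sub>v \<bullet> \<eta>') = 0\<close>. The du Bois-Reymond lemma then gives
  \<open>E L\<^sub>v = c + \<integral> E L\<^sub>x\<close> almost everywhere, which is the Herglotz equation in integrated form.

  The argument needs that the absolutely continuous functions are exactly the indefinite Lebesgue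
  integrals. Differentiation of integrals follows from the Vitali covering lemma; the converse
  reduces through the total variation to monotone functions, whose interval measure has a
  Radon-Nikodym density.\<close>

section \<open>Lebesgue differentiation on the line\<close>

text \<open>The obstacle is that \<open>\<xi>\<close> is only absolutely continuous: its velocity
  may be unbounded, and nothing makes \<open>L_x\<close> or \<open>L_v\<close> along it integrable
  beforehand. The majorant comes from admissibility: \<open>w\<close> is absolutely continuous, so
  \<open>L\<close> along \<open>\<xi>\<close> is integrable, and (L4') bounds both gradients by
  multiples of \<open>G\<close>, which is \<open>L\<close> shifted to be nonnegative. Integrated
  along a segment in \<open>(x, v)\<close>, the same inequality controls \<open>L\<close> off the
  curve as long as the perturbation of the velocity is bounded. Hence test curves have bounded
  derivative, and the du Bois-Reymond lemma is proved with a bounded sign function. A single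
  constant \<open>A\<close> replaces all locally bounded coefficients. The action equals
  \<open>w b - u\<close>, so minimality is a comparison of end values. Differentiability of
  \<open>w\<^sub>\<epsilon>\<close> in \<open>\<epsilon>\<close> is never established: the quotient
  of \<open>w\<^sub>\<epsilon> - w\<close> by \<open>\<epsilon>\<close> is merely bounded, and the
  integrating factor removes it before the limit is taken. Only \<open>\<epsilon> > 0\<close> is
  considered; equality comes from testing with \<open>\<eta>\<close> and
  \<open>- \<eta>\<close>.\<close>

lemma integral_uniformly_small:
  fixes h :: "real \<Rightarrow> real"
  assumes h: "integrable lebesgue h" and nonneg: "\<And>x. 0 \<le> h x" and "0 < \<epsilon>"
  obtains \<delta> where "0 < \<delta>"
    "\<And>S. \<lbrakk>S \<in> sets lebesgue; emeasure lebesgue S < ennreal \<delta>\<rbrakk>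
       \<Longrightarrow> (\<integral>\<^sup>+x\<in>S. ennreal (h x) \<partial>lebesgue) < ennreal \<epsilon>"
proof -
  have [measurable]: "h \<in> borel_measurable lebesgue" using h by auto
  \<comment> \<open>Truncation: the part of \<open>h\<close> above a high level \<open>n\<close> has
    small integral, and the remaining part is at most \<open>n\<close>, hence controlled by the
    measure of the set.\<close>
  have "(\<lambda>n. LINT x|lebesgue. h x - min (h x) (real n)) \<longlonglongrightarrow> (LINT x|(lebesgue::real measure). (0::real))"
  proof (rule integral_dominated_convergence[where w=h])
    show "AE x in lebesgue. (\<lambda>n. h x - min (h x) (real n)) \<longlonglongrightarrow> 0"
    proof (rule AE_I2)
      fix x
      have "eventually (\<lambda>n. h x - min (h x) (real n) = 0) sequentially"
        using eventually_ge_at_top[of "nat \<lceil>h x\<rceil>"] by eventually_elim (auto simp: min_def nat_ceiling_le_eq)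
      then show "(\<lambda>n. h x - min (h x) (real n)) \<longlonglongrightarrow> 0" by (rule tendsto_eventually)
    qed
  qed (use h nonneg in \<open>auto simp: min_def\<close>)
  then obtain n where n: "(LINT x|lebesgue. h x - min (h x) (real n)) < \<epsilon>/2"
    using \<open>0 < \<epsilon>\<close> by (force dest: order_tendstoD(2)[where a="\<epsilon>/2"] simp: eventually_sequentially)
  have int: "integrable lebesgue (\<lambda>x. h x - min (h x) (real n))"
    by (rule Bochner_Integration.integrable_bound[OF h]) (use nonneg in \<open>auto simp: min_def\<close>)
  have nn: "(\<integral>\<^sup>+x. ennreal (h x - min (h x) (real n)) \<partial>lebesgue) < ennreal (\<epsilon>/2)"
    using n by (subst nn_integral_eq_integral[OF int]) (auto simp: \<open>0 < \<epsilon>\<close> ennreal_lessI)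
  \<comment> \<open>Makes \<open>n * \<delta>\<close> smaller than half of
    \<open>\<epsilon>\<close>; the added 1 covers \<open>n = 0\<close>.\<close>
  define \<delta> where "\<delta> = \<epsilon> / (2 * (real n + 1))"
  have "0 < \<delta>" using \<open>0 < \<epsilon>\<close> by (simp add: \<delta>_def)
  moreover have "(\<integral>\<^sup>+x\<in>S. ennreal (h x) \<partial>lebesgue) < ennreal \<epsilon>"
    if [measurable]: "S \<in> sets lebesgue" and S: "emeasure lebesgue S < ennreal \<delta>" for S
  proof -
    have "(\<integral>\<^sup>+x\<in>S. ennreal (h x) \<partial>lebesgue)
        \<le> (\<integral>\<^sup>+x. ennreal (h x - min (h x) (real n)) + ennreal (real n) * indicator S x \<partial>lebesgue)"
      by (rule nn_integral_mono) (auto simp: min_def nonneg indicator_def simp flip: ennreal_plus split: if_splits)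
    also have "\<dots> = (\<integral>\<^sup>+x. ennreal (h x - min (h x) (real n)) \<partial>lebesgue) + ennreal (real n) * emeasure lebesgue S"
      by (subst nn_integral_add) (auto simp: nn_integral_cmult_indicator)
    also have "\<dots> \<le> (\<integral>\<^sup>+x. ennreal (h x - min (h x) (real n)) \<partial>lebesgue) + ennreal (real n) * ennreal \<delta>"
      using S by (intro add_left_mono mult_left_mono) auto
    also have "\<dots> < ennreal (\<epsilon>/2 + \<epsilon>/2)"
      using \<open>0 < \<epsilon>\<close>
      by (intro add_mono_ennreal nn) (auto simp: \<delta>_def field_simps ennreal_lessI simp flip: ennreal_mult)
    also have "\<dots> = ennreal \<epsilon>" by simp
    finally show ?thesis .
  qed
  ultimately show thesis using that by blast
qed

text \<open>Writing the sum as an integral over \<open>count_space C\<close> spares the enumeration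
  of a Vitali family, whose indices are pairs of centre and radius.\<close>

lemma emeasure_UN_le_nn_integral:
  assumes C: "countable C" and A: "\<And>i. i \<in> C \<Longrightarrow> A i \<in> sets M"
  shows "emeasure M (\<Union>i\<in>C. A i) \<le> (\<integral>\<^sup>+i. emeasure M (A i) \<partial>count_space C)"
proof (cases "finite C")
  case True
  have "emeasure M (\<Union>i\<in>C. A i) \<le> (\<Sum>i\<in>C. emeasure M (A i))"
    using A True by (intro emeasure_subadditive_finite) auto
  also have "\<dots> = (\<integral>\<^sup>+i. emeasure M (A i) \<partial>count_space C)"
    using True by (simp add: nn_integral_count_space_finite)
  finally show ?thesis .
next
  case False
  then obtain f :: "nat \<Rightarrow> _" where b: "bij_betw f UNIV C"
    using C bij_betw_from_nat_into[of C] by blast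
  then have r: "C = range f" by (simp add: bij_betw_def)
  have "emeasure M (\<Union>i\<in>C. A i) = emeasure M (\<Union>n. A (f n))"
    unfolding r by (simp add: image_image)
  also have "\<dots> \<le> (\<Sum>n. emeasure M (A (f n)))"
    using A r by (intro emeasure_subadditive_countably) auto
  also have "\<dots> = (\<integral>\<^sup>+n. emeasure M (A (f n)) \<partial>count_space UNIV)"
    by (simp add: nn_integral_count_space_nat)
  also have "\<dots> = (\<integral>\<^sup>+i. emeasure M (A i) \<partial>count_space C)"
    by (rule nn_integral_bij_count_space[OF b])
  finally show ?thesis .
qed

text \<open>The measure \<open>\<nu>\<close> with density \<open>h\<close> gives no mass to the zero
  set \<open>Z\<close> of \<open>h\<close>, so some open \<open>U\<close> around \<open>Z\<close>
  has tiny \<open>\<nu>\<close>-mass. Each point of \<open>E\<close> is the centre of a ball inside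
  \<open>U\<close> with \<open>\<nu>\<close>-mass at least \<open>c * r\<close>. Vitali selects
  disjoint balls whose fivefold enlargements cover \<open>E\<close>. An enlarged ball has length
  \<open>10 * r\<close>, at most \<open>10 / c\<close> times the mass of the original one, so the
  total length is at most \<open>10 / c\<close> times the mass of \<open>U\<close>. Measurability of
  \<open>E\<close> is not assumed, hence the outer description of negligibility.\<close>

lemma negligible_upper_density:
  fixes h :: "real \<Rightarrow> real"
  assumes h: "integrable lebesgue h" and nonneg: "\<And>x. 0 \<le> h x" and "0 < c"
    and zero: "\<And>x. x \<in> E \<Longrightarrow> h x = 0"
    and dense: "\<And>x \<delta>. \<lbrakk>x \<in> E; 0 < \<delta>\<rbrakk> \<Longrightarrow>
       \<exists>r. 0 < r \<and> r < \<delta> \<and> ennreal (c * r) \<le> (\<integral>\<^sup>+y\<in>cball x r. ennreal (h y) \<partial>lebesgue)"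
  shows "negligible E"
  unfolding negligible_outer_le
proof (intro allI impI)
  fix e :: real assume "0 < e"
  define \<nu> where "\<nu> = density lebesgue (\<lambda>x. ennreal (h x))"
  have hm [measurable]: "h \<in> borel_measurable lebesgue" using h by auto
  have nu: "emeasure \<nu> S = (\<integral>\<^sup>+y\<in>S. ennreal (h y) \<partial>lebesgue)" if "S \<in> sets lebesgue" for S
    using that by (simp add: \<nu>_def emeasure_density)
  have nu_sets: "sets \<nu> = sets lebesgue" by (simp add: \<nu>_def)
  define Z where "Z = {x. h x = 0}"
  have Z: "Z \<in> sets lebesgue"
  proof -
    have "{x\<in>space lebesgue. h x = 0} \<in> sets lebesgue" by measurable
    then show ?thesis by (simp add: Z_def)
  qed
  obtain \<delta> where "0 < \<delta>" and \<delta>: "\<And>S. \<lbrakk>S \<in> sets lebesgue; emeasure lebesgue S < ennreal \<delta>\<rbrakk>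
       \<Longrightarrow> (\<integral>\<^sup>+x\<in>S. ennreal (h x) \<partial>lebesgue) < ennreal (e * c / 10)"
    using integral_uniformly_small[OF h nonneg, of "e * c / 10"] \<open>0 < e\<close> \<open>0 < c\<close> by auto
  obtain U where "open U" "Z \<subseteq> U" and UZ: "U - Z \<in> lmeasurable" "emeasure lebesgue (U - Z) < ennreal \<delta>"
    using sets_lebesgue_outer_open[OF Z \<open>0 < \<delta>\<close>] by blast
  have Um: "U \<in> sets lebesgue" using \<open>open U\<close> by simp
  have "emeasure \<nu> U = (\<integral>\<^sup>+x\<in>U - Z. ennreal (h x) \<partial>lebesgue)"
    unfolding nu[OF Um] by (rule nn_integral_cong) (auto simp: Z_def indicator_def)
  then have nuU: "emeasure \<nu> U < ennreal (e * c / 10)"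
    using \<delta> UZ by (simp add: fmeasurableD)
  \<comment> \<open>The cap on \<open>r\<close> serves the covering lemma, which asks for bounded
    radii; the inclusion in \<open>U\<close> bounds the joint mass of the selected balls.\<close>
  define K where "K = {(x, r). x \<in> E \<and> 0 < r \<and> r \<le> 1 \<and> cball x r \<subseteq> U \<and> ennreal (c * r) \<le> emeasure \<nu> (cball x r)}"
  have cov: "E \<subseteq> (\<Union>i\<in>K. cball (fst i) (snd i))"
  proof
    fix x assume "x \<in> E"
    then have "x \<in> U" using zero \<open>Z \<subseteq> U\<close> by (auto simp: Z_def)
    then obtain d where d: "0 < d" "cball x d \<subseteq> U" using \<open>open U\<close> open_contains_cball by blast
    obtain r where r: "0 < r" "r < min d 1" "ennreal (c * r) \<le> (\<integral>\<^sup>+y\<in>cball x r. ennreal (h y) \<partial>lebesgue)"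
      using dense[OF \<open>x \<in> E\<close>, of "min d 1"] d by auto
    have "cball x r \<subseteq> cball x d" using r by (intro subset_cball) auto
    then have "(x, r) \<in> K" using r d \<open>x \<in> E\<close> by (auto simp: K_def nu)
    then show "x \<in> (\<Union>i\<in>K. cball (fst i) (snd i))" using r by force
  qed
  have rad: "0 < snd i \<and> snd i \<le> 1" if "i \<in> K" for i
    using that by (auto simp: K_def)
  obtain C where C: "countable C" "C \<subseteq> K"
     "pairwise (\<lambda>i j. disjnt (cball (fst i) (snd i)) (cball (fst j) (snd j))) C"
     "E \<subseteq> (\<Union>i\<in>C. cball (fst i) (5 * snd i))"
    by (rule Vitali_covering_lemma_cballs[OF cov rad]) auto
  let ?T = "\<Union>i\<in>C. cball (fst i) (5 * snd i)"
  have Tm: "?T \<in> sets lebesgue" using C(1) by (intro sets.countable_UN') auto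
  have "emeasure lebesgue ?T \<le> (\<integral>\<^sup>+i. emeasure lebesgue (cball (fst i) (5 * snd i)) \<partial>count_space C)"
    using C(1) by (intro emeasure_UN_le_nn_integral) auto
  also have "\<dots> \<le> (\<integral>\<^sup>+i. ennreal (10 / c) * emeasure \<nu> (cball (fst i) (snd i)) \<partial>count_space C)"
  proof (rule nn_integral_mono)
    fix i assume "i \<in> space (count_space C)"
    then have i: "0 < snd i" "ennreal (c * snd i) \<le> emeasure \<nu> (cball (fst i) (snd i))"
      using C(2) by (auto simp: K_def)
    have "emeasure lebesgue (cball (fst i) (5 * snd i)) = ennreal (10 * snd i)"
      using i(1) by (simp add: cball_eq_atLeastAtMost)
    also have "\<dots> = ennreal (10 / c) * ennreal (c * snd i)"
      using i(1) \<open>0 < c\<close> by (simp flip: ennreal_mult)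
    also have "\<dots> \<le> ennreal (10 / c) * emeasure \<nu> (cball (fst i) (snd i))"
      using i(2) by (intro mult_left_mono) auto
    finally show "emeasure lebesgue (cball (fst i) (5 * snd i)) \<le> ennreal (10 / c) * emeasure \<nu> (cball (fst i) (snd i))" .
  qed
  also have "\<dots> = ennreal (10 / c) * (\<integral>\<^sup>+i. emeasure \<nu> (cball (fst i) (snd i)) \<partial>count_space C)"
    by (rule nn_integral_cmult) auto
  also have "(\<integral>\<^sup>+i. emeasure \<nu> (cball (fst i) (snd i)) \<partial>count_space C) = emeasure \<nu> (\<Union>i\<in>C. cball (fst i) (snd i))"
    using C by (intro emeasure_UN_countable[symmetric])
      (auto simp: nu_sets disjoint_family_on_def pairwise_def disjnt_def)
  also have "\<dots> \<le> emeasure \<nu> U"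
  proof (rule emeasure_mono[OF UN_least])
    fix i assume "i \<in> C"
    then have "i \<in> K" using C(2) by blast
    then show "cball (fst i) (snd i) \<subseteq> U" by (simp add: K_def case_prod_beta)
  qed (simp add: nu_sets Um)
  also have "ennreal (10 / c) * emeasure \<nu> U \<le> ennreal (10 / c) * ennreal (e * c / 10)"
    using nuU by (intro mult_left_mono) auto
  also have "\<dots> = ennreal e" using \<open>0 < e\<close> \<open>0 < c\<close> by (simp flip: ennreal_mult)
  finally have le: "emeasure lebesgue ?T \<le> ennreal e" by (simp add: mult_left_mono)
  then have "?T \<in> lmeasurable"
    using Tm by (metis ennreal_less_top fmeasurableI infinity_ennreal_def le_less_trans)
  moreover have "measure lebesgue ?T \<le> e"
    using le \<open>0 < e\<close> by (simp add: measure_def enn2real_leI)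
  ultimately show "\<exists>T. E \<subseteq> T \<and> T \<in> lmeasurable \<and> measure lebesgue T \<le> e"
    using C(4) by blast
qed

lemma set_nn_integral_eq_integral:
  fixes h :: "real \<Rightarrow> real"
  assumes S: "S \<in> sets lebesgue" and h: "integrable (lebesgue_on S) h"
    and nonneg: "\<And>x. x \<in> S \<Longrightarrow> 0 \<le> h x"
  shows "(\<integral>\<^sup>+x\<in>S. ennreal (h x) \<partial>lebesgue) = ennreal (integral S h)"
proof -
  have "(\<integral>\<^sup>+x\<in>S. ennreal (h x) \<partial>lebesgue) = (\<integral>\<^sup>+x. ennreal (h x) \<partial>lebesgue_on S)"
    using S by (subst nn_integral_restrict_space) auto
  also have "\<dots> = ennreal (integral\<^sup>L (lebesgue_on S) h)"
    using nonneg by (intro nn_integral_eq_integral[OF h] AE_I2) auto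
  finally show ?thesis using lebesgue_integral_eq_integral[OF h S] by simp
qed

lemma integrable_lebesgue_on_subset:
  fixes g :: "real \<Rightarrow> 'a::euclidean_space"
  assumes "integrable (lebesgue_on S) g" "T \<subseteq> S" "S \<in> sets lebesgue" "T \<in> sets lebesgue"
  shows "integrable (lebesgue_on T) g"
  using set_integrable_subset[of lebesgue S g T] assms
  by (simp add: integrable_restrict_space set_integrable_def)

lemma integrable_on_sub_ivl:
  fixes g :: "real \<Rightarrow> 'a::euclidean_space"
  assumes "integrable (lebesgue_on {a..b}) g" "{u..v} \<subseteq> {a..b}"
  shows "g integrable_on {u..v}"
  using integrable_lebesgue_on_subset[OF assms] by (simp add: integrable_on_lebesgue_on)

text \<open>One-sided Lebesgue differentiation at a fixed level. The excess of \<open>g\<close> over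
  \<open>p\<close> vanishes wherever \<open>g x \<le> p\<close>, so by the density lemma its means
  near almost every such \<open>x\<close> are below \<open>c\<close>. The intervals need only
  contain \<open>x\<close>, which later yields left and right difference quotients at once.\<close>

lemma AE_mean_le:
  fixes g :: "real \<Rightarrow> real"
  assumes g: "integrable (lebesgue_on {a..b}) g" and "0 < c"
  shows "AE x in lebesgue. x \<in> {a<..<b} \<and> g x \<le> p \<longrightarrow>
    (\<exists>\<delta>>0. \<forall>u v. a \<le> u \<and> u \<le> x \<and> x \<le> v \<and> v \<le> b \<and> u < v \<and> v - u < \<delta> \<longrightarrow>
       integral {u..v} g \<le> (p + c) * (v - u))"
proof -
  define h where "h = (\<lambda>y. indicat_real {a..b} y * max (g y - p) 0)"
  have hi: "integrable lebesgue h"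
  proof -
    have "integrable (lebesgue_on {a..b}) (\<lambda>y. max (g y - p) 0)"
      using g by (intro integrable_max Bochner_Integration.integrable_diff) (auto simp: lmeasurable_iff_integrable finite_measure.integrable_const finite_measure_lebesgue_on)
    then show ?thesis by (simp add: integrable_restrict_space h_def)
  qed
  have hn: "0 \<le> h x" for x by (simp add: h_def)
  define E where "E = {x \<in> {a<..<b}. g x \<le> p \<and> \<not> (\<exists>\<delta>>0. \<forall>r. 0 < r \<and> r < \<delta> \<longrightarrow>
       (\<integral>\<^sup>+y\<in>cball x r. ennreal (h y) \<partial>lebesgue) < ennreal (c * r))}"
  have "negligible E"
  proof (rule negligible_upper_density[OF hi hn \<open>0 < c\<close>])
    show "h x = 0" if "x \<in> E" for x using that by (auto simp: E_def h_def)
    show "\<exists>r. 0 < r \<and> r < \<delta> \<and> ennreal (c * r) \<le> (\<integral>\<^sup>+y\<in>cball x r. ennreal (h y) \<partial>lebesgue)"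
      if "x \<in> E" "0 < \<delta>" for x \<delta> using that unfolding E_def not_less[symmetric] by blast
  qed
  then have "E \<in> null_sets lebesgue" by (simp add: negligible_iff_null_sets)
  then have "AE x in lebesgue. x \<notin> E" by (rule AE_not_in)
  then show ?thesis
  proof (rule AE_mp[OF _ AE_I2], intro impI, elim conjE)
    fix x assume "x \<notin> E" and x: "x \<in> {a<..<b}" "g x \<le> p"
    then obtain \<delta> where "\<delta> > 0" and \<delta>: "\<And>r. 0 < r \<Longrightarrow> r < \<delta> \<Longrightarrow>
       (\<integral>\<^sup>+y\<in>cball x r. ennreal (h y) \<partial>lebesgue) < ennreal (c * r)"
      unfolding E_def by blast
    show "\<exists>\<delta>>0. \<forall>u v. a \<le> u \<and> u \<le> x \<and> x \<le> v \<and> v \<le> b \<and> u < v \<and> v - u < \<delta> \<longrightarrow>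
       integral {u..v} g \<le> (p + c) * (v - u)"
    proof (intro exI[of _ \<delta>] conjI allI impI \<open>\<delta> > 0\<close>, elim conjE)
      fix u v assume uv: "a \<le> u" "u \<le> x" "x \<le> v" "v \<le> b" "u < v" "v - u < \<delta>"
      have hI: "integrable (lebesgue_on {u..v}) h"
        using hi integrable_lebesgue_on_subset[of UNIV h "{u..v}"] by (simp add: lebesgue_on_UNIV_eq)
      have hI': "h integrable_on {u..v}"
        using hI by (simp add: integrable_on_lebesgue_on)
      have gI: "g integrable_on {u..v}"
        using integrable_on_sub_ivl[OF g] uv by auto
      have "ennreal (integral {u..v} h) = (\<integral>\<^sup>+y\<in>{u..v}. ennreal (h y) \<partial>lebesgue)"
        by (rule set_nn_integral_eq_integral[symmetric]) (use hI hn in auto)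
      \<comment> \<open>An interval containing \<open>x\<close> lies in the ball around
        \<open>x\<close> of radius its length; since the density bound is \<open>c\<close> times the
        radius, no factor is lost.\<close>
      also have "\<dots> \<le> (\<integral>\<^sup>+y\<in>cball x (v - u). ennreal (h y) \<partial>lebesgue)"
        using uv by (intro nn_integral_mono) (auto simp: indicator_def dist_real_def)
      also have "\<dots> < ennreal (c * (v - u))" using \<delta> uv by auto
      finally have 1: "integral {u..v} h < c * (v - u)"
        using uv \<open>0 < c\<close> by (simp add: ennreal_less_iff integral_nonneg hI' hn)
      have "integral {u..v} g \<le> integral {u..v} (\<lambda>y. p + h y)"
        using uv by (intro integral_le gI integrable_add hI' integrable_const_ivl) (auto simp: h_def max_def)
      also have "\<dots> = p * (v - u) + integral {u..v} h"
        using uv by (subst integral_add) (auto simp: hI')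
      finally show "integral {u..v} g \<le> (p + c) * (v - u)" using 1 by (simp add: algebra_simps)
    qed
  qed
qed

section \<open>Indefinite Lebesgue integrals and their derivatives\<close>

text \<open>Integrability is Lebesgue integrability, while the value is written with the gauge
  integral, which agrees with it here and has the richer calculus on intervals.\<close>

definition primitive_on :: "real \<Rightarrow> real \<Rightarrow> (real \<Rightarrow> real) \<Rightarrow> (real \<Rightarrow> real) \<Rightarrow> bool" where
  "primitive_on a b f g \<longleftrightarrow>
     integrable (lebesgue_on {a..b}) g \<and> (\<forall>t\<in>{a..b}. f t = f a + integral {a..t} g)"

lemma primitive_on_integrable: "primitive_on a b f g \<Longrightarrow> integrable (lebesgue_on {a..b}) g"
  unfolding primitive_on_def by blast

lemma primitive_on_eq: "primitive_on a b f g \<Longrightarrow> t \<in> {a..b} \<Longrightarrow> f t = f a + integral {a..t} g"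
  unfolding primitive_on_def by blast

lemma primitive_on_diff:
  assumes "primitive_on a b f g" "a \<le> u" "u \<le> v" "v \<le> b"
  shows "f v - f u = integral {u..v} g"
proof -
  have "g integrable_on {a..v}"
    using assms integrable_on_sub_ivl[OF primitive_on_integrable[OF assms(1)], of a v] by auto
  then have "integral {a..u} g + integral {u..v} g = integral {a..v} g"
    using assms by (intro Henstock_Kurzweil_Integration.integral_combine) auto
  moreover have "f u = f a + integral {a..u} g" "f v = f a + integral {a..v} g"
    using assms by (auto intro!: primitive_on_eq)
  ultimately show ?thesis by linarith
qed

lemma primitive_on_abs_diff_le:
  assumes p: "primitive_on a b f g" and "a \<le> u" "u \<le> v" "v \<le> b"
  shows "\<bar>f v - f u\<bar> \<le> integral {u..v} (\<lambda>x. \<bar>g x\<bar>)"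
proof -
  have g: "integrable (lebesgue_on {u..v}) g"
    using assms by (intro integrable_lebesgue_on_subset[OF primitive_on_integrable[OF p]]) auto
  then have "integrable (lebesgue_on {u..v}) (\<lambda>x. \<bar>g x\<bar>)" by simp
  with g show ?thesis
    unfolding primitive_on_diff[OF assms]
    by (intro integral_norm_bound_integral[of g "{u..v}" "\<lambda>x. \<bar>g x\<bar>", simplified])
      (simp_all add: integrable_on_lebesgue_on)
qed

text \<open>The mean value estimate is applied to \<open>g\<close> and to \<open>- g\<close>, with
  rational levels and with tolerances \<open>1 / (n + 1)\<close>, so that countably many null sets
  suffice. At a good point a rational just above the value gives an upper bound for the means of
  \<open>g\<close>, and the estimate for \<open>- g\<close> gives the lower one.\<close>

lemma primitive_on_AE_deriv:
  assumes p: "primitive_on a b f g"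
  shows "AE x\<in>{a..b} in lebesgue. (f has_real_derivative g x) (at x within {a..b})"
proof -
  have g: "integrable (lebesgue_on {a..b}) g" using p by (rule primitive_on_integrable)
  have "AE x in lebesgue. \<forall>q\<in>\<rat>. \<forall>n. x \<in> {a<..<b} \<and> h x \<le> q \<longrightarrow>
    (\<exists>\<delta>>0. \<forall>u v. a \<le> u \<and> u \<le> x \<and> x \<le> v \<and> v \<le> b \<and> u < v \<and> v - u < \<delta> \<longrightarrow>
       integral {u..v} h \<le> (q + 1 / real (Suc n)) * (v - u))"
    if h: "integrable (lebesgue_on {a..b}) h" for h :: "real \<Rightarrow> real"
    unfolding AE_ball_countable[OF countable_rat] AE_all_countable
    using AE_mean_le[OF h] by simp
  note AE = this[OF g] this[OF Bochner_Integration.integrable_minus[OF g]]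
  have upper: "\<exists>\<delta>>0. \<forall>u v. a \<le> u \<and> u \<le> x \<and> x \<le> v \<and> v \<le> b \<and> u < v \<and> v - u < \<delta> \<longrightarrow>
       integral {u..v} h \<le> (h x + e) * (v - u)"
    if "0 < e" and x: "x \<in> {a<..<b}" and
      *: "\<forall>q\<in>\<rat>. \<forall>n. x \<in> {a<..<b} \<and> h x \<le> q \<longrightarrow>
    (\<exists>\<delta>>0. \<forall>u v. a \<le> u \<and> u \<le> x \<and> x \<le> v \<and> v \<le> b \<and> u < v \<and> v - u < \<delta> \<longrightarrow>
       integral {u..v} h \<le> (q + 1 / real (Suc n)) * (v - u))"
    for h :: "real \<Rightarrow> real" and x e :: real
  proof -
    obtain q where q: "q \<in> \<rat>" "h x < q" "q < h x + e/2"
      using Rats_dense_in_real[of "h x" "h x + e/2"] \<open>0 < e\<close> by auto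
    obtain n where n: "1 / real (Suc n) < e/2"
      using nat_approx_posE[of "e/2"] \<open>0 < e\<close> by auto
    obtain \<delta> where "\<delta> > 0" and \<delta>: "\<And>u v. a \<le> u \<and> u \<le> x \<and> x \<le> v \<and> v \<le> b \<and> u < v \<and> v - u < \<delta> \<Longrightarrow>
       integral {u..v} h \<le> (q + 1 / real (Suc n)) * (v - u)"
      using *[rule_format, OF q(1), of n] x q(2) by auto
    have "(q + 1 / real (Suc n)) * (v - u) \<le> (h x + e) * (v - u)" if "u < v" for u v
      using that q n by (intro mult_right_mono) auto
    with \<delta> \<open>\<delta> > 0\<close> show ?thesis by (meson order_trans)
  qed
  \<comment> \<open>The mean value estimate speaks of interior points only.\<close>
  have ends: "AE x in lebesgue. x \<noteq> a \<and> x \<noteq> b"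
    by (intro AE_conjI) (auto intro!: AE_not_in[of "{_}", simplified])
  show ?thesis
    using AE ends
  proof (rule AE_mp[OF AE_conjI[OF _ AE_conjI] AE_I2], intro impI, elim conjE)
    fix x
    assume A1: "\<forall>q\<in>\<rat>. \<forall>n. x \<in> {a<..<b} \<and> g x \<le> q \<longrightarrow>
    (\<exists>\<delta>>0. \<forall>u v. a \<le> u \<and> u \<le> x \<and> x \<le> v \<and> v \<le> b \<and> u < v \<and> v - u < \<delta> \<longrightarrow>
       integral {u..v} g \<le> (q + 1 / real (Suc n)) * (v - u))"
      and A2: "\<forall>q\<in>\<rat>. \<forall>n. x \<in> {a<..<b} \<and> - g x \<le> q \<longrightarrow>
    (\<exists>\<delta>>0. \<forall>u v. a \<le> u \<and> u \<le> x \<and> x \<le> v \<and> v \<le> b \<and> u < v \<and> v - u < \<delta> \<longrightarrow>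
       integral {u..v} (\<lambda>x. - g x) \<le> (q + 1 / real (Suc n)) * (v - u))"
      and "x \<in> {a..b}" "x \<noteq> a" "x \<noteq> b"
    then have x: "x \<in> {a<..<b}" by auto
    show "(f has_real_derivative g x) (at x within {a..b})"
      unfolding has_field_derivative_def has_derivative_within_alt
    proof (intro conjI allI impI bounded_linear_mult_right)
      fix e :: real assume "0 < e"
      obtain d1 where "d1 > 0" and d1: "\<And>u v. a \<le> u \<and> u \<le> x \<and> x \<le> v \<and> v \<le> b \<and> u < v \<and> v - u < d1 \<Longrightarrow>
         integral {u..v} g \<le> (g x + e) * (v - u)"
        using upper[OF \<open>0 < e\<close> x A1] by blast
      obtain d2 where "d2 > 0" and d2: "\<And>u v. a \<le> u \<and> u \<le> x \<and> x \<le> v \<and> v \<le> b \<and> u < v \<and> v - u < d2 \<Longrightarrow>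
         - integral {u..v} g \<le> (- g x + e) * (v - u)"
        using upper[OF \<open>0 < e\<close> x A2] unfolding Henstock_Kurzweil_Integration.integral_neg by blast
      have key: "\<bar>f v - f u - g x * (v - u)\<bar> \<le> e * (v - u)"
        if uv: "a \<le> u" "u \<le> x" "x \<le> v" "v \<le> b" "u < v" "v - u < min d1 d2" for u v
      proof -
        have "f v - f u = integral {u..v} g" using primitive_on_diff[OF p] uv by auto
        with d1[of u v] d2[of u v] uv show ?thesis by (auto simp: algebra_simps abs_le_iff)
      qed
      show "\<exists>d>0. \<forall>y\<in>{a..b}. norm (y - x) < d \<longrightarrow> norm (f y - f x - g x * (y - x)) \<le> e * norm (y - x)"
      proof (intro exI[of _ "min d1 d2"] conjI ballI impI)
        fix y assume y: "y \<in> {a..b}" "norm (y - x) < min d1 d2"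
        consider "y < x" | "y = x" | "x < y" by linarith
        then show "norm (f y - f x - g x * (y - x)) \<le> e * norm (y - x)"
        proof cases
          case 1
          have "f y - f x - g x * (y - x) = - (f x - f y - g x * (x - y))" by (simp add: algebra_simps)
          then show ?thesis using key[of y x] y x 1 by (simp add: abs_minus_commute)
        next
          case 3
          then show ?thesis using key[of x y] y x by auto
        qed auto
      qed (use \<open>d1 > 0\<close> \<open>d2 > 0\<close> in auto)
    qed
  qed
qed

text \<open>The increments over a division are bounded by the integral of the absolute value of
  \<open>g\<close> over its union, and integrals of an integrable function are uniformly small on
  sets of small measure. The extension \<open>h\<close> by zero brings the question to the whole
  line.\<close>

lemma primitive_on_absolutely_continuous:
  assumes p: "primitive_on a b f g"
  shows "absolutely_continuous_on_ivl a b f"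
  unfolding absolutely_continuous_on_ivl_def
proof (intro allI impI)
  fix e :: real assume "0 < e"
  define h where "h = (\<lambda>x. indicat_real {a..b} x * \<bar>g x\<bar>)"
  have hi: "integrable lebesgue h"
  proof -
    have "integrable (lebesgue_on {a..b}) (\<lambda>x. \<bar>g x\<bar>)" using primitive_on_integrable[OF p] by simp
    then show ?thesis by (simp add: integrable_restrict_space h_def)
  qed
  obtain \<delta> where "0 < \<delta>" and \<delta>: "\<And>S. \<lbrakk>S \<in> sets lebesgue; emeasure lebesgue S < ennreal \<delta>\<rbrakk>
       \<Longrightarrow> (\<integral>\<^sup>+x\<in>S. ennreal (h x) \<partial>lebesgue) < ennreal e"
    using integral_uniformly_small[OF hi _ \<open>0 < e\<close>] by (auto simp: h_def)
  have "(\<Sum>k\<in>d. norm (f (Sup k) - f (Inf k))) < e"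
    if d: "d division_of \<Union>d" "\<Union>d \<subseteq> {a..b}" and len: "(\<Sum>k\<in>d. Sup k - Inf k) < \<delta>" for d
  proof -
    have fin: "finite d" using d(1) by auto
    have k: "\<exists>u v. k = {u..v} \<and> u \<le> v \<and> a \<le> u \<and> v \<le> b" if kd: "k \<in> d" for k
    proof -
      obtain u v where "k = cbox u v" "k \<noteq> {}" using division_ofD(3,4)[OF d(1) kd] by blast
      moreover have "k \<subseteq> {a..b}" using d(2) kd by blast
      ultimately show ?thesis by (intro exI[of _ u] exI[of _ v]) auto
    qed
    have km: "k \<in> sets lebesgue" "emeasure lebesgue k = ennreal (Sup k - Inf k)" "0 \<le> Sup k - Inf k"
      if "k \<in> d" for k
      using k[OF that] by auto
    have S: "\<Union>d \<in> sets lebesgue" using fin km by (intro sets.finite_Union) auto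
    have "emeasure lebesgue (\<Union>d) \<le> (\<Sum>k\<in>d. emeasure lebesgue k)"
      using emeasure_subadditive_finite[of d "\<lambda>k. k" lebesgue] fin km by (auto simp: image_subset_iff)
    also have "\<dots> = (\<Sum>k\<in>d. ennreal (Sup k - Inf k))"
      using km by (intro sum.cong) auto
    also have "\<dots> = ennreal (\<Sum>k\<in>d. Sup k - Inf k)"
      using km by (intro sum_ennreal) auto
    also have "\<dots> < ennreal \<delta>" using len \<open>0 < \<delta>\<close> by (simp add: ennreal_lessI)
    finally have "(\<integral>\<^sup>+x\<in>\<Union>d. ennreal (h x) \<partial>lebesgue) < ennreal e" using \<delta> S by blast
    moreover have hd: "integrable (lebesgue_on (\<Union>d)) h"
      using hi integrable_lebesgue_on_subset[of UNIV h "\<Union>d"] S by (simp add: lebesgue_on_UNIV_eq)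
    ultimately have "ennreal (integral (\<Union>d) h) < ennreal e"
      by (subst set_nn_integral_eq_integral[symmetric]) (auto simp: S h_def)
    then have "integral (\<Union>d) h < e"
      using \<open>0 < e\<close> by (subst (asm) ennreal_less_iff) (auto simp: h_def intro!: Henstock_Kurzweil_Integration.integral_nonneg integrable_on_lebesgue_on[OF hd S, unfolded h_def])
    have "(\<Sum>k\<in>d. norm (f (Sup k) - f (Inf k))) \<le> (\<Sum>k\<in>d. integral k h)"
    proof (rule sum_mono)
      fix k assume "k \<in> d"
      then obtain u v where uv: "k = {u..v}" "u \<le> v" "a \<le> u" "v \<le> b" using k by blast
      have "norm (f v - f u) \<le> integral {u..v} (\<lambda>x. \<bar>g x\<bar>)"
        using primitive_on_abs_diff_le[OF p] uv by auto
      also have "\<dots> = integral {u..v} h"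
        using uv by (intro Henstock_Kurzweil_Integration.integral_cong) (auto simp: h_def)
      finally show "norm (f (Sup k) - f (Inf k)) \<le> integral k h" using uv by simp
    qed
    also have "\<dots> = integral (\<Union>d) h"
      by (rule integral_combine_division_topdown[symmetric])
        (use integrable_on_lebesgue_on[OF hd S] d in auto)
    finally show ?thesis using \<open>integral (\<Union>d) h < e\<close> by simp
  qed
  then show "\<exists>\<delta>>0. \<forall>d. d division_of \<Union>d \<and> \<Union>d \<subseteq> {a..b} \<and> (\<Sum>k\<in>d. Sup k - Inf k) < \<delta> \<longrightarrow>
        (\<Sum>k\<in>d. norm (f (Sup k) - f (Inf k))) < e"
    using \<open>0 < \<delta>\<close> by blast
qed

section \<open>Absolutely continuous functions are primitives\<close>

text \<open>Families are sets of endpoint pairs instead of divisions, since pairs are easily cut at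
  a point, refined and united. Degenerate intervals are excluded, so distinct members are linearly
  ordered and a family over a one-point interval is empty.\<close>

definition nonoverlapping :: "real \<Rightarrow> real \<Rightarrow> (real \<times> real) set \<Rightarrow> bool" where
  "nonoverlapping a b P \<longleftrightarrow> finite P \<and> (\<forall>p\<in>P. a \<le> fst p \<and> fst p < snd p \<and> snd p \<le> b) \<and>
     (\<forall>p\<in>P. \<forall>q\<in>P. p \<noteq> q \<longrightarrow> snd p \<le> fst q \<or> snd q \<le> fst p)"

text \<open>For the identity this is the total length, so one functional serves both sides of the
  epsilon-delta condition.\<close>

definition incr_sum :: "(real \<Rightarrow> real) \<Rightarrow> (real \<times> real) set \<Rightarrow> real" where
  "incr_sum f P = (\<Sum>p\<in>P. \<bar>f (snd p) - f (fst p)\<bar>)"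

definition ac_pairs :: "real \<Rightarrow> real \<Rightarrow> (real \<Rightarrow> real) \<Rightarrow> bool" where
  "ac_pairs a b f \<longleftrightarrow> (\<forall>\<epsilon>>0. \<exists>\<delta>>0. \<forall>P. nonoverlapping a b P \<and> incr_sum (\<lambda>t. t) P < \<delta> \<longrightarrow> incr_sum f P < \<epsilon>)"

lemma ac_pairs_of_absolutely_continuous:
  assumes "absolutely_continuous_on_ivl a b f"
  shows "ac_pairs a b f"
  unfolding ac_pairs_def
proof (intro allI impI)
  fix e :: real assume "0 < e"
  then obtain \<delta> where "\<delta> > 0" and \<delta>: "\<And>d. d division_of \<Union>d \<and> \<Union>d \<subseteq> {a..b} \<and> (\<Sum>k\<in>d. Sup k - Inf k) < \<delta> \<Longrightarrow>
        (\<Sum>k\<in>d. norm (f (Sup k) - f (Inf k))) < e"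
    using assms unfolding absolutely_continuous_on_ivl_def by blast
  have "incr_sum f P < e" if P: "nonoverlapping a b P" and len: "incr_sum (\<lambda>t. t) P < \<delta>" for P
  proof -
    let ?I = "\<lambda>p::real\<times>real. {fst p..snd p}"
    have lt: "fst p < snd p" "a \<le> fst p" "snd p \<le> b" if "p \<in> P" for p using P that by (auto simp: nonoverlapping_def)
    have inj: "inj_on ?I P"
      by (rule inj_onI) (auto simp: Icc_eq_Icc prod_eq_iff dest!: lt(1))
    have d: "(?I ` P) division_of \<Union>(?I ` P)"
    proof (rule division_ofI)
      fix K1 K2 assume "K1 \<in> ?I ` P" "K2 \<in> ?I ` P" "K1 \<noteq> K2"
      then obtain p q where pq: "p \<in> P" "q \<in> P" "p \<noteq> q" "K1 = ?I p" "K2 = ?I q" by auto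
      then have "snd p \<le> fst q \<or> snd q \<le> fst p" using P unfolding nonoverlapping_def by blast
      then show "interior K1 \<inter> interior K2 = {}" using pq by auto
    next
      fix K assume "K \<in> ?I ` P"
      then show "K \<noteq> {}" "\<exists>a b. K = cbox a b" using lt by (auto simp: not_less intro!: less_imp_le)
    qed (use P in \<open>auto simp: nonoverlapping_def\<close>)
    have "(\<Sum>k\<in>?I ` P. norm (f (Sup k) - f (Inf k))) < e"
    proof (rule \<delta>, intro conjI d)
      show "\<Union> (?I ` P) \<subseteq> {a..b}" using lt by force
      have "(\<Sum>k\<in>?I ` P. Sup k - Inf k) = incr_sum (\<lambda>t. t) P"
        unfolding incr_sum_def sum.reindex[OF inj] by (rule sum.cong) (auto dest: lt(1))
      then show "(\<Sum>k\<in>?I ` P. Sup k - Inf k) < \<delta>" using len by simp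
    qed
    moreover have "(\<Sum>k\<in>?I ` P. norm (f (Sup k) - f (Inf k))) = incr_sum f P"
      unfolding incr_sum_def sum.reindex[OF inj] by (rule sum.cong) (auto dest: lt(1))
    ultimately show ?thesis by simp
  qed
  with \<open>\<delta> > 0\<close> show "\<exists>\<delta>>0. \<forall>P. nonoverlapping a b P \<and> incr_sum (\<lambda>t. t) P < \<delta> \<longrightarrow> incr_sum f P < e" by blast
qed

text \<open>Passing to open intervals makes the family truly disjoint without changing any
  length.\<close>

lemma sum_length_nonoverlapping:
  assumes P: "nonoverlapping a b P" and U: "U \<in> sets lborel" "\<And>p. p \<in> P \<Longrightarrow> {fst p<..<snd p} \<subseteq> U"
  shows "ennreal (incr_sum (\<lambda>t. t) P) \<le> emeasure lborel U"
proof -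
  have lt: "fst p < snd p" "a \<le> fst p" "snd p \<le> b" if "p \<in> P" for p using P that by (auto simp: nonoverlapping_def)
  have fin: "finite P" using P by (simp add: nonoverlapping_def)
  have disj: "disjoint_family_on (\<lambda>p. {fst p<..<snd p}) P"
    unfolding disjoint_family_on_def
  proof (intro ballI impI)
    fix p q assume "p \<in> P" "q \<in> P" "p \<noteq> q"
    then have "snd p \<le> fst q \<or> snd q \<le> fst p" using P unfolding nonoverlapping_def by blast
    then show "{fst p<..<snd p} \<inter> {fst q<..<snd q} = {}" by auto
  qed
  have "ennreal (incr_sum (\<lambda>t. t) P) = (\<Sum>p\<in>P. ennreal \<bar>snd p - fst p\<bar>)"
    by (simp add: incr_sum_def)
  also have "\<dots> = (\<Sum>p\<in>P. emeasure lborel {fst p<..<snd p})"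
    using lt(1) by (intro sum.cong) (auto simp: less_imp_le)
  also have "\<dots> = emeasure lborel (\<Union>p\<in>P. {fst p<..<snd p})"
    by (rule sum_emeasure) (use disj fin in auto)
  also have "\<dots> \<le> emeasure lborel U" using U by (intro emeasure_mono) auto
  finally show ?thesis .
qed

lemma sum_length_nonoverlapping_le:
  assumes P: "nonoverlapping a b P" and "a \<le> b"
  shows "incr_sum (\<lambda>t. t) P \<le> b - a"
proof -
  have "ennreal (incr_sum (\<lambda>t. t) P) \<le> emeasure lborel {a..b}"
  proof (rule sum_length_nonoverlapping[OF P])
    fix p assume "p \<in> P"
    then have "a \<le> fst p" "snd p \<le> b" using P by (auto simp: nonoverlapping_def)
    then show "{fst p<..<snd p} \<subseteq> {a..b}" by auto
  qed simp
  then show ?thesis using \<open>a \<le> b\<close> by simp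
qed

lemma nonoverlapping_mono: "nonoverlapping s t P \<Longrightarrow> a \<le> s \<Longrightarrow> t \<le> b \<Longrightarrow> nonoverlapping a b P"
  unfolding nonoverlapping_def by force

text \<open>Every interval is cut at \<open>s\<close>; for one that straddles \<open>s\<close> the
  triangle inequality bounds its increment by those of the two pieces. Both cutting maps stay
  injective because the members do not overlap.\<close>

lemma incr_sum_split:
  assumes P: "nonoverlapping a t P" and s: "a \<le> s" "s \<le> t"
  obtains A B where "nonoverlapping a s A" "nonoverlapping s t B" "incr_sum f P \<le> incr_sum f A + incr_sum f B"
proof -
  define A where "A = (\<lambda>p. (fst p, min (snd p) s)) ` {p\<in>P. fst p < s}"
  define B where "B = (\<lambda>p. (max (fst p) s, snd p)) ` {p\<in>P. s < snd p}"
  have fin: "finite P" using P by (simp add: nonoverlapping_def)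
  have lt: "fst p < snd p" "a \<le> fst p" "snd p \<le> t" if "p \<in> P" for p using P that by (auto simp: nonoverlapping_def)
  have ord: "snd p \<le> fst q \<or> snd q \<le> fst p" if "p \<in> P" "q \<in> P" "p \<noteq> q" for p q
    using P that unfolding nonoverlapping_def by blast
  have injA: "inj_on (\<lambda>p. (fst p, min (snd p) s)) {p\<in>P. fst p < s}"
  proof (rule inj_onI)
    fix p q assume "p \<in> {p\<in>P. fst p < s}" "q \<in> {p\<in>P. fst p < s}" "(fst p, min (snd p) s) = (fst q, min (snd q) s)"
    then show "p = q" using ord[of p q] lt[of p] lt[of q] by auto
  qed
  have injB: "inj_on (\<lambda>p. (max (fst p) s, snd p)) {p\<in>P. s < snd p}"
  proof (rule inj_onI)
    fix p q assume "p \<in> {p\<in>P. s < snd p}" "q \<in> {p\<in>P. s < snd p}" "(max (fst p) s, snd p) = (max (fst q) s, snd q)"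
    then show "p = q" using ord[of p q] lt[of p] lt[of q] by auto
  qed
  have "nonoverlapping a s A"
    unfolding nonoverlapping_def
  proof (intro conjI ballI impI)
    fix p q assume "p \<in> A" "q \<in> A" "p \<noteq> q"
    then obtain p' q' where "p' \<in> P" "q' \<in> P" "p' \<noteq> q'" "p = (fst p', min (snd p') s)" "q = (fst q', min (snd q') s)"
      by (auto simp: A_def)
    then show "snd p \<le> fst q \<or> snd q \<le> fst p" using ord[of p' q'] by auto
  qed (use fin lt in \<open>auto simp: A_def\<close>)
  moreover have "nonoverlapping s t B"
    unfolding nonoverlapping_def
  proof (intro conjI ballI impI)
    fix p q assume "p \<in> B" "q \<in> B" "p \<noteq> q"
    then obtain p' q' where "p' \<in> P" "q' \<in> P" "p' \<noteq> q'" "p = (max (fst p') s, snd p')" "q = (max (fst q') s, snd q')"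
      by (auto simp: B_def)
    then show "snd p \<le> fst q \<or> snd q \<le> fst p"
      using ord[of p' q'] lt[of p'] lt[of q'] \<open>p \<in> B\<close> \<open>q \<in> B\<close> by (auto simp: B_def)
  qed (use fin lt in \<open>auto simp: B_def\<close>)
  moreover have "incr_sum f P \<le> incr_sum f A + incr_sum f B"
  proof -
    have "incr_sum f P \<le> (\<Sum>p\<in>P. (if fst p < s then \<bar>f (min (snd p) s) - f (fst p)\<bar> else 0)
        + (if s < snd p then \<bar>f (snd p) - f (max (fst p) s)\<bar> else 0))"
      unfolding incr_sum_def
    proof (rule sum_mono)
      fix p assume "p \<in> P"
      then show "\<bar>f (snd p) - f (fst p)\<bar> \<le> (if fst p < s then \<bar>f (min (snd p) s) - f (fst p)\<bar> else 0)
        + (if s < snd p then \<bar>f (snd p) - f (max (fst p) s)\<bar> else 0)"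
        using lt[of p] by (auto simp: min_def max_def)
    qed
    also have "\<dots> = incr_sum f A + incr_sum f B"
      by (simp add: sum.distrib incr_sum_def A_def B_def sum.reindex[OF injA] sum.reindex[OF injB]
          sum.inter_filter[OF fin])
    finally show ?thesis .
  qed
  ultimately show ?thesis using that by blast
qed

section \<open>Total variation of an absolutely continuous function\<close>

definition variation :: "(real \<Rightarrow> real) \<Rightarrow> real \<Rightarrow> real \<Rightarrow> real" where
  "variation f a t = Sup (incr_sum f ` {P. nonoverlapping a t P})"

text \<open>The interval is consumed in steps of length \<open>\<delta>/2\<close>, each contributing
  less than 1 to any increment sum; the half makes a full step strictly shorter than
  \<open>\<delta>\<close>.\<close>

lemma ac_pairs_bounded_variation:
  assumes ac: "ac_pairs a b f"
  obtains M where "\<And>P. nonoverlapping a b P \<Longrightarrow> incr_sum f P \<le> M"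
proof -
  obtain \<delta> where "\<delta> > 0" and \<delta>: "\<And>P. nonoverlapping a b P \<Longrightarrow> incr_sum (\<lambda>t. t) P < \<delta> \<Longrightarrow> incr_sum f P < 1"
    using ac unfolding ac_pairs_def by (meson zero_less_one)
  have *: "incr_sum f P \<le> real n"
    if "nonoverlapping a t P" "t \<le> a + real n * (\<delta>/2)" "t \<le> b" for n t P
    using that
  proof (induction n arbitrary: t P)
    case 0
    then have "P = {}" by (force simp: nonoverlapping_def)
    then show ?case by (simp add: incr_sum_def)
  next
    case (Suc n)
    show ?case
    proof (cases "t \<le> a + real n * (\<delta>/2)")
      case True
      then show ?thesis using Suc.IH[OF Suc.prems(1)] Suc.prems by auto
    next
      case False
      define s where "s = a + real n * (\<delta>/2)"
      have s: "a \<le> s" "s \<le> t" using False \<open>\<delta> > 0\<close> by (auto simp: s_def)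
      obtain A B where AB: "nonoverlapping a s A" "nonoverlapping s t B" "incr_sum f P \<le> incr_sum f A + incr_sum f B"
        by (rule incr_sum_split[OF Suc.prems(1) s])
      have 1: "incr_sum f A \<le> real n" using Suc.IH[OF AB(1)] s Suc.prems by (auto simp: s_def)
      have "incr_sum (\<lambda>t. t) B \<le> t - s" by (rule sum_length_nonoverlapping_le[OF AB(2) s(2)])
      moreover have "t - s \<le> \<delta>/2" using Suc.prems(2) by (simp add: s_def algebra_simps add_divide_distrib)
      ultimately have "incr_sum (\<lambda>t. t) B < \<delta>" using \<open>\<delta> > 0\<close> by simp
      then have "incr_sum f B < 1" using AB(2) s Suc.prems by (intro \<delta> nonoverlapping_mono[OF AB(2)]) auto
      with 1 AB(3) show ?thesis by simp
    qed
  qed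
  obtain n where "b - a < real n * (\<delta>/2)" using reals_Archimedean3[of "\<delta>/2"] \<open>\<delta> > 0\<close> by (meson half_gt_zero)
  then have "incr_sum f P \<le> real n" if "nonoverlapping a b P" for P using *[OF that, of n] by simp
  then show ?thesis using that by blast
qed

lemma variation_bdd:
  assumes "ac_pairs a b f" "t \<le> b"
  shows "bdd_above (incr_sum f ` {P. nonoverlapping a t P})"
  using ac_pairs_bounded_variation[OF assms(1)] nonoverlapping_mono[of a t _ a b] assms(2)
  by (metis (mono_tags, lifting) bdd_above.I2 mem_Collect_eq order_refl)

lemma incr_sum_le_variation:
  assumes "ac_pairs a b f" "t \<le> b" "nonoverlapping a t P"
  shows "incr_sum f P \<le> variation f a t"
  unfolding variation_def using assms variation_bdd[OF assms(1,2)] by (intro cSUP_upper) auto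

lemma variation_le:
  assumes "\<And>P. nonoverlapping a t P \<Longrightarrow> incr_sum f P \<le> M"
  shows "variation f a t \<le> M"
proof -
  have "nonoverlapping a t {}" by (simp add: nonoverlapping_def)
  then show ?thesis unfolding variation_def using assms by (intro cSUP_least) auto
qed

text \<open>The interval from \<open>s\<close> to \<open>t\<close> can be appended to any family
  below \<open>s\<close>. So the variation is monotone and its increments dominate those of
  \<open>f\<close>.\<close>

lemma variation_add_increment:
  assumes ac: "ac_pairs a b f" and "a \<le> s" "s \<le> t" "t \<le> b"
  shows "variation f a s + \<bar>f t - f s\<bar> \<le> variation f a t"
proof (cases "s = t")
  case False
  have "variation f a s \<le> variation f a t - \<bar>f t - f s\<bar>"
  proof (rule variation_le)
    fix P assume P: "nonoverlapping a s P"
    have "nonoverlapping a t (insert (s, t) P)"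
      using P assms False unfolding nonoverlapping_def by force
    then have "incr_sum f (insert (s, t) P) \<le> variation f a t"
      using ac assms incr_sum_le_variation by blast
    moreover have "(s, t) \<notin> P" "finite P" using P assms False by (force simp: nonoverlapping_def)+
    ultimately show "incr_sum f P \<le> variation f a t - \<bar>f t - f s\<bar>"
      by (simp add: incr_sum_def)
  qed
  then show ?thesis by simp
qed simp

text \<open>Cut a nearly optimal family for \<open>t\<close> at \<open>s\<close>: the left part
  cannot exceed the variation up to \<open>s\<close>, so the right part carries the rest up to
  \<open>\<eta>\<close>.\<close>

lemma variation_increment_approx:
  assumes ac: "ac_pairs a b f" and st: "a \<le> s" "s \<le> t" "t \<le> b" and "0 < \<eta>"
  obtains Q where "nonoverlapping s t Q" "variation f a t - variation f a s \<le> incr_sum f Q + \<eta>"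
proof -
  have "\<exists>P. nonoverlapping a t P \<and> variation f a t - \<eta> \<le> incr_sum f P"
    using variation_le[of a t f "variation f a t - \<eta>"] \<open>0 < \<eta>\<close> by (metis diff_add_cancel less_add_same_cancel1 linorder_not_less nle_le)
  then obtain P where P: "nonoverlapping a t P" "variation f a t - \<eta> \<le> incr_sum f P" by blast
  obtain A B where AB: "nonoverlapping a s A" "nonoverlapping s t B" "incr_sum f P \<le> incr_sum f A + incr_sum f B"
    by (rule incr_sum_split[OF P(1) st(1,2)])
  have "incr_sum f A \<le> variation f a s" using incr_sum_le_variation[OF ac _ AB(1)] st by simp
  then show ?thesis using that[OF AB(2)] AB(3) P(2) by simp
qed

text \<open>Each member of \<open>P\<close> is replaced by a family inside it whose
  \<open>f\<close>-increments nearly exhaust the increment of the variation. The union is again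
  nonoverlapping and no longer than \<open>P\<close>, so absolute continuity of \<open>f\<close>
  applies to it.\<close>

lemma ac_pairs_variation:
  assumes ac: "ac_pairs a b f"
  shows "ac_pairs a b (variation f a)"
  unfolding ac_pairs_def
proof (intro allI impI)
  fix e :: real assume "0 < e"
  then obtain \<delta> where "\<delta> > 0" and \<delta>: "\<And>P. nonoverlapping a b P \<Longrightarrow> incr_sum (\<lambda>t. t) P < \<delta> \<Longrightarrow> incr_sum f P < e/2"
    using ac unfolding ac_pairs_def by (meson half_gt_zero)
  have "incr_sum (variation f a) P < e" if P: "nonoverlapping a b P" and len: "incr_sum (\<lambda>t. t) P < \<delta>" for P
  proof -
    have fin: "finite P" using P by (simp add: nonoverlapping_def)
    have lt: "fst p < snd p" "a \<le> fst p" "snd p \<le> b" if "p \<in> P" for p using P that by (auto simp: nonoverlapping_def)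
    have ord: "snd p \<le> fst q \<or> snd q \<le> fst p" if "p \<in> P" "q \<in> P" "p \<noteq> q" for p q
      using P that unfolding nonoverlapping_def by blast
    \<comment> \<open>The approximation errors of all members of \<open>P\<close> together stay
      within \<open>e/2\<close>; the added 1 avoids division by zero for empty
      \<open>P\<close>.\<close>
    define \<eta> where "\<eta> = e / (2 * (real (card P) + 1))"
    have "\<eta> > 0" using \<open>0 < e\<close> by (simp add: \<eta>_def)
    have "\<exists>Q. nonoverlapping (fst p) (snd p) Q \<and> variation f a (snd p) - variation f a (fst p) \<le> incr_sum f Q + \<eta>"
      if "p \<in> P" for p
      using variation_increment_approx[OF ac _ _ _ \<open>\<eta> > 0\<close>, of "fst p" "snd p"] lt[OF that] by (metis less_imp_le)
    then obtain Q where Q: "\<And>p. p \<in> P \<Longrightarrow> nonoverlapping (fst p) (snd p) (Q p)"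
      and QV: "\<And>p. p \<in> P \<Longrightarrow> variation f a (snd p) - variation f a (fst p) \<le> incr_sum f (Q p) + \<eta>"
      by metis
    have Qf: "finite (Q p)" if "p \<in> P" for p using Q[OF that] by (simp add: nonoverlapping_def)
    have Qin: "fst p \<le> fst q" "fst q < snd q" "snd q \<le> snd p" if "p \<in> P" "q \<in> Q p" for p q
      using Q[OF that(1)] that(2) by (auto simp: nonoverlapping_def)
    have disj: "Q p \<inter> Q p' = {}" if "p \<in> P" "p' \<in> P" "p \<noteq> p'" for p p'
    proof -
      have False if q: "q \<in> Q p" "q \<in> Q p'" for q
        using ord[OF \<open>p \<in> P\<close> \<open>p' \<in> P\<close> \<open>p \<noteq> p'\<close>] Qin[OF \<open>p \<in> P\<close> q(1)] Qin[OF \<open>p' \<in> P\<close> q(2)] by linarith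
      then show ?thesis by blast
    qed
    have U: "nonoverlapping a b (\<Union>p\<in>P. Q p)"
      unfolding nonoverlapping_def
    proof (intro conjI ballI impI)
      fix q assume "q \<in> (\<Union>p\<in>P. Q p)"
      then obtain p where "p \<in> P" "q \<in> Q p" by blast
      then show "a \<le> fst q" "fst q < snd q" "snd q \<le> b" using Qin[of p q] lt[of p] by linarith+
    next
      fix q q' assume "q \<in> (\<Union>p\<in>P. Q p)" "q' \<in> (\<Union>p\<in>P. Q p)" "q \<noteq> q'"
      then obtain p p' where pp: "p \<in> P" "q \<in> Q p" "p' \<in> P" "q' \<in> Q p'" by blast
      show "snd q \<le> fst q' \<or> snd q' \<le> fst q"
      proof (cases "p = p'")
        case True
        then show ?thesis using Q[OF pp(1)] pp \<open>q \<noteq> q'\<close> unfolding nonoverlapping_def by blast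
      next
        case False
        then show ?thesis using ord[OF pp(1,3)] Qin[OF pp(1,2)] Qin[OF pp(3,4)] by linarith
      qed
    qed (use fin Qf in auto)
    have sumU: "incr_sum g (\<Union>p\<in>P. Q p) = (\<Sum>p\<in>P. incr_sum g (Q p))" for g
      unfolding incr_sum_def using fin Qf disj by (intro sum.UNION_disjoint) auto
    have "incr_sum (\<lambda>t. t) (\<Union>p\<in>P. Q p) \<le> incr_sum (\<lambda>t. t) P"
      unfolding sumU incr_sum_def[of _ P]
      using sum_length_nonoverlapping_le[OF Q] lt by (intro sum_mono) (fastforce simp: less_imp_le)
    then have small: "incr_sum f (\<Union>p\<in>P. Q p) < e/2" using \<delta>[OF U] len by simp
    have "incr_sum (variation f a) P \<le> (\<Sum>p\<in>P. incr_sum f (Q p) + \<eta>)"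
      unfolding incr_sum_def[of _ P]
    proof (rule sum_mono)
      fix p assume p: "p \<in> P"
      then show "\<bar>variation f a (snd p) - variation f a (fst p)\<bar> \<le> incr_sum f (Q p) + \<eta>"
        using QV[OF p] variation_add_increment[OF ac, of "fst p" "snd p"] lt[OF p] by auto
    qed
    also have "\<dots> = incr_sum f (\<Union>p\<in>P. Q p) + real (card P) * \<eta>" by (simp add: sumU sum.distrib)
    also have "\<dots> < e"
    proof -
      have "real (card P) * \<eta> \<le> e/2" using \<open>0 < e\<close> by (simp add: \<eta>_def field_simps)
      then show ?thesis using small by simp
    qed
    finally show ?thesis .
  qed
  with \<open>\<delta> > 0\<close> show "\<exists>\<delta>>0. \<forall>P. nonoverlapping a b P \<and> incr_sum (\<lambda>t. t) P < \<delta> \<longrightarrow> incr_sum (variation f a) P < e" by blast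
qed

section \<open>Monotone functions and their Stieltjes measures\<close>

text \<open>Enclose \<open>N\<close> in an open set \<open>U\<close> of length below
  \<open>\<delta>\<close>. A finite union of boxes inside \<open>U\<close> splits into
  nonoverlapping intervals of total length below \<open>\<delta>\<close>, and its measure is at most
  their increment sum, hence below \<open>e\<close>. Continuity from below carries the bound to
  \<open>U\<close>.\<close>

lemma mono_ac_pairs_null:
  fixes F :: "real \<Rightarrow> real"
  assumes mono: "\<And>x y. x \<le> y \<Longrightarrow> F x \<le> F y" and cont: "continuous_on UNIV F"
    and ac: "ac_pairs a b F"
    and N: "N \<in> null_sets lborel" "N \<subseteq> {a<..<b}"
  shows "N \<in> null_sets (interval_measure F)"
proof -
  let ?\<mu> = "interval_measure F"
  have Icc: "emeasure ?\<mu> {u..v} = ennreal (F v - F u)" if "u \<le> v" for u v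
    using emeasure_interval_measure_Icc[OF that mono cont] by simp
  have "emeasure ?\<mu> N \<le> ennreal e" if "0 < e" for e
  proof -
    obtain \<delta> where "\<delta> > 0" and \<delta>: "\<And>P. nonoverlapping a b P \<Longrightarrow> incr_sum (\<lambda>t. t) P < \<delta> \<Longrightarrow> incr_sum F P < e"
      using ac \<open>0 < e\<close> unfolding ac_pairs_def by meson
    have Nl: "N \<in> null_sets lebesgue" using N(1) by (rule null_sets_completionI)
    obtain T where T: "open T" "N \<subseteq> T" "emeasure lebesgue (T - N) < ennreal \<delta>"
      using sets_lebesgue_outer_open[of N \<delta>] Nl \<open>\<delta> > 0\<close> by blast
    \<comment> \<open>Absolute continuity of \<open>F\<close> is known only for intervals inside
      \<open>[a,b]\<close>.\<close>
    define U where "U = T \<inter> {a<..<b}"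
    have "open U" "N \<subseteq> U" using T N(2) by (auto simp: U_def)
    have "emeasure lborel U = emeasure lebesgue U" using \<open>open U\<close> by simp
    also have "\<dots> \<le> emeasure lebesgue T" using T by (intro emeasure_mono) (auto simp: U_def)
    also have "\<dots> = emeasure lebesgue (T - N)" using Nl T(1) by (intro emeasure_Diff_null_set[symmetric]) auto
    finally have small: "emeasure lborel U < ennreal \<delta>" using T(3) by simp
    obtain \<D> where \<D>: "countable \<D>" "\<D> \<subseteq> Pow U" "\<And>X. X \<in> \<D> \<Longrightarrow> \<exists>a b. X = cbox a b" "\<Union>\<D> = U"
      using open_countable_Union_open_cbox[OF \<open>open U\<close>] by metis
    have bound: "emeasure ?\<mu> (\<Union>\<F>) \<le> ennreal e" if \<F>: "finite \<F>" "\<F> \<subseteq> \<D>" for \<F>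
    proof -
      obtain p where p: "p division_of (\<Union>\<F>)"
        using elementary_unions_intervals[OF \<F>(1)] \<D>(3) \<F>(2) by (metis subsetD)
      have pf: "finite p" using p by auto
      have k: "\<exists>u v. k = {u..v} \<and> u \<le> v" if kp: "k \<in> p" for k
      proof -
        obtain u v where "k = cbox u v" "k \<noteq> {}" using division_ofD(3,4)[OF p kp] by blast
        then show ?thesis by (intro exI[of _ u] exI[of _ v]) auto
      qed
      have kU: "k \<subseteq> U" if "k \<in> p" for k
        using division_ofD(2)[OF p that] \<F>(2) \<D>(2) by blast
      have I: "Inf k \<le> Sup k" "k = {Inf k..Sup k}" if "k \<in> p" for k using k[OF that] by auto
      \<comment> \<open>A division may contain single points; they carry no increment and are
        dropped to meet \<open>nonoverlapping\<close>.\<close>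
      define q where "q = {k\<in>p. Inf k < Sup k}"
      define P where "P = (\<lambda>k. (Inf k, Sup k)) ` q"
      have inj: "inj_on (\<lambda>k. (Inf k, Sup k)) q"
        by (rule inj_onI) (metis (no_types, lifting) I(2) Pair_inject mem_Collect_eq q_def)
      have novl: "nonoverlapping a b P"
        unfolding nonoverlapping_def
      proof (intro conjI ballI impI)
        fix x y assume "x \<in> P" "y \<in> P" "x \<noteq> y"
        then obtain k l where kl: "k \<in> p" "l \<in> p" "k \<noteq> l" "x = (Inf k, Sup k)" "y = (Inf l, Sup l)"
          "Inf k < Sup k" "Inf l < Sup l"
          by (auto simp: P_def q_def)
        have "interior {Inf k..Sup k} \<inter> interior {Inf l..Sup l} = {}"
          using division_ofD(5)[OF p kl(1-3)] I(2)[OF kl(1)] I(2)[OF kl(2)] by metis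
        then have "{max (Inf k) (Inf l)<..<min (Sup k) (Sup l)} = {}"
          by (auto simp: set_eq_iff)
        then show "snd x \<le> fst y \<or> snd y \<le> fst x"
          using kl(4-7) by (auto simp: min_def max_def split: if_splits)
      next
        fix x assume "x \<in> P"
        then obtain k where kk: "k \<in> p" "x = (Inf k, Sup k)" "Inf k < Sup k" by (auto simp: P_def q_def)
        have "{Inf k..Sup k} \<subseteq> {a<..<b}" using kU[OF kk(1)] I(2)[OF kk(1)] by (auto simp: U_def)
        then have "Inf k \<in> {a<..<b}" "Sup k \<in> {a<..<b}" using kk(3) by (meson atLeastAtMost_iff less_imp_le order_refl subsetD)+
        then show "a \<le> fst x" "snd x \<le> b" "fst x < snd x" using kk by auto
      qed (simp add: P_def q_def pf)
      have "ennreal (incr_sum (\<lambda>t. t) P) \<le> emeasure lborel U"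
      proof (rule sum_length_nonoverlapping[OF novl])
        fix x assume "x \<in> P"
        then obtain k where kk: "k \<in> p" "x = (Inf k, Sup k)" by (auto simp: P_def q_def)
        then show "{fst x<..<snd x} \<subseteq> U" using kU[OF kk(1)] I(2)[OF kk(1)] by (auto 0 3)
      qed (simp add: \<open>open U\<close>)
      then have "ennreal (incr_sum (\<lambda>t. t) P) < ennreal \<delta>" using small by simp
      then have "incr_sum (\<lambda>t. t) P < \<delta>" by (simp add: ennreal_less_iff incr_sum_def sum_nonneg)
      then have sF: "incr_sum F P < e" using \<delta> novl by blast
      have "emeasure ?\<mu> (\<Union>\<F>) = emeasure ?\<mu> (\<Union>k\<in>p. k)" using division_ofD(6)[OF p] by simp
      also have "\<dots> \<le> (\<Sum>k\<in>p. emeasure ?\<mu> k)"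
      proof (intro emeasure_subadditive_finite pf)
        show "(\<lambda>k. k) ` p \<subseteq> sets ?\<mu>" using I(2) by (auto, metis atLeastAtMost_borel)
      qed
      also have "\<dots> = (\<Sum>k\<in>p. ennreal (F (Sup k) - F (Inf k)))"
        by (intro sum.cong refl) (metis I Icc)
      also have "\<dots> = ennreal (\<Sum>k\<in>p. F (Sup k) - F (Inf k))"
        using I(1) mono by (intro sum_ennreal) auto
      also have "(\<Sum>k\<in>p. F (Sup k) - F (Inf k)) = (\<Sum>k\<in>q. F (Sup k) - F (Inf k))"
        using I(1) by (intro sum.mono_neutral_right pf) (auto simp: q_def, metis order_le_less)
      also have "\<dots> = incr_sum F P"
        unfolding incr_sum_def P_def sum.reindex[OF inj]
        by (intro sum.cong refl) (simp add: q_def mono less_imp_le)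
      finally show ?thesis using sF by (meson ennreal_leI less_imp_le order_trans)
    qed
    have "emeasure ?\<mu> U \<le> ennreal e"
    proof (cases "\<D> = {}")
      case True
      then show ?thesis using \<D>(4) by auto
    next
      case False
      then obtain X :: "nat \<Rightarrow> real set" where X: "\<D> = range X" using \<D>(1) range_from_nat_into by metis
      have Xs: "X i \<in> sets ?\<mu>" for i using \<D>(3)[of "X i"] X by auto
      have "U = (\<Union>n. \<Union>i<n. X i)" using \<D>(4) X by auto
      also have "emeasure ?\<mu> \<dots> = (SUP n. emeasure ?\<mu> (\<Union>i<n. X i))"
        using Xs by (intro SUP_emeasure_incseq[symmetric]) (auto simp: incseq_def intro: order_less_le_trans)
      also have "\<dots> \<le> ennreal e"
      proof (rule SUP_least)
        fix n show "emeasure ?\<mu> (\<Union>i<n. X i) \<le> ennreal e"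
          using bound[of "X ` {..<n}"] X by auto
      qed
      finally show ?thesis .
    qed
    moreover have "emeasure ?\<mu> N \<le> emeasure ?\<mu> U"
      using \<open>N \<subseteq> U\<close> \<open>open U\<close> by (intro emeasure_mono) auto
    ultimately show ?thesis by simp
  qed
  then have "emeasure ?\<mu> N = 0"
    by (metis ennreal_le_epsilon add_0 le_zero_eq)
  then show ?thesis using N(1) by (auto simp: null_sets_def)
qed

lemma ac_pairs_continuous_on:
  assumes ac: "ac_pairs a b F"
  shows "continuous_on {a..b} F"
  unfolding continuous_on_iff
proof (intro ballI allI impI)
  fix x e :: real assume x: "x \<in> {a..b}" and "0 < e"
  obtain \<delta> where "\<delta> > 0" and \<delta>: "\<And>P. nonoverlapping a b P \<Longrightarrow> incr_sum (\<lambda>t. t) P < \<delta> \<Longrightarrow> incr_sum F P < e"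
    using ac \<open>0 < e\<close> unfolding ac_pairs_def by meson
  have *: "\<bar>F v - F u\<bar> < e" if "a \<le> u" "u < v" "v \<le> b" "v - u < \<delta>" for u v
    using \<delta>[of "{(u, v)}"] that by (simp add: nonoverlapping_def incr_sum_def)
  have "dist (F x') (F x) < e" if "x' \<in> {a..b}" "dist x' x < \<delta>" for x'
  proof (cases x' x rule: linorder_cases)
    case less
    then show ?thesis using *[of x' x] that x by (simp add: dist_real_def abs_minus_commute)
  next
    case greater
    then show ?thesis using *[of x x'] that x by (simp add: dist_real_def)
  qed (use \<open>0 < e\<close> in simp)
  with \<open>\<delta> > 0\<close> show "\<exists>d>0. \<forall>x'\<in>{a..b}. dist x' x < d \<longrightarrow> dist (F x') (F x) < e" by blast
qed

lemma mono_ac_pairs_primitive_on: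
  assumes mono: "\<And>x y. a \<le> x \<Longrightarrow> x \<le> y \<Longrightarrow> y \<le> b \<Longrightarrow> F x \<le> F y"
    and ac: "ac_pairs a b F" and "a \<le> b"
  obtains g where "primitive_on a b F g"
proof -
  \<comment> \<open>\<open>interval_measure\<close> wants a monotone function on the whole line;
    constant continuation keeps monotonicity and continuity.\<close>
  define G where "G = (\<lambda>t. F (max a (min b t)))"
  have GF: "G t = F t" if "t \<in> {a..b}" for t using that by (simp add: G_def)
  have Gm: "G x \<le> G y" if "x \<le> y" for x y
    using that \<open>a \<le> b\<close> unfolding G_def by (intro mono) auto
  have Gc: "continuous_on UNIV G"
    unfolding G_def using \<open>a \<le> b\<close>
    by (intro continuous_on_compose2[OF ac_pairs_continuous_on[OF ac]] continuous_intros) auto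
  have Gac: "ac_pairs a b G"
  proof -
    have "incr_sum G P = incr_sum F P" if "nonoverlapping a b P" for P
      unfolding incr_sum_def
    proof (rule sum.cong[OF refl])
      fix p assume "p \<in> P"
      then have "fst p \<in> {a..b}" "snd p \<in> {a..b}" using that by (force simp: nonoverlapping_def)+
      then show "\<bar>G (snd p) - G (fst p)\<bar> = \<bar>F (snd p) - F (fst p)\<bar>" by (simp only: GF)
    qed
    then show ?thesis using ac unfolding ac_pairs_def by metis
  qed
  define \<mu> where "\<mu> = interval_measure G"
  have [simp]: "sets \<mu> = sets borel" by (simp add: \<mu>_def)
  have Icc: "emeasure \<mu> {u..v} = ennreal (G v - G u)" if "u \<le> v" for u v
    using emeasure_interval_measure_Icc[OF that Gm Gc] by (simp add: \<mu>_def)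
  \<comment> \<open>The constant continuation puts no mass outside the open interval, so null sets
    need to be examined only inside it.\<close>
  have left: "{..a} \<in> null_sets \<mu>"
  proof -
    have "{..a} = (\<Union>n::nat. {a - real n..a})"
      by (auto simp: set_eq_iff) (metis diff_le_eq real_arch_simple diff_diff_eq2 diff_add_cancel add.commute)
    moreover have "(\<Union>n::nat. {a - real n..a}) \<in> null_sets \<mu>"
    proof (rule null_sets_UN)
      fix n :: nat
      have "emeasure \<mu> {a - real n..a} = 0"
        using \<open>a \<le> b\<close> by (subst Icc) (auto simp: G_def)
      then show "{a - real n..a} \<in> null_sets \<mu>" by (auto simp: null_sets_def)
    qed
    ultimately show ?thesis by simp
  qed
  have right: "{b..} \<in> null_sets \<mu>"
  proof -
    have "{b..} = (\<Union>n::nat. {b..b + real n})"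
      by (auto simp: set_eq_iff) (metis diff_le_eq real_arch_simple add.commute)
    moreover have "(\<Union>n::nat. {b..b + real n}) \<in> null_sets \<mu>"
    proof (rule null_sets_UN)
      fix n :: nat
      have "emeasure \<mu> {b..b + real n} = 0"
        using \<open>a \<le> b\<close> by (subst Icc) (auto simp: G_def)
      then show "{b..b + real n} \<in> null_sets \<mu>" by (auto simp: null_sets_def)
    qed
    ultimately show ?thesis by simp
  qed
  have "absolutely_continuous lborel \<mu>"
    unfolding absolutely_continuous_def
  proof
    fix N :: "real set" assume N: "N \<in> null_sets lborel"
    have "N \<inter> {a<..<b} \<in> null_sets lborel" using N by (intro null_set_Int2) auto
    then have "N \<inter> {a<..<b} \<in> null_sets \<mu>"
      unfolding \<mu>_def by (intro mono_ac_pairs_null[OF Gm Gc Gac]) auto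
    then have "N \<inter> {a<..<b} \<union> {..a} \<union> {b..} \<in> null_sets \<mu>" using left right by auto
    then show "N \<in> null_sets \<mu>"
      by (rule null_sets_subset) (use N in auto)
  qed
  then obtain h where hm [measurable]: "h \<in> borel_measurable lborel" and h: "density lborel h = \<mu>"
    using sigma_finite_measure.Radon_Nikodym[OF lborel.sigma_finite_measure_axioms, of \<mu>] by auto
  have hI: "(\<integral>\<^sup>+x\<in>{a..t}. h x \<partial>lborel) = ennreal (F t - F a)" if "t \<in> {a..b}" for t
  proof -
    have "(\<integral>\<^sup>+x\<in>{a..t}. h x \<partial>lborel) = emeasure \<mu> {a..t}"
      unfolding h[symmetric] by (subst emeasure_density) auto
    also have "\<dots> = ennreal (F t - F a)" using that by (subst Icc) (auto simp: GF)
    finally show ?thesis .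
  qed
  have fin: "AE x in lborel. x \<in> {a..b} \<longrightarrow> h x \<noteq> \<infinity>"
  proof -
    have "AE x in lborel. h x * indicator {a..b} x \<noteq> \<infinity>"
      using hI[of b] \<open>a \<le> b\<close> by (intro nn_integral_PInf_AE) auto
    then show ?thesis by eventually_elim auto
  qed
  \<comment> \<open>The density is extended-real valued; it is finite almost everywhere on
    \<open>[a,b]\<close> because its integral there is \<open>F b - F a\<close>.\<close>
  define g where "g = (\<lambda>x. enn2real (h x))"
  have gm [measurable]: "g \<in> borel_measurable borel" using hm unfolding g_def by simp
  have gI: "(\<integral>\<^sup>+x\<in>{a..t}. ennreal (g x) \<partial>lebesgue) = ennreal (F t - F a)" if t: "t \<in> {a..b}" for t
  proof -
    have "(\<integral>\<^sup>+x\<in>{a..t}. ennreal (g x) \<partial>lebesgue) = (\<integral>\<^sup>+x\<in>{a..t}. ennreal (g x) \<partial>lborel)"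
      by (rule nn_integral_completion)
    also have "\<dots> = (\<integral>\<^sup>+x\<in>{a..t}. h x \<partial>lborel)"
    proof (rule nn_integral_cong_AE, use fin in eventually_elim)
      fix x assume "x \<in> {a..b} \<longrightarrow> h x \<noteq> \<infinity>"
      then show "ennreal (g x) * indicator {a..t} x = h x * indicator {a..t} x"
        using t by (auto simp: g_def indicator_def less_top ennreal_enn2real)
    qed
    finally show ?thesis using hI[OF t] by simp
  qed
  have gint: "integrable (lebesgue_on {a..b}) g"
  proof (rule integrableI_nonneg)
    show "g \<in> borel_measurable (lebesgue_on {a..b})"
      using gm by (simp add: measurable_restrict_space1 measurable_completion)
    have "(\<integral>\<^sup>+x. ennreal (g x) \<partial>lebesgue_on {a..b}) = (\<integral>\<^sup>+x\<in>{a..b}. ennreal (g x) \<partial>lebesgue)"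
      by (subst nn_integral_restrict_space) auto
    then show "(\<integral>\<^sup>+x. ennreal (g x) \<partial>lebesgue_on {a..b}) < \<infinity>"
      using gI[of b] \<open>a \<le> b\<close> by simp
  qed (simp add: g_def)
  have "F t = F a + integral {a..t} g" if t: "t \<in> {a..b}" for t
  proof -
    have gt: "integrable (lebesgue_on {a..t}) g"
      using t by (intro integrable_lebesgue_on_subset[OF gint]) auto
    have "ennreal (integral {a..t} g) = ennreal (F t - F a)"
      by (subst gI[OF t, symmetric], rule set_nn_integral_eq_integral[symmetric, OF _ gt]) (auto simp: g_def)
    moreover have "0 \<le> integral {a..t} g"
      by (intro Henstock_Kurzweil_Integration.integral_nonneg integrable_on_lebesgue_on[OF gt]) (auto simp: g_def)
    moreover have "F a \<le> F t" using t by (intro mono) auto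
    ultimately show ?thesis by simp
  qed
  with gint have "primitive_on a b F g" unfolding primitive_on_def by blast
  then show ?thesis by (rule that)
qed

text \<open>Jordan decomposition \<open>f = V - (V - f)\<close>: both terms are nondecreasing, as
  increments of \<open>V\<close> dominate those of \<open>f\<close>, and both are absolutely
  continuous, since an increment of \<open>V - f\<close> is at most twice that of
  \<open>V\<close>.\<close>

theorem absolutely_continuous_imp_primitive_on:
  assumes "absolutely_continuous_on_ivl a b f" "a \<le> b"
  obtains g where "primitive_on a b f g"
proof -
  let ?V = "variation f a"
  have ac: "ac_pairs a b f" using assms(1) by (rule ac_pairs_of_absolutely_continuous)
  have inc: "?V s + \<bar>f t - f s\<bar> \<le> ?V t" if "a \<le> s" "s \<le> t" "t \<le> b" for s t
    using variation_add_increment[OF ac that] .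
  have acV: "ac_pairs a b ?V" by (rule ac_pairs_variation[OF ac])
  have "ac_pairs a b (\<lambda>t. ?V t - f t)"
    unfolding ac_pairs_def
  proof (intro allI impI)
    fix e :: real assume "0 < e"
    then obtain \<delta> where "\<delta> > 0" and \<delta>: "\<And>P. nonoverlapping a b P \<Longrightarrow> incr_sum (\<lambda>t. t) P < \<delta> \<Longrightarrow> incr_sum ?V P < e/2"
      using acV unfolding ac_pairs_def by (meson half_gt_zero)
    have "incr_sum (\<lambda>t. ?V t - f t) P \<le> 2 * incr_sum ?V P" if P: "nonoverlapping a b P" for P
      unfolding incr_sum_def sum_distrib_left
    proof (rule sum_mono)
      fix p assume "p \<in> P"
      then have "a \<le> fst p" "fst p \<le> snd p" "snd p \<le> b" using P by (auto simp: nonoverlapping_def less_imp_le)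
      from inc[OF this] show "\<bar>?V (snd p) - f (snd p) - (?V (fst p) - f (fst p))\<bar> \<le> 2 * \<bar>?V (snd p) - ?V (fst p)\<bar>"
        by (smt (verit))
    qed
    with \<delta> have "\<forall>P. nonoverlapping a b P \<and> incr_sum (\<lambda>t. t) P < \<delta> \<longrightarrow> incr_sum (\<lambda>t. ?V t - f t) P < e" by fastforce
    then show "\<exists>\<delta>>0. \<forall>P. nonoverlapping a b P \<and> incr_sum (\<lambda>t. t) P < \<delta> \<longrightarrow> incr_sum (\<lambda>t. ?V t - f t) P < e"
      using \<open>\<delta> > 0\<close> by blast
  qed
  then obtain g1 where g1: "primitive_on a b (\<lambda>t. ?V t - f t) g1"
    using inc \<open>a \<le> b\<close> by (rule_tac mono_ac_pairs_primitive_on[of a b "\<lambda>t. ?V t - f t"]) (fastforce+)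
  obtain g2 where g2: "primitive_on a b ?V g2"
    using inc \<open>a \<le> b\<close> by (rule_tac mono_ac_pairs_primitive_on[of a b ?V, OF _ acV]) (fastforce+)
  have "primitive_on a b f (\<lambda>t. g2 t - g1 t)"
    unfolding primitive_on_def
  proof (intro conjI ballI)
    show "integrable (lebesgue_on {a..b}) (\<lambda>t. g2 t - g1 t)"
      using primitive_on_integrable[OF g1] primitive_on_integrable[OF g2] by simp
    fix t assume t: "t \<in> {a..b}"
    have "g1 integrable_on {a..t}" "g2 integrable_on {a..t}"
      using integrable_on_sub_ivl[OF primitive_on_integrable[OF g1], of a t]
        integrable_on_sub_ivl[OF primitive_on_integrable[OF g2], of a t] t by auto
    then have "integral {a..t} (\<lambda>t. g2 t - g1 t) = integral {a..t} g2 - integral {a..t} g1"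
      by (rule_tac Henstock_Kurzweil_Integration.integral_diff)
    then show "f t = f a + integral {a..t} (\<lambda>t. g2 t - g1 t)"
      using primitive_on_eq[OF g1 t] primitive_on_eq[OF g2 t] by linarith
  qed
  then show ?thesis by (rule that)
qed

section \<open>Calculus of absolutely continuous functions\<close>

text \<open>No measurability of \<open>h\<close> is demanded, because Lebesgue measure is
  complete.\<close>

lemma primitive_on_cong_AE:
  assumes p: "primitive_on a b f g" and AE: "AE x\<in>{a..b} in lebesgue. h x = g x"
  shows "primitive_on a b f h"
proof -
  have "AE x in lebesgue. x \<in> {a..b} \<longrightarrow> h x = g x" using AE .
  then obtain N where N: "N \<in> null_sets lebesgue" "{x. \<not> (x \<in> {a..b} \<longrightarrow> h x = g x)} \<subseteq> N"
    by (auto simp: eventually_ae_filter)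
  then have neg: "negligible N" by (simp add: negligible_iff_null_sets)
  have eq: "h x = g x" if "x \<in> {a..b} - N" for x using N(2) that by blast
  have "g absolutely_integrable_on {a..b}"
    using primitive_on_integrable[OF p] by (simp add: set_integrable_def integrable_restrict_space)
  then have "h absolutely_integrable_on {a..b}"
    by (rule absolutely_integrable_spike[OF _ neg]) (use eq in auto)
  then have "integrable (lebesgue_on {a..b}) h"
    by (rule absolutely_integrable_imp_integrable) simp
  moreover have "f t = f a + integral {a..t} h" if t: "t \<in> {a..b}" for t
    using primitive_on_eq[OF p t] integral_spike[OF neg, of "{a..t}" h g] eq t by force
  ultimately show ?thesis unfolding primitive_on_def by blast
qed

lemma primitive_on_integral:
  assumes "integrable (lebesgue_on {a..b}) g"
  shows "primitive_on a b (\<lambda>t. c + integral {a..t} g) g"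
  using assms by (simp add: primitive_on_def)

lemma real_derivative_unique_Icc:
  fixes f :: "real \<Rightarrow> real"
  assumes "a < b" "x \<in> {a..b}" "(f has_real_derivative D) (at x within {a..b})"
    "(f has_real_derivative E) (at x within {a..b})"
  shows "D = E"
  using assms vector_derivative_within_cbox[of a b x f D] vector_derivative_within_cbox[of a b x f E]
  by (simp add: has_real_derivative_iff_has_vector_derivative)

text \<open>Fundamental theorem of calculus for absolutely continuous functions: some density
  exists, and almost everywhere it is the derivative, hence equal to \<open>g\<close>. It turns
  product rules that hold almost everywhere into integral identities.\<close>

theorem primitive_onI_deriv:
  assumes ac: "absolutely_continuous_on_ivl a b f" and "a < b"
    and deriv: "AE x\<in>{a..b} in lebesgue. (f has_real_derivative g x) (at x within {a..b})"
  shows "primitive_on a b f g"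
proof -
  obtain h where h: "primitive_on a b f h"
    using absolutely_continuous_imp_primitive_on[OF ac] \<open>a < b\<close> by (auto intro: less_imp_le)
  have "AE x\<in>{a..b} in lebesgue. g x = h x"
    using deriv primitive_on_AE_deriv[OF h] by eventually_elim (meson \<open>a < b\<close> real_derivative_unique_Icc)
  then show ?thesis by (rule primitive_on_cong_AE[OF h])
qed

section \<open>Closure properties of absolute continuity\<close>

text \<open>One criterion for sums, differences, linear images, products and exponentials: in each
  case an increment is bounded by the increments of at most two absolutely continuous
  functions.\<close>

lemma absolutely_continuous_dominated:
  assumes f: "absolutely_continuous_on_ivl a b f" and g: "absolutely_continuous_on_ivl a b g"
    and le: "\<And>u v. u \<in> {a..b} \<Longrightarrow> v \<in> {a..b} \<Longrightarrow> norm (F v - F u) \<le> C * (norm (f v - f u) + norm (g v - g u))"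
  shows "absolutely_continuous_on_ivl a b F"
  unfolding absolutely_continuous_on_ivl_def
proof (intro allI impI)
  fix e :: real assume "0 < e"
  define C' where "C' = \<bar>C\<bar> + 1"
  have "C' > 0" by (simp add: C'_def add_nonneg_pos)
  define e' where "e' = e / (2 * C')"
  have "e' > 0" using \<open>0 < e\<close> \<open>C' > 0\<close> by (simp add: e'_def)
  obtain d1 where "d1 > 0" and d1: "\<And>d. d division_of \<Union>d \<and> \<Union>d \<subseteq> {a..b} \<and> (\<Sum>k\<in>d. Sup k - Inf k) < d1 \<Longrightarrow>
        (\<Sum>k\<in>d. norm (f (Sup k) - f (Inf k))) < e'"
    using f \<open>e' > 0\<close> unfolding absolutely_continuous_on_ivl_def by blast
  obtain d2 where "d2 > 0" and d2: "\<And>d. d division_of \<Union>d \<and> \<Union>d \<subseteq> {a..b} \<and> (\<Sum>k\<in>d. Sup k - Inf k) < d2 \<Longrightarrow>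
        (\<Sum>k\<in>d. norm (g (Sup k) - g (Inf k))) < e'"
    using g \<open>e' > 0\<close> unfolding absolutely_continuous_on_ivl_def by blast
  have "(\<Sum>k\<in>d. norm (F (Sup k) - F (Inf k))) < e"
    if d: "d division_of \<Union>d" "\<Union>d \<subseteq> {a..b}" "(\<Sum>k\<in>d. Sup k - Inf k) < min d1 d2" for d
  proof -
    have "(\<Sum>k\<in>d. norm (F (Sup k) - F (Inf k))) \<le> (\<Sum>k\<in>d. C' * (norm (f (Sup k) - f (Inf k)) + norm (g (Sup k) - g (Inf k))))"
    proof (rule sum_mono)
      fix k assume kd: "k \<in> d"
      obtain u v where "k = cbox u v" "k \<noteq> {}" using division_ofD(3,4)[OF d(1) kd] by blast
      moreover have "k \<subseteq> {a..b}" using d(2) kd by blast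
      ultimately have "Inf k \<in> {a..b}" "Sup k \<in> {a..b}" by auto
      then have "norm (F (Sup k) - F (Inf k)) \<le> C * (norm (f (Sup k) - f (Inf k)) + norm (g (Sup k) - g (Inf k)))"
        using le by blast
      also have "\<dots> \<le> C' * (norm (f (Sup k) - f (Inf k)) + norm (g (Sup k) - g (Inf k)))"
        by (intro mult_right_mono) (auto simp: C'_def)
      finally show "norm (F (Sup k) - F (Inf k)) \<le> C' * (norm (f (Sup k) - f (Inf k)) + norm (g (Sup k) - g (Inf k)))" .
    qed
    also have "\<dots> = C' * ((\<Sum>k\<in>d. norm (f (Sup k) - f (Inf k))) + (\<Sum>k\<in>d. norm (g (Sup k) - g (Inf k))))"
      by (simp add: sum_distrib_left sum.distrib distrib_left)
    also have "\<dots> < C' * (e' + e')"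
      using d1[of d] d2[of d] d \<open>C' > 0\<close> by (intro mult_strict_left_mono add_strict_mono) auto
    also have "\<dots> = e" using \<open>C' > 0\<close> by (simp add: e'_def)
    finally show ?thesis .
  qed
  then show "\<exists>\<delta>>0. \<forall>d. d division_of \<Union>d \<and> \<Union>d \<subseteq> {a..b} \<and> (\<Sum>k\<in>d. Sup k - Inf k) < \<delta> \<longrightarrow>
        (\<Sum>k\<in>d. norm (F (Sup k) - F (Inf k))) < e"
    using \<open>d1 > 0\<close> \<open>d2 > 0\<close> by (intro exI[of _ "min d1 d2"]) auto
qed

lemma absolutely_continuous_imp_continuous_on:
  fixes f :: "real \<Rightarrow> real"
  assumes "absolutely_continuous_on_ivl a b f"
  shows "continuous_on {a..b} f"
  using assms ac_pairs_of_absolutely_continuous ac_pairs_continuous_on by blast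

lemma absolutely_continuous_bounded:
  fixes f :: "real \<Rightarrow> real"
  assumes "absolutely_continuous_on_ivl a b f"
  obtains M where "M > 0" "\<And>t. t \<in> {a..b} \<Longrightarrow> \<bar>f t\<bar> \<le> M"
proof -
  have "bounded (f ` {a..b})"
    using assms by (intro compact_imp_bounded compact_continuous_image absolutely_continuous_imp_continuous_on) auto
  then show ?thesis using that by (auto simp: bounded_pos)
qed

lemma absolutely_continuous_add:
  assumes "absolutely_continuous_on_ivl a b f" "absolutely_continuous_on_ivl a b g"
  shows "absolutely_continuous_on_ivl a b (\<lambda>t. f t + g t)"
  by (rule absolutely_continuous_dominated[OF assms, of _ 1]) (simp add: add_diff_add norm_triangle_ineq)

lemma absolutely_continuous_bounded_linear:
  assumes "absolutely_continuous_on_ivl a b f" "bounded_linear h"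
  shows "absolutely_continuous_on_ivl a b (\<lambda>t. h (f t))"
proof -
  interpret bounded_linear h by fact
  obtain K where "\<And>x. norm (h x) \<le> norm x * K" using bounded by blast
  then show ?thesis
    by (intro absolutely_continuous_dominated[OF assms(1) assms(1), of _ "K/2"]) (simp add: diff[symmetric] mult.commute)
qed

lemma absolutely_continuous_const: "absolutely_continuous_on_ivl a b (\<lambda>t. c)"
  by (auto simp: absolutely_continuous_on_ivl_def intro: exI[of _ 1])

lemma absolutely_continuous_mult:
  fixes f g :: "real \<Rightarrow> real"
  assumes f: "absolutely_continuous_on_ivl a b f" and g: "absolutely_continuous_on_ivl a b g"
  shows "absolutely_continuous_on_ivl a b (\<lambda>t. f t * g t)"
proof -
  obtain M where M: "M > 0" "\<And>t. t \<in> {a..b} \<Longrightarrow> \<bar>f t\<bar> \<le> M" using absolutely_continuous_bounded[OF f] by blast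
  obtain N where N: "N > 0" "\<And>t. t \<in> {a..b} \<Longrightarrow> \<bar>g t\<bar> \<le> N" using absolutely_continuous_bounded[OF g] by blast
  show ?thesis
  proof (rule absolutely_continuous_dominated[OF f g, of _ "M + N"])
    fix u v assume uv: "u \<in> {a..b}" "v \<in> {a..b}"
    have "f v * g v - f u * g u = (f v - f u) * g v + f u * (g v - g u)" by (simp add: algebra_simps)
    then have "\<bar>f v * g v - f u * g u\<bar> \<le> \<bar>f v - f u\<bar> * \<bar>g v\<bar> + \<bar>f u\<bar> * \<bar>g v - g u\<bar>"
      by (metis abs_mult abs_triangle_ineq)
    also have "\<dots> \<le> \<bar>f v - f u\<bar> * (M + N) + (M + N) * \<bar>g v - g u\<bar>"
      using M(1) N(1) M(2)[OF uv(1)] N(2)[OF uv(2)] by (intro add_mono mult_left_mono mult_right_mono) auto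
    finally show "norm (f v * g v - f u * g u) \<le> (M + N) * (norm (f v - f u) + norm (g v - g u))"
      by (simp add: algebra_simps)
  qed
qed

lemma absolutely_continuous_exp:
  fixes f :: "real \<Rightarrow> real"
  assumes f: "absolutely_continuous_on_ivl a b f"
  shows "absolutely_continuous_on_ivl a b (\<lambda>t. exp (f t))"
proof -
  obtain M where M: "M > 0" "\<And>t. t \<in> {a..b} \<Longrightarrow> \<bar>f t\<bar> \<le> M" using absolutely_continuous_bounded[OF f] by blast
  have exp_le: "\<bar>exp x - exp y\<bar> \<le> exp M * \<bar>x - y\<bar>" if "\<bar>x\<bar> \<le> M" "\<bar>y\<bar> \<le> M" for x y :: real
  proof -
    have "norm (exp x - exp y) \<le> exp M * norm (x - y)"
    proof (rule field_differentiable_bound[of "{-M..M}" exp exp])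
      show "(exp has_field_derivative exp z) (at z within {-M..M})" for z :: real
        by (rule DERIV_subset[OF DERIV_exp]) simp
    qed (use that in auto)
    then show ?thesis by simp
  qed
  show ?thesis
  proof (rule absolutely_continuous_dominated[OF f f])
    fix u v assume "u \<in> {a..b}" "v \<in> {a..b}"
    then have "\<bar>exp (f v) - exp (f u)\<bar> \<le> exp M * \<bar>f v - f u\<bar>" by (intro exp_le M)
    then show "norm (exp (f v) - exp (f u)) \<le> exp M * (norm (f v - f u) + norm (f v - f u))"
      by (simp add: distrib_left add_increasing)
  qed
qed

section \<open>Vector-valued curves, treated coordinatewise\<close>

lemma absolutely_continuous_vec:
  fixes F :: "real \<Rightarrow> real^'n::finite"
  assumes "\<And>i. absolutely_continuous_on_ivl a b (\<lambda>t. F t $ i)"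
  shows "absolutely_continuous_on_ivl a b F"
proof -
  have "absolutely_continuous_on_ivl a b (\<lambda>t. \<Sum>i\<in>I. F t $ i *\<^sub>R (axis i 1 :: real^'n))" if "finite I" for I
    using that
  proof induction
    case (insert i I)
    have "absolutely_continuous_on_ivl a b (\<lambda>t. F t $ i *\<^sub>R (axis i 1 :: real^'n))"
      using assms by (rule absolutely_continuous_bounded_linear) (rule bounded_linear_scaleR_left)
    from absolutely_continuous_add[OF this insert.IH] insert.hyps show ?case by simp
  qed (simp add: absolutely_continuous_const)
  moreover have "(\<Sum>i\<in>UNIV. F t $ i *\<^sub>R axis i 1) = F t" for t
    by (simp add: vec_eq_iff axis_def if_distrib cong: if_cong)
  ultimately show ?thesis by (metis (no_types, lifting) ext finite)
qed

lemma absolutely_continuous_vec_nth: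
  fixes F :: "real \<Rightarrow> real^'n::finite"
  assumes "absolutely_continuous_on_ivl a b F"
  shows "absolutely_continuous_on_ivl a b (\<lambda>t. F t $ i)"
  using assms by (rule absolutely_continuous_bounded_linear) (rule bounded_linear_vec_nth)

lemma has_vector_derivative_vecI:
  fixes F :: "real \<Rightarrow> real^'n::finite"
  assumes "\<And>i. ((\<lambda>t. F t $ i) has_real_derivative D $ i) (at x within S)"
  shows "(F has_vector_derivative D) (at x within S)"
  unfolding has_vector_derivative_def
proof (subst has_derivative_componentwise_within, rule ballI)
  fix e :: "real^'n" assume "e \<in> Basis"
  then obtain i where e: "e = axis i 1" by (auto simp: Basis_vec_def)
  show "((\<lambda>x. F x \<bullet> e) has_derivative (\<lambda>x. x *\<^sub>R D \<bullet> e)) (at x within S)"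
    using assms[of i] by (simp add: e inner_axis has_field_derivative_def mult.commute mult_commute_abs)
qed

lemma velocity_eqI:
  assumes "a < b" "s \<in> {a..b}" "(\<xi> has_vector_derivative D) (at s within {a..b})"
  shows "velocity a b \<xi> s = D"
  using assms vector_derivative_within_cbox[of a b s \<xi> D] by (simp add: velocity_def)

text \<open>The exceptional sets of the finitely many coordinates are united; off the union the
  vector of coordinate densities is the derivative, hence the velocity.\<close>

lemma absolutely_continuous_velocity:
  fixes \<xi> :: "real \<Rightarrow> real^'n::finite"
  assumes ac: "absolutely_continuous_on_ivl a b \<xi>" and "a < b"
  shows "\<And>i. primitive_on a b (\<lambda>t. \<xi> t $ i) (\<lambda>t. velocity a b \<xi> t $ i)"
    and "AE s\<in>{a..b} in lebesgue. (\<xi> has_vector_derivative velocity a b \<xi> s) (at s within {a..b})"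
proof -
  have "\<exists>g. primitive_on a b (\<lambda>t. \<xi> t $ i) g" for i
    using absolutely_continuous_imp_primitive_on[OF absolutely_continuous_vec_nth[OF ac]] \<open>a < b\<close>
    by (meson less_imp_le)
  then obtain g where g: "\<And>i. primitive_on a b (\<lambda>t. \<xi> t $ i) (g i)" by metis
  have "AE s in lebesgue. \<forall>i. s \<in> {a..b} \<longrightarrow> ((\<lambda>t. \<xi> t $ i) has_real_derivative g i s) (at s within {a..b})"
    unfolding AE_all_countable using primitive_on_AE_deriv[OF g] by blast
  then have ae: "AE s\<in>{a..b} in lebesgue. (\<xi> has_vector_derivative (\<chi> i. g i s)) (at s within {a..b})"
    by eventually_elim (auto intro!: has_vector_derivative_vecI)
  then have v: "AE s\<in>{a..b} in lebesgue. velocity a b \<xi> s = (\<chi> i. g i s)"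
    by eventually_elim (auto intro!: velocity_eqI \<open>a < b\<close>)
  with ae show "AE s\<in>{a..b} in lebesgue. (\<xi> has_vector_derivative velocity a b \<xi> s) (at s within {a..b})"
    by eventually_elim auto
  fix i
  have "AE s\<in>{a..b} in lebesgue. velocity a b \<xi> s $ i = g i s"
    using v by eventually_elim auto
  then show "primitive_on a b (\<lambda>t. \<xi> t $ i) (\<lambda>t. velocity a b \<xi> t $ i)"
    by (rule primitive_on_cong_AE[OF g])
qed

section \<open>Caratheodory differential equations\<close>

lemma integral_exp_Icc:
  fixes k a t :: real
  assumes "0 < k" "a \<le> t"
  shows "((\<lambda>s. k * exp (k * (s - a))) has_integral (exp (k * (t - a)) - 1)) {a..t}"
proof -
  have "((\<lambda>s. k * exp (k * (s - a))) has_integral (exp (k * (t - a)) - exp (k * (a - a)))) {a..t}"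
    using assms(2)
    by (intro fundamental_theorem_of_calculus)
      (auto intro!: derivative_eq_intros simp flip: has_real_derivative_iff_has_vector_derivative)
  then show ?thesis by simp
qed

text \<open>Look at a maximum \<open>m\<close> of the weighted function \<open>z\<close>. The
  integral term absorbs at most half of \<open>D m\<close>, so \<open>D m \<le> 2 * B\<close>, and
  \<open>z m \<le> D m\<close> bounds \<open>z\<close> everywhere. The two factors 2 are the price
  of this short argument; only linearity in \<open>B\<close> matters later.\<close>

lemma gronwall_Icc:
  fixes D :: "real \<Rightarrow> real"
  assumes "a \<le> b" "0 < K" "continuous_on {a..b} D" and nonneg: "\<And>t. t \<in> {a..b} \<Longrightarrow> 0 \<le> D t"
    and le: "\<And>t. t \<in> {a..b} \<Longrightarrow> D t \<le> B + integral {a..t} (\<lambda>s. K * D s)"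
    and t: "t \<in> {a..b}"
  shows "D t \<le> 2 * B * exp (2 * K * (b - a))"
proof -
  define z where "z = (\<lambda>s. exp (- (2 * K * (s - a))) * D s)"
  have "continuous_on {a..b} z" unfolding z_def by (intro continuous_intros assms)
  then obtain m where m: "m \<in> {a..b}" "\<And>s. s \<in> {a..b} \<Longrightarrow> z s \<le> z m"
    using continuous_attains_sup[of "{a..b}" z] \<open>a \<le> b\<close> by auto
  have Dz: "D s = exp (2 * K * (s - a)) * z s" for s
    by (simp add: z_def exp_minus)
  have zm: "0 \<le> z m" using nonneg[OF m(1)] by (simp add: z_def)
  have "integral {a..m} (\<lambda>s. K * D s) \<le> integral {a..m} (\<lambda>s. (2 * K * exp (2 * K * (s - a))) * (z m / 2))"
  proof (rule integral_le)
    show "(\<lambda>s. K * D s) integrable_on {a..m}"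
      using m(1) by (intro integrable_continuous_real continuous_intros continuous_on_subset[OF assms(3)]) auto
    show "(\<lambda>s. (2 * K * exp (2 * K * (s - a))) * (z m / 2)) integrable_on {a..m}"
      by (intro integrable_continuous_real continuous_intros)
    fix s assume "s \<in> {a..m}"
    then have "z s \<le> z m" using m by auto
    then show "K * D s \<le> (2 * K * exp (2 * K * (s - a))) * (z m / 2)"
      using \<open>0 < K\<close> by (simp add: Dz mult_left_mono)
  qed
  also have "\<dots> = (exp (2 * K * (m - a)) - 1) * (z m / 2)"
    using integral_exp_Icc[of "2 * K" a m] \<open>0 < K\<close> m(1)
    by (intro integral_unique has_integral_mult_left) auto
  finally have "D m \<le> B + (exp (2 * K * (m - a)) - 1) * (z m / 2)" using le[OF m(1)] by simp
  then have 1: "exp (2 * K * (m - a)) * z m \<le> B + exp (2 * K * (m - a)) * (z m / 2)"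
    using zm by (simp add: Dz[of m] algebra_simps)
  have "D m \<le> 2 * B" using 1 by (simp add: Dz[of m])
  have B: "0 \<le> B" using \<open>D m \<le> 2 * B\<close> nonneg[OF m(1)] by simp
  have "z m \<le> D m"
    using nonneg[OF m(1)] \<open>0 < K\<close> m(1) by (auto simp: z_def intro!: mult_left_le_one_le)
  then have "z t \<le> 2 * B" using m(2)[OF t] \<open>D m \<le> 2 * B\<close> by simp
  then have "D t \<le> exp (2 * K * (t - a)) * (2 * B)" by (simp add: Dz[of t])
  also have "\<dots> \<le> exp (2 * K * (b - a)) * (2 * B)"
    using t \<open>0 < K\<close> B by (intro mult_right_mono) auto
  finally show ?thesis by (simp add: mult.commute)
qed

text \<open>Here \<open>v\<close> need not solve the equation: its defect is the difference of
  \<open>f s (v s)\<close> and \<open>h s\<close>. Zero defect yields uniqueness; a defect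
  proportional to the perturbation parameter yields closeness of perturbed solutions.\<close>

lemma ode_stability:
  fixes f :: "real \<Rightarrow> real \<Rightarrow> real"
  assumes "a \<le> b" "0 < K"
    and lip: "\<And>s r r'. s \<in> {a..b} \<Longrightarrow> \<bar>f s r - f s r'\<bar> \<le> K * \<bar>r - r'\<bar>"
    and w: "primitive_on a b w (\<lambda>s. f s (w s))" and v: "primitive_on a b v h" and "w a = v a"
    and int: "integrable (lebesgue_on {a..b}) (\<lambda>s. f s (v s))"
    and B: "integral {a..b} (\<lambda>s. \<bar>f s (v s) - h s\<bar>) \<le> B"
    and t: "t \<in> {a..b}"
  shows "\<bar>w t - v t\<bar> \<le> 2 * B * exp (2 * K * (b - a))"
proof (rule gronwall_Icc[OF \<open>a \<le> b\<close> \<open>0 < K\<close> _ _ _ t])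
  have cw: "continuous_on {a..b} w" and cv: "continuous_on {a..b} v"
    using w v by (auto intro: absolutely_continuous_imp_continuous_on primitive_on_absolutely_continuous)
  then show cD: "continuous_on {a..b} (\<lambda>t. \<bar>w t - v t\<bar>)" by (intro continuous_intros)
  fix t assume t: "t \<in> {a..b}"
  note iw = primitive_on_integrable[OF w] and iv = primitive_on_integrable[OF v]
  have sub: "integrable (lebesgue_on {a..t}) g" if "integrable (lebesgue_on {a..b}) g" for g :: "real \<Rightarrow> real"
    using t by (intro integrable_lebesgue_on_subset[OF that]) auto
  have hk: "g integrable_on {a..t}" if "integrable (lebesgue_on {a..b}) g" for g :: "real \<Rightarrow> real"
    using t by (intro integrable_on_sub_ivl[OF that]) auto
  have "w t - v t = integral {a..t} (\<lambda>s. f s (w s)) - integral {a..t} h"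
    using primitive_on_eq[OF w t] primitive_on_eq[OF v t] \<open>w a = v a\<close> by linarith
  also have "\<dots> = integral {a..t} (\<lambda>s. f s (w s) - h s)"
    by (rule Henstock_Kurzweil_Integration.integral_diff[symmetric]) (intro hk iw iv)+
  finally have eq: "w t - v t = integral {a..t} (\<lambda>s. f s (w s) - h s)" .
  have iD: "(\<lambda>s. K * \<bar>w s - v s\<bar>) integrable_on {a..t}"
    using t by (intro integrable_continuous_real continuous_intros continuous_on_subset[OF cw] continuous_on_subset[OF cv]) auto
  have iE: "(\<lambda>s. \<bar>f s (v s) - h s\<bar>) integrable_on {a..t}"
    using int iv by (intro hk) simp
  have "norm (integral {a..t} (\<lambda>s. f s (w s) - h s)) \<le> integral {a..t} (\<lambda>s. K * \<bar>w s - v s\<bar> + \<bar>f s (v s) - h s\<bar>)"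
  proof (rule integral_norm_bound_integral)
    show "(\<lambda>s. f s (w s) - h s) integrable_on {a..t}" using iw iv by (intro hk) simp
    show "(\<lambda>s. K * \<bar>w s - v s\<bar> + \<bar>f s (v s) - h s\<bar>) integrable_on {a..t}"
      by (intro integrable_add iD iE)
    fix s assume "s \<in> {a..t}"
    then have "\<bar>f s (w s) - f s (v s)\<bar> \<le> K * \<bar>w s - v s\<bar>" using t by (intro lip) auto
    then show "norm (f s (w s) - h s) \<le> K * \<bar>w s - v s\<bar> + \<bar>f s (v s) - h s\<bar>" by simp
  qed
  also have "\<dots> = integral {a..t} (\<lambda>s. K * \<bar>w s - v s\<bar>) + integral {a..t} (\<lambda>s. \<bar>f s (v s) - h s\<bar>)"
    by (rule Henstock_Kurzweil_Integration.integral_add[OF iD iE])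
  also have "integral {a..t} (\<lambda>s. \<bar>f s (v s) - h s\<bar>) \<le> integral {a..b} (\<lambda>s. \<bar>f s (v s) - h s\<bar>)"
    using t int iv by (intro integral_subset_le iE integrable_on_sub_ivl[of a b]) auto
  finally show "\<bar>w t - v t\<bar> \<le> B + integral {a..t} (\<lambda>s. K * \<bar>w s - v s\<bar>)" using B eq by simp
qed simp

text \<open>Picard iteration for a right-hand side that is only integrable in time. In a weighted
  supremum norm the integral operator contracts on all of \<open>[a,b]\<close> at once, so no
  continuation of local solutions is needed.\<close>

lemma ode_existence:
  fixes f :: "real \<Rightarrow> real \<Rightarrow> real"
  assumes "a \<le> b" "0 < K"
    and lip: "\<And>s r r'. s \<in> {a..b} \<Longrightarrow> \<bar>f s r - f s r'\<bar> \<le> K * \<bar>r - r'\<bar>"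
    and int: "\<And>w. continuous_on {a..b} w \<Longrightarrow> integrable (lebesgue_on {a..b}) (\<lambda>s. f s (w s))"
  obtains w where "w a = u" "primitive_on a b w (\<lambda>s. f s (w s))"
proof -
  \<comment> \<open>Clamping to \<open>[a,b]\<close> lets the iteration run in the complete type of
    bounded continuous functions on the line.\<close>
  define c where "c = (\<lambda>t::real. max a (min b t))"
  have c: "c t \<in> {a..b}" for t using \<open>a \<le> b\<close> by (auto simp: c_def)
  have c_id: "c t = t" if "t \<in> {a..b}" for t using that by (auto simp: c_def)
  have cc: "continuous_on UNIV c" unfolding c_def by (intro continuous_intros)
  \<comment> \<open>The integral of \<open>K * E\<close> from \<open>a\<close> to \<open>t\<close>
    is half of \<open>E t - 1\<close>, which gives contraction factor 1/2 whatever \<open>K\<close>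
    and \<open>b - a\<close> are. The unknown is rescaled to \<open>z = w / E\<close>.\<close>
  define E where "E = (\<lambda>s. exp (2 * K * (s - a)))"
  have E: "0 < E s" "E s \<noteq> 0" for s by (auto simp: E_def)
  have Ec: "continuous_on S E" for S unfolding E_def by (intro continuous_intros)
  define I where "I = (\<lambda>z t. u + integral {a..t} (\<lambda>s. f s (E s * z s)))"
  define T where "T = (\<lambda>z. Bcontfun (\<lambda>t. I (apply_bcontfun z) (c t) / E (c t)))"
  have intz: "integrable (lebesgue_on {a..b}) (\<lambda>s. f s (E s * apply_bcontfun z s))" for z
    by (intro int continuous_intros Ec continuous_on_apply_bcontfun)
  have prim: "primitive_on a b (I (apply_bcontfun z)) (\<lambda>s. f s (E s * apply_bcontfun z s))" for z
    unfolding I_def by (rule primitive_on_integral[OF intz])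
  have T: "apply_bcontfun (T z) t = I (apply_bcontfun z) (c t) / E (c t)" for z t
  proof -
    have "continuous_on {a..b} (\<lambda>t. I (apply_bcontfun z) t / E t)"
      using E by (intro continuous_intros Ec absolutely_continuous_imp_continuous_on
          primitive_on_absolutely_continuous[OF prim]) auto
    then have cont: "continuous_on UNIV (\<lambda>t. I (apply_bcontfun z) (c t) / E (c t))"
      and "bounded ((\<lambda>t. I (apply_bcontfun z) t / E t) ` {a..b})"
      using c by (auto intro!: compact_imp_bounded compact_continuous_image
          continuous_on_compose2[OF _ cc, of "{a..b}" "\<lambda>t. I (apply_bcontfun z) t / E t"])
    then obtain M where "\<And>t. t \<in> {a..b} \<Longrightarrow> norm (I (apply_bcontfun z) t / E t) \<le> M"
      unfolding bounded_iff by (meson imageI)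
    then have "(\<lambda>t. I (apply_bcontfun z) (c t) / E (c t)) \<in> bcontfun"
      using cont c by (intro bcontfun_normI[of _ M]) blast+
    then show ?thesis unfolding T_def by (simp add: Bcontfun_inverse)
  qed
  have "dist (T z) (T z') \<le> 1/2 * dist z z'" for z z'
  proof (rule dist_bound)
    fix t
    let ?d = "dist z z'" and ?t = "c t"
    have d: "\<bar>apply_bcontfun z s - apply_bcontfun z' s\<bar> \<le> ?d" for s
      using dist_bounded[of z s z'] by (simp add: dist_real_def)
    have hk: "(\<lambda>s. f s (E s * apply_bcontfun z s)) integrable_on {a..?t}" for z
      using c[of t] by (intro integrable_on_sub_ivl[OF intz]) auto
    have "I (apply_bcontfun z) ?t - I (apply_bcontfun z') ?t
        = integral {a..?t} (\<lambda>s. f s (E s * apply_bcontfun z s) - f s (E s * apply_bcontfun z' s))"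
      unfolding I_def by (simp add: Henstock_Kurzweil_Integration.integral_diff[OF hk hk])
    also have "norm \<dots> \<le> integral {a..?t} (\<lambda>s. (2 * K * E s) * (?d / 2))"
    proof (rule integral_norm_bound_integral)
      show "(\<lambda>s. f s (E s * apply_bcontfun z s) - f s (E s * apply_bcontfun z' s)) integrable_on {a..?t}"
        by (intro integrable_diff hk)
      show "(\<lambda>s. (2 * K * E s) * (?d / 2)) integrable_on {a..?t}"
        by (intro integrable_continuous_real continuous_intros Ec)
      fix s assume "s \<in> {a..?t}"
      then have "norm (f s (E s * apply_bcontfun z s) - f s (E s * apply_bcontfun z' s))
          \<le> K * \<bar>E s * apply_bcontfun z s - E s * apply_bcontfun z' s\<bar>"
        using c[of t] lip by auto
      also have "\<dots> = K * E s * \<bar>apply_bcontfun z s - apply_bcontfun z' s\<bar>"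
        using E(1)[of s] by (simp add: abs_mult flip: right_diff_distrib)
      also have "\<dots> \<le> K * E s * ?d" using \<open>0 < K\<close> E(1)[of s] d by (intro mult_left_mono) auto
      finally show "norm (f s (E s * apply_bcontfun z s) - f s (E s * apply_bcontfun z' s)) \<le> (2 * K * E s) * (?d / 2)"
        by simp
    qed
    also have "\<dots> = (E ?t - 1) * (?d / 2)"
      using integral_exp_Icc[of "2 * K" a ?t] \<open>0 < K\<close> c[of t] unfolding E_def
      by (intro integral_unique has_integral_mult_left) auto
    also have "\<dots> \<le> E ?t * (?d / 2)" by (intro mult_right_mono) auto
    finally have "\<bar>I (apply_bcontfun z) ?t - I (apply_bcontfun z') ?t\<bar> \<le> E ?t * (?d / 2)" by simp
    then have "\<bar>I (apply_bcontfun z) ?t - I (apply_bcontfun z') ?t\<bar> / E ?t \<le> ?d / 2"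
      using E(1)[of ?t] by (simp add: divide_le_eq mult.commute)
    then show "dist (apply_bcontfun (T z) t) (apply_bcontfun (T z') t) \<le> 1/2 * ?d"
      using E(1)[of ?t] by (simp add: T dist_real_def abs_divide flip: diff_divide_distrib)
  qed
  then obtain z where z: "T z = z"
    using banach_fix_type[of "1/2" T] by auto
  define w where "w = I (apply_bcontfun z)"
  have "E s * apply_bcontfun z s = w s" if "s \<in> {a..b}" for s
    using T[of z s] E(2)[of s] by (simp add: z w_def c_id[OF that])
  then have "primitive_on a b w (\<lambda>s. f s (w s))"
    using prim[of z] unfolding w_def[symmetric]
    by (elim primitive_on_cong_AE) (auto intro!: AE_I2)
  moreover have "w a = u" by (simp add: w_def I_def)
  ultimately show ?thesis using that by blast
qed

section \<open>The Lagrangian\<close>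

lemma linear_eq_inner_axis:
  fixes l :: "real^'n::finite \<Rightarrow> real"
  assumes "linear l"
  shows "l h = h \<bullet> (\<chi> i. l (axis i 1))"
proof -
  have "h = (\<Sum>i\<in>UNIV. h $ i *\<^sub>R axis i 1)"
    by (simp add: vec_eq_iff axis_def if_distrib cong: if_cong)
  then have "l h = l (\<Sum>i\<in>UNIV. h $ i *\<^sub>R axis i 1)" by simp
  also have "\<dots> = (\<Sum>i\<in>UNIV. h $ i * l (axis i 1))"
    by (simp add: linear_sum[OF assms] linear_scale[OF assms])
  finally show ?thesis by (simp add: inner_vec_def)
qed

text \<open>Every partial derivative is the total derivative evaluated at fixed coordinate
  directions, so its joint continuity is inherited. Time is only a parameter of the variation, so
  the derivative is recorded in \<open>(x, v, r)\<close> alone.\<close>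

lemma C1_lagrangian_partials:
  fixes L :: "'n::finite lagrangian"
  assumes "C1_lagrangian L"
  shows has_derivative_lagrangian: "\<And>t x v r. ((\<lambda>(x, v, r). L t x v r) has_derivative
      (\<lambda>(h, k, \<rho>). L_x L t x v r \<bullet> h + L_v L t x v r \<bullet> k + L_r L t x v r * \<rho>)) (at (x, v, r))"
    and continuous_lagrangian: "continuous_on UNIV (\<lambda>(t, x, v, r). L t x v r)"
    and continuous_L_x: "continuous_on UNIV (\<lambda>(t, x, v, r). L_x L t x v r)"
    and continuous_L_v: "continuous_on UNIV (\<lambda>(t, x, v, r). L_v L t x v r)"
    and continuous_L_r: "continuous_on UNIV (\<lambda>(t, x, v, r). L_r L t x v r)"
proof -
  obtain f' where f': "\<And>p. ((\<lambda>(t, x, v, r). L t x v r) has_derivative blinfun_apply (f' p)) (at p)"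
    and cont: "continuous_on UNIV f'"
    using assms unfolding C1_lagrangian_def C1_map_def by blast
  have bl: "bounded_linear (blinfun_apply (f' p))" for p by (rule blinfun.bounded_linear_right)
  have lin: "linear (blinfun_apply (f' p))" for p using bl by (rule bounded_linear.linear)
  have Lx: "L_x L t x v r = (\<chi> i. f' (t, x, v, r) (0, axis i 1, 0, 0))" (is "?A = ?B")
    and Lx': "f' (t, x, v, r) (0, h, 0, 0) = h \<bullet> L_x L t x v r" for t x v r h
  proof -
    have d: "((\<lambda>z. (t, z, v, r)) has_derivative (\<lambda>h. (0, h, 0, 0))) (at x)"
      by (auto intro!: derivative_eq_intros simp: zero_prod_def)
    have l: "linear (\<lambda>h. f' (t, x, v, r) (0, h, 0, 0))"
      by (rule bounded_linear.linear) (intro bounded_linear_compose[OF bl] bounded_linear_Pair bounded_linear_zero bounded_linear_ident)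
    have eq: "f' (t, x, v, r) (0, h, 0, 0) = h \<bullet> (\<chi> i. f' (t, x, v, r) (0, axis i 1, 0, 0))" for h
      by (rule linear_eq_inner_axis[OF l])
    have "((\<lambda>z. L t z v r) has_derivative (\<lambda>h. f' (t, x, v, r) (0, h, 0, 0))) (at x)"
      using has_derivative_compose[OF d f'] by simp
    then have "GDERIV (\<lambda>z. L t z v r) x :> (\<chi> i. f' (t, x, v, r) (0, axis i 1, 0, 0))"
      unfolding gderiv_def by (simp only: eq[symmetric])
    then show *: "L_x L t x v r = (\<chi> i. f' (t, x, v, r) (0, axis i 1, 0, 0))"
      unfolding L_x_def by (rule grad_eqI)
    show "f' (t, x, v, r) (0, h, 0, 0) = h \<bullet> L_x L t x v r"
      unfolding * by (rule eq)
  qed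
  have Lv: "L_v L t x v r = (\<chi> i. f' (t, x, v, r) (0, 0, axis i 1, 0))"
    and Lv': "f' (t, x, v, r) (0, 0, h, 0) = h \<bullet> L_v L t x v r" for t x v r h
  proof -
    have d: "((\<lambda>z. (t, x, z, r)) has_derivative (\<lambda>h. (0, 0, h, 0))) (at v)"
      by (auto intro!: derivative_eq_intros simp: zero_prod_def)
    have l: "linear (\<lambda>h. f' (t, x, v, r) (0, 0, h, 0))"
      by (rule bounded_linear.linear) (intro bounded_linear_compose[OF bl] bounded_linear_Pair bounded_linear_zero bounded_linear_ident)
    have eq: "f' (t, x, v, r) (0, 0, h, 0) = h \<bullet> (\<chi> i. f' (t, x, v, r) (0, 0, axis i 1, 0))" for h
      by (rule linear_eq_inner_axis[OF l])
    have "((\<lambda>z. L t x z r) has_derivative (\<lambda>h. f' (t, x, v, r) (0, 0, h, 0))) (at v)"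
      using has_derivative_compose[OF d f'] by simp
    then have "GDERIV (\<lambda>z. L t x z r) v :> (\<chi> i. f' (t, x, v, r) (0, 0, axis i 1, 0))"
      unfolding gderiv_def by (simp only: eq[symmetric])
    then show *: "L_v L t x v r = (\<chi> i. f' (t, x, v, r) (0, 0, axis i 1, 0))"
      unfolding L_v_def by (rule grad_eqI)
    show "f' (t, x, v, r) (0, 0, h, 0) = h \<bullet> L_v L t x v r"
      unfolding * by (rule eq)
  qed
  have Lr: "L_r L t x v r = f' (t, x, v, r) (0, 0, 0, 1)"
    and Lr': "f' (t, x, v, r) (0, 0, 0, \<rho>) = L_r L t x v r * \<rho>" for t x v r \<rho>
  proof -
    have d: "((\<lambda>z. (t, x, v, z)) has_derivative (\<lambda>h. (0, 0, 0, h))) (at r)"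
      by (auto intro!: derivative_eq_intros simp: zero_prod_def)
    have sc: "f' (t, x, v, r) (0, 0, 0, h) = f' (t, x, v, r) (0, 0, 0, 1) * h" for h
      using linear_scale[OF lin, of "(t, x, v, r)" h "(0, 0, 0, 1)"] by simp
    have "((\<lambda>z. L t x v z) has_derivative (\<lambda>h. f' (t, x, v, r) (0, 0, 0, 1) * h)) (at r)"
      using has_derivative_compose[OF d f'] by (simp only: sc[symmetric]) simp
    then have "((\<lambda>z. L t x v z) has_real_derivative f' (t, x, v, r) (0, 0, 0, 1)) (at r)"
      unfolding has_field_derivative_def .
    then show *: "L_r L t x v r = f' (t, x, v, r) (0, 0, 0, 1)"
      unfolding L_r_def by (rule DERIV_imp_deriv)
    show "f' (t, x, v, r) (0, 0, 0, \<rho>) = L_r L t x v r * \<rho>" unfolding * by (rule sc)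
  qed
  show "((\<lambda>(x, v, r). L t x v r) has_derivative
      (\<lambda>(h, k, \<rho>). L_x L t x v r \<bullet> h + L_v L t x v r \<bullet> k + L_r L t x v r * \<rho>)) (at (x, v, r))" for t x v r
  proof -
    have d: "((\<lambda>p. (t, p)) has_derivative (\<lambda>h. (0, h))) (at (x, v, r))"
      by (auto intro!: derivative_eq_intros simp: zero_prod_def)
    have "((\<lambda>p. (\<lambda>(t, x, v, r). L t x v r) (t, p)) has_derivative (\<lambda>h. f' (t, x, v, r) (0, h))) (at (x, v, r))"
      using has_derivative_compose[OF d f'] by simp
    moreover have "(\<lambda>h. f' (t, x, v, r) (0, h)) = (\<lambda>(h, k, \<rho>). L_x L t x v r \<bullet> h + L_v L t x v r \<bullet> k + L_r L t x v r * \<rho>)"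
    proof (rule ext, clarify)
      fix h k :: "real^'n" and \<rho> :: real
      have "(0, h, k, \<rho>) = (0, h, 0, 0) + (0, 0, k, 0) + (0 :: real, 0, 0, \<rho>)" by simp
      then have "f' (t, x, v, r) (0, h, k, \<rho>) = f' (t, x, v, r) (0, h, 0, 0) + f' (t, x, v, r) (0, 0, k, 0) + f' (t, x, v, r) (0, 0, 0, \<rho>)"
        by (simp only: linear_add[OF lin])
      then show "f' (t, x, v, r) (0, h, k, \<rho>) = L_x L t x v r \<bullet> h + L_v L t x v r \<bullet> k + L_r L t x v r * \<rho>"
        by (simp add: Lx' Lv' Lr' inner_commute)
    qed
    ultimately show ?thesis by (simp add: case_prod_unfold)
  qed
  show "continuous_on UNIV (\<lambda>(t, x, v, r). L t x v r)"
    using f' by (meson continuous_at_imp_continuous_on has_derivative_continuous)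
  have c: "continuous_on UNIV (\<lambda>p. f' p e)" for e
    by (intro continuous_intros cont)
  have "continuous_on UNIV (\<lambda>p. \<chi> i. f' p (0, axis i 1, 0, 0))"
    by (intro continuous_on_vec_lambda c)
  then show "continuous_on UNIV (\<lambda>(t, x, v, r). L_x L t x v r)" by (simp add: Lx case_prod_unfold)
  have "continuous_on UNIV (\<lambda>p. \<chi> i. f' p (0, 0, axis i 1, 0))"
    by (intro continuous_on_vec_lambda c)
  then show "continuous_on UNIV (\<lambda>(t, x, v, r). L_v L t x v r)" by (simp add: Lv case_prod_unfold)
  show "continuous_on UNIV (\<lambda>(t, x, v, r). L_r L t x v r)" using c by (simp add: Lr case_prod_unfold)
qed

section \<open>Uniform bounds on the Lagrangian\<close>

text \<open>A violation at one point would persist on a nondegenerate subinterval of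
  \<open>[a,b]\<close>, which has positive measure. Bounds by essential suprema thereby hold at
  every time.\<close>

lemma AE_Icc_closed_imp_ball:
  fixes P :: "real \<Rightarrow> bool"
  assumes AE: "AE t\<in>{a..b} in lebesgue. P t" and "a < b" and "closed {t. P t}" and t: "t \<in> {a..b}"
  shows "P t"
proof (rule ccontr)
  assume "\<not> P t"
  have "open (- {t. P t})" using \<open>closed {t. P t}\<close> by (simp add: open_Compl)
  then obtain e where "e > 0" and e: "ball t e \<subseteq> - {t. P t}"
    using \<open>\<not> P t\<close> open_contains_ball by blast
  define u v where "u = max a (t - e/2)" and "v = min b (t + e/2)"
  have uv: "u < v" using t \<open>a < b\<close> \<open>e > 0\<close> by (auto simp: u_def v_def)
  have sub: "{u..v} \<subseteq> {a..b} \<inter> ball t e"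
    using \<open>e > 0\<close> by (auto simp: u_def v_def dist_real_def)
  have "AE s in lebesgue. s \<notin> {u..v}"
    using AE by eventually_elim (use sub e in blast)
  then have "{u..v} \<in> null_sets lebesgue"
    by (subst (asm) AE_iff_null_sets[symmetric]) auto
  then have "emeasure lebesgue {u..v} = 0" by auto
  then show False using uv by simp
qed

lemma Linf_loc_bound:
  assumes "Linf_loc_nonneg c"
  obtains M where "AE t\<in>{a..b} in lebesgue. c t \<le> M"
proof -
  obtain M where "AE t\<in>{a..b} in lebesgue. \<bar>c t\<bar> \<le> M"
    using assms unfolding Linf_loc_nonneg_def Linf_loc_def by (meson compact_Icc)
  then have "AE t\<in>{a..b} in lebesgue. c t \<le> M" by eventually_elim auto
  then show ?thesis by (rule that)
qed

lemma lagrangian_L_r_bound_imp_lipschitz: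
  fixes L :: "'n::finite lagrangian"
  assumes "C1_lagrangian L" and "\<And>z. \<bar>L_r L t x v z\<bar> \<le> A"
  shows "\<bar>L t x v r - L t x v r'\<bar> \<le> A * \<bar>r - r'\<bar>"
proof -
  have d: "((\<lambda>z. L t x v z) has_real_derivative L_r L t x v z) (at z)" for z
  proof -
    have "((\<lambda>z. (x, v, z)) has_derivative (\<lambda>h. (0, 0, h))) (at z)"
      by (auto intro!: derivative_eq_intros simp: zero_prod_def)
    from has_derivative_compose[OF this has_derivative_lagrangian[OF assms(1)]]
    show ?thesis by (simp add: has_field_derivative_def)
  qed
  have "norm (L t x v r - L t x v r') \<le> A * norm (r - r')"
    using d assms(2) by (intro field_differentiable_bound[of UNIV]) auto
  then show ?thesis by simp
qed

text \<open>The shift \<open>A * (1 + \<bar>r\<bar>)\<close> compensates the possible negativity of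
  \<open>L\<close>, so that the coefficient \<open>C\<^sub>2\<close> can be replaced by its bound;
  the last 1 absorbs \<open>C\<^sub>1\<close>.\<close>

locale herglotz_lagrangian =
  fixes L :: "'n::finite lagrangian" and a b A :: real
  assumes C1: "C1_lagrangian L" and ab: "a < b" and A: "0 < A"
    and L_r_le: "t \<in> {a..b} \<Longrightarrow> \<bar>L_r L t x v r\<bar> \<le> A"
    and L_x_le: "t \<in> {a..b} \<Longrightarrow> norm (L_x L t x v r) \<le> A * (L t x v r + A * (1 + \<bar>r\<bar>) + 1)"
    and L_v_le: "t \<in> {a..b} \<Longrightarrow> norm (L_v L t x v r) \<le> A * (L t x v r + A * (1 + \<bar>r\<bar>) + 1)"

lemma herglotz_lagrangianI:
  fixes L :: "'n::finite lagrangian"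
  assumes C1: "C1_lagrangian L" and L2: "cond_L2 L" and L3: "cond_L3 L" and L4: "cond_L4' L" and "a < b"
  obtains A where "herglotz_lagrangian L a b A"
proof -
  obtain \<theta> c0 where \<theta>: "superlinear \<theta>" and c0: "Linf_loc_nonneg c0"
    and low: "\<And>t x v. L t x v 0 \<ge> \<theta> (norm v) - c0 t"
    using L2 unfolding cond_L2_def by blast
  obtain K where K: "Linf_loc_nonneg K" and LK: "\<And>t x v r. \<bar>L_r L t x v r\<bar> \<le> K t"
    using L3 unfolding cond_L3_def by blast
  obtain c1 c2 where c: "Linf_loc_nonneg c1" "Linf_loc_nonneg c2"
    and Lc: "\<And>t x v r. max (norm (L_x L t x v r)) (norm (L_v L t x v r)) \<le> c1 t + c2 t * L t x v r"
    using L4 unfolding cond_L4'_def by blast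
  obtain M0 where M0: "AE t\<in>{a..b} in lebesgue. c0 t \<le> M0" by (rule Linf_loc_bound[OF c0])
  obtain MK where MK: "AE t\<in>{a..b} in lebesgue. K t \<le> MK" by (rule Linf_loc_bound[OF K])
  obtain M1 where M1: "AE t\<in>{a..b} in lebesgue. c1 t \<le> M1" by (rule Linf_loc_bound[OF c(1)])
  obtain M2 where M2: "AE t\<in>{a..b} in lebesgue. c2 t \<le> M2" by (rule Linf_loc_bound[OF c(2)])
  \<comment> \<open>Dominates all four essential bounds, and the 1 makes it positive.\<close>
  define A where "A = \<bar>M0\<bar> + \<bar>MK\<bar> + \<bar>M1\<bar> + \<bar>M2\<bar> + 1"
  have "A > 0" by (simp add: A_def add_nonneg_pos)
  have ae: "AE t\<in>{a..b} in lebesgue. \<forall>x v r. \<bar>L_r L t x v r\<bar> \<le> A \<and>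
      norm (L_x L t x v r) \<le> A * (L t x v r + A * (1 + \<bar>r\<bar>) + 1) \<and>
      norm (L_v L t x v r) \<le> A * (L t x v r + A * (1 + \<bar>r\<bar>) + 1)"
    using M0 MK M1 M2
  proof eventually_elim
    case (elim t)
    show ?case
    proof (intro impI allI)
      fix x v r assume "t \<in> {a..b}"
      with elim have le: "c0 t \<le> A" "K t \<le> A" "c1 t \<le> A" "c2 t \<le> A" by (auto simp: A_def)
      have c2: "0 \<le> c2 t" using c(2) by (simp add: Linf_loc_nonneg_def)
      have Lr: "\<bar>L_r L t x v r\<bar> \<le> A" for r using LK[of t x v r] le by simp
      have "\<bar>L t x v r - L t x v 0\<bar> \<le> A * \<bar>r - 0\<bar>"
        by (rule lagrangian_L_r_bound_imp_lipschitz[OF C1 Lr])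
      moreover have "0 \<le> \<theta> (norm v)" using \<theta> by (simp add: superlinear_def)
      \<comment> \<open>The lower bound at \<open>r = 0\<close> from (L2) is carried to every
        \<open>r\<close> by the Lipschitz bound from (L3).\<close>
      ultimately have nn: "0 \<le> L t x v r + A * (1 + \<bar>r\<bar>)" using low[where t=t and x=x and v=v] le by (simp add: algebra_simps)
      have "max (norm (L_x L t x v r)) (norm (L_v L t x v r)) \<le> c1 t + c2 t * L t x v r" by (rule Lc)
      also have "\<dots> \<le> A + c2 t * (L t x v r + A * (1 + \<bar>r\<bar>))"
        using le c2 \<open>A > 0\<close> by (intro add_mono mult_left_mono) auto
      also have "\<dots> \<le> A + A * (L t x v r + A * (1 + \<bar>r\<bar>))"
        using le nn by (intro add_left_mono mult_right_mono) auto
      finally have "max (norm (L_x L t x v r)) (norm (L_v L t x v r)) \<le> A * (L t x v r + A * (1 + \<bar>r\<bar>) + 1)"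
        by (simp add: algebra_simps)
      with Lr[of r] show "\<bar>L_r L t x v r\<bar> \<le> A \<and>
        norm (L_x L t x v r) \<le> A * (L t x v r + A * (1 + \<bar>r\<bar>) + 1) \<and>
        norm (L_v L t x v r) \<le> A * (L t x v r + A * (1 + \<bar>r\<bar>) + 1)" by simp
    qed
  qed
  \<comment> \<open>After the coefficients became constants, both sides of each bound are continuous
    in \<open>t\<close>, so the bounds hold on a closed set of times.\<close>
  have comp: "continuous_on UNIV (\<lambda>t. g t x v r)" if "continuous_on UNIV (\<lambda>(t, x, v, r). g t x v r)"
    for g :: "real \<Rightarrow> real^'n \<Rightarrow> real^'n \<Rightarrow> real \<Rightarrow> 'b::topological_space" and x v r
  proof -
    have "continuous_on UNIV (\<lambda>t. (\<lambda>(t, x, v, r). g t x v r) (t, x, v, r))"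
      by (rule continuous_on_compose2[OF that]) (auto intro!: continuous_intros)
    then show ?thesis by simp
  qed
  note cL = comp[OF continuous_lagrangian[OF C1]] comp[OF continuous_L_x[OF C1]]
    comp[OF continuous_L_v[OF C1]] comp[OF continuous_L_r[OF C1]]
  have all: "\<forall>x v r. \<bar>L_r L t x v r\<bar> \<le> A \<and>
      norm (L_x L t x v r) \<le> A * (L t x v r + A * (1 + \<bar>r\<bar>) + 1) \<and>
      norm (L_v L t x v r) \<le> A * (L t x v r + A * (1 + \<bar>r\<bar>) + 1)" if "t \<in> {a..b}" for t
    by (rule AE_Icc_closed_imp_ball[OF ae \<open>a < b\<close> _ that])
      (intro closed_Collect_all closed_Collect_conj closed_Collect_le continuous_intros cL)
  have "herglotz_lagrangian L a b A"
    by unfold_locales (use C1 \<open>a < b\<close> \<open>A > 0\<close> all in auto)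
  then show ?thesis by (rule that)
qed

lemma carath_iff_primitive:
  assumes "a < b"
  shows "caratheodory_solution L a b u \<xi> w \<longleftrightarrow>
    w a = u \<and> primitive_on a b w (\<lambda>s. L s (\<xi> s) (velocity a b \<xi> s) (w s))"
  using primitive_onI_deriv[OF _ assms] primitive_on_AE_deriv primitive_on_absolutely_continuous
  unfolding caratheodory_solution_def by (intro iffI conjI; elim conjE)

text \<open>The increments \<open>h n\<close> are only of order \<open>e n\<close>; their quotients
  by \<open>e n\<close> need not converge. This fits the perturbed solutions, which are known to be
  close but not differentiable in the parameter.\<close>

lemma has_derivative_remainder_quotient:
  fixes f :: "'a::real_normed_vector \<Rightarrow> real"
  assumes f: "(f has_derivative f') (at p)" and le: "\<And>n. norm (h n) \<le> C * e n"
    and pos: "\<And>n. 0 < e n" and lim: "e \<longlonglongrightarrow> 0"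
  shows "(\<lambda>n. (f (p + h n) - f p - f' (h n)) / e n) \<longlonglongrightarrow> 0"
proof (rule LIMSEQ_I)
  fix r :: real assume "0 < r"
  define C' where "C' = \<bar>C\<bar> + 1"
  have "C' > 0" by (simp add: C'_def add_nonneg_pos)
  have le': "norm (h n) \<le> C' * e n" for n
  proof -
    have "C * e n \<le> C' * e n" using pos[of n] by (intro mult_right_mono) (auto simp: C'_def)
    then show ?thesis using le[of n] by simp
  qed
  have "0 < r / (2 * C')" using \<open>0 < r\<close> \<open>C' > 0\<close> by simp
  then obtain d where "d > 0" and d: "\<And>y. norm (y - p) < d \<Longrightarrow> norm (f y - f p - f' (y - p)) \<le> r / (2 * C') * norm (y - p)"
    using f unfolding has_derivative_at_alt by blast
  have "0 < d / C'" using \<open>d > 0\<close> \<open>C' > 0\<close> by simp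
  then obtain N where N: "\<And>n. n \<ge> N \<Longrightarrow> \<bar>e n\<bar> < d / C'"
    using LIMSEQ_D[OF lim] by fastforce
  show "\<exists>no. \<forall>n\<ge>no. norm ((f (p + h n) - f p - f' (h n)) / e n - 0) < r"
  proof (intro exI[of _ N] allI impI)
    fix n assume "n \<ge> N"
    then have "C' * e n < d" using N[of n] pos[of n] \<open>C' > 0\<close> by (simp add: field_simps)
    then have "norm (h n) < d" using le'[of n] by simp
    then have "\<bar>f (p + h n) - f p - f' (h n)\<bar> \<le> r / (2 * C') * norm (h n)" using d[of "p + h n"] by simp
    also have "\<dots> \<le> r / (2 * C') * (C' * e n)"
      using le'[of n] \<open>0 < r\<close> \<open>C' > 0\<close> by (intro mult_left_mono) auto
    also have "\<dots> = r / 2 * e n" using \<open>C' > 0\<close> by simp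
    finally have "\<bar>f (p + h n) - f p - f' (h n)\<bar> / e n \<le> r / 2"
      using pos[of n] by (simp add: divide_le_eq)
    then have "\<bar>f (p + h n) - f p - f' (h n)\<bar> / e n < r" using \<open>0 < r\<close> by linarith
    then show "norm ((f (p + h n) - f p - f' (h n)) / e n - 0) < r"
      using pos[of n] by (simp add: abs_divide)
  qed
qed

lemma borel_measurable_lebesgue_on_vec:
  fixes V :: "real \<Rightarrow> real^'n::finite"
  assumes "\<And>i. (\<lambda>s. V s $ i) \<in> borel_measurable (lebesgue_on S)"
  shows "V \<in> borel_measurable (lebesgue_on S)"
  unfolding borel_measurable_euclidean_space[of V]
  using assms by (auto simp: Basis_vec_def inner_axis)

lemma borel_measurable_continuous_on_Icc:
  fixes f :: "real \<Rightarrow> 'a::euclidean_space"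
  assumes "continuous_on {a..b} f"
  shows "f \<in> borel_measurable (lebesgue_on {a..b})"
  using assms by (intro continuous_imp_measurable_on_sets_lebesgue) auto

lemma absolutely_continuous_vec_imp_continuous_on:
  fixes f :: "real \<Rightarrow> real^'n::finite"
  assumes "absolutely_continuous_on_ivl a b f"
  shows "continuous_on {a..b} f"
proof -
  have "continuous_on {a..b} (\<lambda>t. \<chi> i. f t $ i)"
    by (intro continuous_on_vec_lambda absolutely_continuous_imp_continuous_on
        absolutely_continuous_vec_nth[OF assms])
  then show ?thesis by simp
qed

lemma velocity_measurable:
  fixes \<xi> :: "real \<Rightarrow> real^'n::finite"
  assumes "absolutely_continuous_on_ivl a b \<xi>" "a < b"
  shows "velocity a b \<xi> \<in> borel_measurable (lebesgue_on {a..b})"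
  using primitive_on_integrable[OF absolutely_continuous_velocity(1)[OF assms]]
  by (intro borel_measurable_lebesgue_on_vec) auto

lemma borel_measurable_lagrangian_comp:
  fixes g :: "real \<Rightarrow> real^'n::finite \<Rightarrow> real^'n \<Rightarrow> real \<Rightarrow> 'b::topological_space"
  assumes g: "continuous_on UNIV (\<lambda>(t, x, v, r). g t x v r)"
    and [measurable]: "\<xi> \<in> borel_measurable (lebesgue_on {a..b})" "V \<in> borel_measurable (lebesgue_on {a..b})"
      "w \<in> borel_measurable (lebesgue_on {a..b})"
  shows "(\<lambda>s. g s (\<xi> s) (V s) (w s)) \<in> borel_measurable (lebesgue_on {a..b})"
proof -
  have [measurable]: "(\<lambda>s. s) \<in> borel_measurable (lebesgue_on {a..b})"
    by (rule borel_measurable_continuous_on_Icc) (rule continuous_on_id)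
  have "(\<lambda>s. (s, \<xi> s, V s, w s)) \<in> borel_measurable (lebesgue_on {a..b})"
    by (intro borel_measurable_Pair) measurable
  from measurable_compose[OF this borel_measurable_continuous_onI[OF g]]
  show ?thesis by simp
qed

context herglotz_lagrangian
begin

lemma lipschitz:
  assumes "s \<in> {a..b}"
  shows "\<bar>L s x v r - L s x v r'\<bar> \<le> A * \<bar>r - r'\<bar>"
  using C1 L_r_le[OF assms] by (rule lagrangian_L_r_bound_imp_lipschitz)

text \<open>\<open>J\<close> is computed with a solution picked by choice; stability with zero
  defect shows that every solution has the same end value.\<close>

lemma J_eq:
  assumes w: "caratheodory_solution L a b u \<zeta> w"
  shows "J L a b u \<zeta> = w b - u"
proof -
  define v where "v = u_sol L a b u \<zeta>"
  have "caratheodory_solution L a b u \<zeta> v"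
    unfolding v_def u_sol_def using someI[of "caratheodory_solution L a b u \<zeta>" w] w by simp
  then have v: "v a = u" "primitive_on a b v (\<lambda>s. L s (\<zeta> s) (velocity a b \<zeta> s) (v s))"
    using carath_iff_primitive[OF ab] by blast+
  have w': "w a = u" "primitive_on a b w (\<lambda>s. L s (\<zeta> s) (velocity a b \<zeta> s) (w s))"
    using w carath_iff_primitive[OF ab] by blast+
  have "\<bar>w b - v b\<bar> \<le> 2 * 0 * exp (2 * A * (b - a))"
  proof (rule ode_stability[where f = "\<lambda>s. L s (\<zeta> s) (velocity a b \<zeta> s)" and a = a,
        OF _ A lipschitz w'(2) v(2) _ primitive_on_integrable[OF v(2)]])
  qed (use ab v w' in auto)
  then have "w b = v b" by simp
  have "J L a b u \<zeta> = integral\<^sup>L (lebesgue_on {a..b}) (\<lambda>s. L s (\<zeta> s) (velocity a b \<zeta> s) (v s))"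
    by (simp add: J_def v_def set_lebesgue_integral_def integral_restrict_space)
  also have "\<dots> = integral {a..b} (\<lambda>s. L s (\<zeta> s) (velocity a b \<zeta> s) (v s))"
    by (rule lebesgue_integral_eq_integral[OF primitive_on_integrable[OF v(2)]]) simp
  also have "\<dots> = v b - v a"
    by (rule primitive_on_diff[OF v(2), symmetric]) (use ab in auto)
  finally show ?thesis using \<open>w b = v b\<close> v(1) by simp
qed

text \<open>By (L4') the derivative of the shifted, nonnegative Lagrangian along a segment in \<open>(x, v)\<close> is
  at most \<open>c\<close> times its value.\<close>

lemma growth:
  assumes s: "s \<in> {a..b}" and \<epsilon>: "0 \<le> \<epsilon>" "\<epsilon> \<le> 1" and c: "A * (norm h + norm k) \<le> c"
  shows "\<bar>L s (x + \<epsilon> *\<^sub>R h) (v + \<epsilon> *\<^sub>R k) r - L s x v r\<bar> \<le> \<epsilon> * (c * exp c * (L s x v r + A * (1 + \<bar>r\<bar>) + 1))"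
proof -
  define G where "G = (\<lambda>\<tau>. L s (x + \<tau> *\<^sub>R h) (v + \<tau> *\<^sub>R k) r + A * (1 + \<bar>r\<bar>) + 1)"
  define G' where "G' = (\<lambda>\<tau>. L_x L s (x + \<tau> *\<^sub>R h) (v + \<tau> *\<^sub>R k) r \<bullet> h + L_v L s (x + \<tau> *\<^sub>R h) (v + \<tau> *\<^sub>R k) r \<bullet> k)"
  have "0 \<le> c" using c A by (smt (verit) mult_nonneg_nonneg norm_ge_zero)
  have d: "(G has_real_derivative G' \<tau>) (at \<tau>)" for \<tau>
  proof -
    have "((\<lambda>\<tau>. (x + \<tau> *\<^sub>R h, v + \<tau> *\<^sub>R k, r)) has_derivative (\<lambda>z. (z *\<^sub>R h, z *\<^sub>R k, 0))) (at \<tau>)"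
      by (auto intro!: derivative_eq_intros)
    from has_derivative_compose[OF this has_derivative_lagrangian[OF C1, of s]]
    have "((\<lambda>\<tau>. L s (x + \<tau> *\<^sub>R h) (v + \<tau> *\<^sub>R k) r) has_derivative
        (\<lambda>z. L_x L s (x + \<tau> *\<^sub>R h) (v + \<tau> *\<^sub>R k) r \<bullet> z *\<^sub>R h + L_v L s (x + \<tau> *\<^sub>R h) (v + \<tau> *\<^sub>R k) r \<bullet> z *\<^sub>R k)) (at \<tau>)"
      by simp
    moreover have "(\<lambda>z. L_x L s (x + \<tau> *\<^sub>R h) (v + \<tau> *\<^sub>R k) r \<bullet> z *\<^sub>R h + L_v L s (x + \<tau> *\<^sub>R h) (v + \<tau> *\<^sub>R k) r \<bullet> z *\<^sub>R k) = (*) (G' \<tau>)"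
      by (auto simp: fun_eq_iff G'_def algebra_simps)
    ultimately have "((\<lambda>\<tau>. L s (x + \<tau> *\<^sub>R h) (v + \<tau> *\<^sub>R k) r) has_real_derivative G' \<tau>) (at \<tau>)"
      by (simp add: has_field_derivative_def)
    then show ?thesis unfolding G_def by (auto intro!: derivative_eq_intros)
  qed
  \<comment> \<open>Nonnegativity is read off from the gradient bound: \<open>A * G \<tau>\<close>
    dominates a norm.\<close>
  have nn: "0 \<le> G \<tau>" for \<tau>
    using L_x_le[OF s, of "x + \<tau> *\<^sub>R h" "v + \<tau> *\<^sub>R k" r] A norm_ge_zero
    by (metis (no_types, opaque_lifting) G_def order_trans zero_le_mult_iff not_le)
  have G': "\<bar>G' \<tau>\<bar> \<le> c * G \<tau>" for \<tau>
  proof -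
    have "\<bar>G' \<tau>\<bar> \<le> norm (L_x L s (x + \<tau> *\<^sub>R h) (v + \<tau> *\<^sub>R k) r) * norm h + norm (L_v L s (x + \<tau> *\<^sub>R h) (v + \<tau> *\<^sub>R k) r) * norm k"
      unfolding G'_def by (intro order_trans[OF abs_triangle_ineq] add_mono Cauchy_Schwarz_ineq2)
    also have "\<dots> \<le> (A * G \<tau>) * norm h + (A * G \<tau>) * norm k"
      unfolding G_def by (intro add_mono mult_right_mono L_x_le L_v_le s norm_ge_zero)
    also have "\<dots> = A * (norm h + norm k) * G \<tau>" by (simp add: algebra_simps)
    also have "\<dots> \<le> c * G \<tau>" by (intro mult_right_mono c nn)
    finally show ?thesis .
  qed
  have le: "G \<tau> \<le> exp c * G 0" if "\<tau> \<in> {0..1}" for \<tau>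
  proof -
    \<comment> \<open>Differential form of Gronwall, for \<open>G' \<le> c * G\<close>.\<close>
    have "exp (- (c * \<tau>)) * G \<tau> \<le> exp (- (c * 0)) * G 0"
    proof (rule DERIV_nonpos_imp_nonincreasing[of 0 \<tau> "\<lambda>\<tau>. exp (- (c * \<tau>)) * G \<tau>"])
      show "\<exists>y. ((\<lambda>\<tau>. exp (- (c * \<tau>)) * G \<tau>) has_real_derivative y) (at z) \<and> y \<le> 0" for z
      proof (intro exI conjI)
        show "((\<lambda>\<tau>. exp (- (c * \<tau>)) * G \<tau>) has_real_derivative exp (- (c * z)) * (G' z - c * G z)) (at z)"
          by (auto intro!: derivative_eq_intros d simp: algebra_simps)
        show "exp (- (c * z)) * (G' z - c * G z) \<le> 0"
          using G'[of z] by (intro mult_nonneg_nonpos) auto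
      qed
    qed (use that in auto)
    then have "G \<tau> \<le> exp (c * \<tau>) * G 0"
      by (simp add: exp_minus field_simps)
    also have "\<dots> \<le> exp c * G 0"
      using that \<open>0 \<le> c\<close> by (intro mult_right_mono nn) (auto intro: mult_left_le)
    finally show ?thesis .
  qed
  have "norm (G \<epsilon> - G 0) \<le> (c * (exp c * G 0)) * norm (\<epsilon> - 0)"
  proof (rule field_differentiable_bound[of "{0..1}" G G'])
    fix \<tau> :: real assume "\<tau> \<in> {0..1}"
    then have "c * G \<tau> \<le> c * (exp c * G 0)" using le \<open>0 \<le> c\<close> by (intro mult_left_mono)
    then show "norm (G' \<tau>) \<le> c * (exp c * G 0)" using G'[of \<tau>] by simp
    show "(G has_field_derivative G' \<tau>) (at \<tau> within {0..1})" using d by (rule DERIV_subset) simp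
  qed (use \<epsilon> in auto)
  then show ?thesis using \<epsilon> by (simp add: G_def algebra_simps)
qed

end

section \<open>First variation\<close>

lemma absolutely_continuous_diff:
  assumes "absolutely_continuous_on_ivl a b f" "absolutely_continuous_on_ivl a b g"
  shows "absolutely_continuous_on_ivl a b (\<lambda>t. f t - g t)"
proof (rule absolutely_continuous_dominated[OF assms, of _ 1])
  fix s t
  have "(f t - g t) - (f s - g s) = (f t - f s) - (g t - g s)" by simp
  then show "norm ((f t - g t) - (f s - g s)) \<le> 1 * (norm (f t - f s) + norm (g t - g s))"
    by (metis mult_1 norm_triangle_ineq4)
qed

text \<open>Minimality is phrased through end values of solutions, which differ from the action by
  the constant \<open>u\<close> and relate directly to the differential equations.\<close>

locale herglotz_minimizer = herglotz_lagrangian L a b A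
  for L :: "'n::finite lagrangian" and a b A :: real +
  fixes \<xi> :: "real \<Rightarrow> real^'n" and u :: real and w :: "real \<Rightarrow> real"
  assumes \<xi>: "absolutely_continuous_on_ivl a b \<xi>"
    and sol: "caratheodory_solution L a b u \<xi> w"
    and minimal: "\<lbrakk>absolutely_continuous_on_ivl a b \<zeta>; \<zeta> a = \<xi> a; \<zeta> b = \<xi> b;
      caratheodory_solution L a b u \<zeta> w'\<rbrakk> \<Longrightarrow> w b \<le> w' b"
begin

abbreviation "V \<equiv> velocity a b \<xi>"

definition "Lx = (\<lambda>s. L_x L s (\<xi> s) (V s) (w s))"
definition "Lv = (\<lambda>s. L_v L s (\<xi> s) (V s) (w s))"
definition "Lr = (\<lambda>s. L_r L s (\<xi> s) (V s) (w s))"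
text \<open>The common integrable majorant: its first summand is the density of the absolutely
  continuous \<open>w\<close>, the rest is continuous, and \<open>A * G\<close> bounds
  \<open>Lx\<close> and \<open>Lv\<close>.\<close>

definition "G = (\<lambda>s. L s (\<xi> s) (V s) (w s) + A * (1 + \<bar>w s\<bar>) + 1)"
text \<open>Integrating factor of the linearised equation: the derivative of
  \<open>E * \<delta>\<close> is \<open>E\<close> times that of \<open>\<delta>\<close> less
  \<open>Lr * \<delta>\<close>.\<close>

definition "E = (\<lambda>s. exp (- integral {a..s} Lr))"

lemma w_prim: "primitive_on a b w (\<lambda>s. L s (\<xi> s) (V s) (w s))"
  and w_init: "w a = u"
  using sol carath_iff_primitive[OF ab] by blast+

lemma w_cont: "continuous_on {a..b} w"
  using w_prim by (intro absolutely_continuous_imp_continuous_on primitive_on_absolutely_continuous)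

lemma \<xi>_meas: "\<xi> \<in> borel_measurable (lebesgue_on {a..b})"
  by (intro borel_measurable_continuous_on_Icc absolutely_continuous_vec_imp_continuous_on \<xi>)

lemma V_meas: "V \<in> borel_measurable (lebesgue_on {a..b})"
  by (rule velocity_measurable[OF \<xi> ab])

lemma w_meas: "w \<in> borel_measurable (lebesgue_on {a..b})"
  by (rule borel_measurable_continuous_on_Icc[OF w_cont])

lemma Lx_meas: "Lx \<in> borel_measurable (lebesgue_on {a..b})"
  unfolding Lx_def by (rule borel_measurable_lagrangian_comp[OF continuous_L_x[OF C1] \<xi>_meas V_meas w_meas])

lemma Lv_meas: "Lv \<in> borel_measurable (lebesgue_on {a..b})"
  unfolding Lv_def by (rule borel_measurable_lagrangian_comp[OF continuous_L_v[OF C1] \<xi>_meas V_meas w_meas])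

lemma Lr_meas: "Lr \<in> borel_measurable (lebesgue_on {a..b})"
  unfolding Lr_def by (rule borel_measurable_lagrangian_comp[OF continuous_L_r[OF C1] \<xi>_meas V_meas w_meas])

lemma G_int: "integrable (lebesgue_on {a..b}) G"
proof -
  have "integrable (lebesgue_on {a..b}) (\<lambda>s. A * (1 + \<bar>w s\<bar>) + 1)"
    by (intro continuous_imp_integrable_real continuous_intros w_cont)
  then show ?thesis
    unfolding G_def add.assoc
    by (rule Bochner_Integration.integrable_add[OF primitive_on_integrable[OF w_prim]])
qed

lemma Lx_le: "s \<in> {a..b} \<Longrightarrow> norm (Lx s) \<le> A * G s"
  and Lv_le: "s \<in> {a..b} \<Longrightarrow> norm (Lv s) \<le> A * G s"
  and Lr_le: "s \<in> {a..b} \<Longrightarrow> \<bar>Lr s\<bar> \<le> A"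
  unfolding Lx_def Lv_def Lr_def G_def using L_x_le L_v_le L_r_le by blast+

lemma G_nonneg: "s \<in> {a..b} \<Longrightarrow> 0 \<le> G s"
  using Lx_le[of s] A by (smt (verit) norm_ge_zero zero_le_mult_iff)

lemma Lr_int: "integrable (lebesgue_on {a..b}) Lr"
  using Lr_le by (intro measurable_bounded_by_integrable_imp_lebesgue_integrable[OF Lr_meas, of "\<lambda>_. A"])
    (auto intro!: continuous_imp_integrable_real continuous_intros)

lemma Lr_prim: "primitive_on a b (\<lambda>s. integral {a..s} Lr) Lr"
  using primitive_on_integral[OF Lr_int, of 0] by simp

lemma E_ac: "absolutely_continuous_on_ivl a b E"
proof -
  have "absolutely_continuous_on_ivl a b (\<lambda>s. - integral {a..s} Lr)"
    by (rule absolutely_continuous_bounded_linear[OF primitive_on_absolutely_continuous[OF Lr_prim]])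
      (intro bounded_linear_minus bounded_linear_ident)
  then show ?thesis unfolding E_def by (rule absolutely_continuous_exp)
qed

lemma E_pos: "0 < E s"
  by (simp add: E_def)

lemma E_deriv: "AE s\<in>{a..b} in lebesgue. (E has_real_derivative - (Lr s * E s)) (at s within {a..b})"
  using primitive_on_AE_deriv[OF Lr_prim]
  by eventually_elim (auto simp: E_def intro!: derivative_eq_intros)

lemma E_bound: obtains M where "0 < M" "\<And>s. s \<in> {a..b} \<Longrightarrow> E s \<le> M"
  using absolutely_continuous_bounded[OF E_ac] by (metis abs_le_D1)

lemma E_meas: "E \<in> borel_measurable (lebesgue_on {a..b})"
  by (intro borel_measurable_continuous_on_Icc absolutely_continuous_imp_continuous_on E_ac)

lemma integrable_E_mult:
  assumes f: "f \<in> borel_measurable (lebesgue_on {a..b})" and le: "\<And>s. s \<in> {a..b} \<Longrightarrow> \<bar>f s\<bar> \<le> C * G s + D"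
  shows "integrable (lebesgue_on {a..b}) (\<lambda>s. E s * f s)"
proof -
  obtain M where M: "0 < M" "\<And>s. s \<in> {a..b} \<Longrightarrow> E s \<le> M" by (rule E_bound) blast
  show ?thesis
  proof (rule measurable_bounded_by_integrable_imp_lebesgue_integrable)
    show "(\<lambda>s. E s * f s) \<in> borel_measurable (lebesgue_on {a..b})"
      using E_meas f by (rule borel_measurable_times)
    show "integrable (lebesgue_on {a..b}) (\<lambda>s. M * (C * G s + D))"
      by (intro Bochner_Integration.integrable_mult_right Bochner_Integration.integrable_add G_int
          continuous_imp_integrable_real continuous_intros)
    fix s assume s: "s \<in> {a..b}"
    have "norm (E s * f s) = E s * \<bar>f s\<bar>" using E_pos[of s] by (simp add: abs_mult)
    also have "\<dots> \<le> M * (C * G s + D)"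
      using M(2)[OF s] le[OF s] E_pos[of s] by (intro mult_mono) (auto intro: order_trans[OF abs_ge_zero])
    finally show "norm (E s * f s) \<le> M * (C * G s + D)" .
  qed simp
qed

lemma growth_along:
  assumes s: "s \<in> {a..b}" and \<epsilon>: "0 \<le> \<epsilon>" "\<epsilon> \<le> 1" and N: "norm h + norm k \<le> N"
  shows "\<bar>L s (\<xi> s + \<epsilon> *\<^sub>R h) (V s + \<epsilon> *\<^sub>R k) (w s) - L s (\<xi> s) (V s) (w s)\<bar>
    \<le> \<epsilon> * ((A * N) * exp (A * N) * G s)"
proof -
  have "A * (norm h + norm k) \<le> A * N" using N A by (intro mult_left_mono) auto
  from growth[OF s \<epsilon> this, of "\<xi> s" "V s" "w s"] show ?thesis by (simp add: G_def)
qed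

text \<open>The velocity of \<open>\<eta>\<close> is prescribed by a function \<open>\<psi>\<close>
  bounded at every point, so that the growth estimate holds on all of \<open>[a,b]\<close>. It makes
  the right-hand side integrable along any continuous function, and makes the defect of
  \<open>w\<close> of order \<open>\<epsilon>\<close>, with \<open>C\<close> independent of
  \<open>\<epsilon>\<close>.\<close>

lemma perturbed_solution:
  fixes \<eta> \<psi> :: "real \<Rightarrow> real^'n"
  assumes \<eta>: "absolutely_continuous_on_ivl a b \<eta>"
    and \<psi>: "\<psi> \<in> borel_measurable (lebesgue_on {a..b})"
    and deriv: "AE s\<in>{a..b} in lebesgue. (\<eta> has_vector_derivative \<psi> s) (at s within {a..b})"
    and N: "\<And>s. s \<in> {a..b} \<Longrightarrow> norm (\<eta> s) + norm (\<psi> s) \<le> N" and "0 < N"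
  obtains C where "0 < C" "\<And>\<epsilon>. 0 < \<epsilon> \<Longrightarrow> \<epsilon> \<le> 1 \<Longrightarrow> \<exists>w'.
    caratheodory_solution L a b u (\<lambda>s. \<xi> s + \<epsilon> *\<^sub>R \<eta> s) w' \<and>
    primitive_on a b w' (\<lambda>s. L s (\<xi> s + \<epsilon> *\<^sub>R \<eta> s) (V s + \<epsilon> *\<^sub>R \<psi> s) (w' s)) \<and>
    (\<forall>s\<in>{a..b}. \<bar>w' s - w s\<bar> \<le> C * \<epsilon>)"
proof -
  define c where "c = (A * N) * exp (A * N)"
  have "0 < c" using A \<open>0 < N\<close> by (simp add: c_def)
  \<comment> \<open>The stability constant for the defect bound
    \<open>\<epsilon> * (c * integral {a..b} G)\<close>, divided by \<open>\<epsilon>\<close>; the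
    added 1 makes it positive.\<close>
  define C where "C = 2 * (c * integral {a..b} G) * exp (2 * A * (b - a)) + 1"
  have "G integrable_on {a..b}" using G_int by (simp add: integrable_on_lebesgue_on)
  then have "0 \<le> integral {a..b} G" using G_nonneg by (rule Henstock_Kurzweil_Integration.integral_nonneg)
  then have "0 < C" using \<open>0 < c\<close> by (simp add: C_def add_nonneg_pos)
  have "\<exists>w'. caratheodory_solution L a b u (\<lambda>s. \<xi> s + \<epsilon> *\<^sub>R \<eta> s) w' \<and>
    primitive_on a b w' (\<lambda>s. L s (\<xi> s + \<epsilon> *\<^sub>R \<eta> s) (V s + \<epsilon> *\<^sub>R \<psi> s) (w' s)) \<and>
    (\<forall>s\<in>{a..b}. \<bar>w' s - w s\<bar> \<le> C * \<epsilon>)" if \<epsilon>: "0 < \<epsilon>" "\<epsilon> \<le> 1" for \<epsilon>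
  proof -
    define f where "f = (\<lambda>s r. L s (\<xi> s + \<epsilon> *\<^sub>R \<eta> s) (V s + \<epsilon> *\<^sub>R \<psi> s) r)"
    have \<eta>m: "\<eta> \<in> borel_measurable (lebesgue_on {a..b})"
      by (intro borel_measurable_continuous_on_Icc absolutely_continuous_vec_imp_continuous_on \<eta>)
    have fm: "(\<lambda>s. f s (v s)) \<in> borel_measurable (lebesgue_on {a..b})" if "continuous_on {a..b} v" for v
      unfolding f_def
      by (rule borel_measurable_lagrangian_comp[OF continuous_lagrangian[OF C1]])
        (intro borel_measurable_add borel_measurable_scaleR borel_measurable_const \<xi>_meas V_meas \<eta>m \<psi>
          borel_measurable_continuous_on_Icc that)+
    have lip: "\<bar>f s r - f s r'\<bar> \<le> A * \<bar>r - r'\<bar>" if "s \<in> {a..b}" for s r r'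
      unfolding f_def using that by (rule lipschitz)
    have gr: "\<bar>f s (w s) - L s (\<xi> s) (V s) (w s)\<bar> \<le> \<epsilon> * (c * G s)" if s: "s \<in> {a..b}" for s
      using growth_along[OF s _ \<epsilon>(2) N[OF s]] \<epsilon>(1) by (simp add: f_def c_def)
    have int: "integrable (lebesgue_on {a..b}) (\<lambda>s. f s (v s))" if v: "continuous_on {a..b} v" for v
    proof (rule measurable_bounded_by_integrable_imp_lebesgue_integrable[OF fm[OF v]])
      show "integrable (lebesgue_on {a..b}) (\<lambda>s. \<bar>L s (\<xi> s) (V s) (w s)\<bar> + c * G s + A * \<bar>v s - w s\<bar>)"
        by (intro Bochner_Integration.integrable_add Bochner_Integration.integrable_abs
            primitive_on_integrable[OF w_prim] Bochner_Integration.integrable_mult_right G_int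
            continuous_imp_integrable_real continuous_intros v w_cont)
      fix s assume s: "s \<in> {a..b}"
      have "\<epsilon> * (c * G s) \<le> c * G s"
        using \<epsilon> \<open>0 < c\<close> G_nonneg[OF s] by (intro mult_left_le_one_le) auto
      then show "norm (f s (v s)) \<le> \<bar>L s (\<xi> s) (V s) (w s)\<bar> + c * G s + A * \<bar>v s - w s\<bar>"
        using gr[OF s] lip[OF s, of "v s" "w s"] unfolding real_norm_def by linarith
    qed simp
    obtain w' where w': "w' a = u" "primitive_on a b w' (\<lambda>s. f s (w' s))"
      using ode_existence[of a b A f u] ab A lip int by (metis less_imp_le)
    have close: "\<bar>w' s - w s\<bar> \<le> C * \<epsilon>" if s: "s \<in> {a..b}" for s
    proof -
      have i1: "integrable (lebesgue_on {a..b}) (\<lambda>s. \<bar>f s (w s) - L s (\<xi> s) (V s) (w s)\<bar>)"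
        by (intro Bochner_Integration.integrable_abs Bochner_Integration.integrable_diff int w_cont primitive_on_integrable[OF w_prim])
      have "integral {a..b} (\<lambda>s. \<bar>f s (w s) - L s (\<xi> s) (V s) (w s)\<bar>) \<le> integral {a..b} (\<lambda>s. \<epsilon> * (c * G s))"
        using i1 G_int gr by (intro integral_le) (auto intro!: integrable_on_lebesgue_on)
      also have "\<dots> = \<epsilon> * (c * integral {a..b} G)" by simp
      finally have "\<bar>w' s - w s\<bar> \<le> 2 * (\<epsilon> * (c * integral {a..b} G)) * exp (2 * A * (b - a))"
        using w' w_init ab
        by (intro ode_stability[of a b A f, OF _ A lip w'(2) w_prim _ int[OF w_cont] _ s]) auto
      also have "\<dots> \<le> C * \<epsilon>" using \<epsilon> by (simp add: C_def algebra_simps)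
      finally show ?thesis .
    qed
    \<comment> \<open>The equation was solved with \<open>\<psi>\<close>; the true velocity agrees
      with it off a null set, which the integral form ignores.\<close>
    have "AE s\<in>{a..b} in lebesgue. velocity a b (\<lambda>s. \<xi> s + \<epsilon> *\<^sub>R \<eta> s) s = V s + \<epsilon> *\<^sub>R \<psi> s"
      using deriv absolutely_continuous_velocity(2)[OF \<xi> ab]
    proof eventually_elim
      case (elim s)
      then show ?case
        by (auto intro!: velocity_eqI ab has_vector_derivative_add
            bounded_linear.has_vector_derivative[OF bounded_linear_scaleR_right])
    qed
    then have "AE s\<in>{a..b} in lebesgue. L s (\<xi> s + \<epsilon> *\<^sub>R \<eta> s) (velocity a b (\<lambda>s. \<xi> s + \<epsilon> *\<^sub>R \<eta> s) s) (w' s) = f s (w' s)"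
      unfolding f_def by eventually_elim auto
    then have "primitive_on a b w' (\<lambda>s. L s (\<xi> s + \<epsilon> *\<^sub>R \<eta> s) (velocity a b (\<lambda>s. \<xi> s + \<epsilon> *\<^sub>R \<eta> s) s) (w' s))"
      by (rule primitive_on_cong_AE[OF w'(2)])
    then have "caratheodory_solution L a b u (\<lambda>s. \<xi> s + \<epsilon> *\<^sub>R \<eta> s) w'"
      using w'(1) carath_iff_primitive[OF ab] by blast
    then show ?thesis using w'(2) close unfolding f_def by blast
  qed
  then show ?thesis using that[OF \<open>0 < C\<close>] by blast
qed

text \<open>The integral of \<open>Q n\<close> is the increment of \<open>E * \<delta> n\<close>
  divided by \<open>e n\<close>. It is nonnegative because \<open>\<delta> n\<close> vanishes at
  \<open>a\<close> and, by minimality, is nonnegative at \<open>b\<close>. Dominated convergence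
  passes this sign to the limit.\<close>

lemma first_variation_nonneg:
  fixes \<eta> \<psi> :: "real \<Rightarrow> real^'n"
  assumes \<eta>: "absolutely_continuous_on_ivl a b \<eta>" and ends: "\<eta> a = 0" "\<eta> b = 0"
    and \<psi>: "\<psi> \<in> borel_measurable (lebesgue_on {a..b})"
    and deriv: "AE s\<in>{a..b} in lebesgue. (\<eta> has_vector_derivative \<psi> s) (at s within {a..b})"
    and N: "\<And>s. s \<in> {a..b} \<Longrightarrow> norm (\<eta> s) + norm (\<psi> s) \<le> N" and "0 < N"
  shows "0 \<le> integral {a..b} (\<lambda>s. E s * (Lx s \<bullet> \<eta> s + Lv s \<bullet> \<psi> s))"
proof -
  obtain C where "0 < C" and C: "\<And>\<epsilon>. 0 < \<epsilon> \<Longrightarrow> \<epsilon> \<le> 1 \<Longrightarrow> \<exists>w'.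
    caratheodory_solution L a b u (\<lambda>s. \<xi> s + \<epsilon> *\<^sub>R \<eta> s) w' \<and>
    primitive_on a b w' (\<lambda>s. L s (\<xi> s + \<epsilon> *\<^sub>R \<eta> s) (V s + \<epsilon> *\<^sub>R \<psi> s) (w' s)) \<and>
    (\<forall>s\<in>{a..b}. \<bar>w' s - w s\<bar> \<le> C * \<epsilon>)"
    using perturbed_solution[OF \<eta> \<psi> deriv N \<open>0 < N\<close>] by blast
  define e where "e = (\<lambda>n. inverse (real (Suc n)))"
  have e: "0 < e n" "e n \<le> 1" for n by (auto simp: e_def inverse_le_1_iff)
  have e_lim: "e \<longlonglongrightarrow> 0" unfolding e_def by (rule LIMSEQ_inverse_real_of_nat)
  obtain W where Wc: "\<And>n. caratheodory_solution L a b u (\<lambda>s. \<xi> s + e n *\<^sub>R \<eta> s) (W n)"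
    and Wp: "\<And>n. primitive_on a b (W n) (\<lambda>s. L s (\<xi> s + e n *\<^sub>R \<eta> s) (V s + e n *\<^sub>R \<psi> s) (W n s))"
    and Wb: "\<And>n s. s \<in> {a..b} \<Longrightarrow> \<bar>W n s - w s\<bar> \<le> C * e n"
  proof -
    have "\<forall>n. \<exists>w'. caratheodory_solution L a b u (\<lambda>s. \<xi> s + e n *\<^sub>R \<eta> s) w' \<and>
      primitive_on a b w' (\<lambda>s. L s (\<xi> s + e n *\<^sub>R \<eta> s) (V s + e n *\<^sub>R \<psi> s) (w' s)) \<and>
      (\<forall>s\<in>{a..b}. \<bar>w' s - w s\<bar> \<le> C * e n)"
      using C[OF e] by blast
    from choice[OF this] show ?thesis using that by blast
  qed
  define c where "c = (A * N) * exp (A * N)"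
  define \<delta> where "\<delta> = (\<lambda>n s. W n s - w s)"
  define F where "F = (\<lambda>n s. L s (\<xi> s + e n *\<^sub>R \<eta> s) (V s + e n *\<^sub>R \<psi> s) (W n s) - L s (\<xi> s) (V s) (w s))"
  \<comment> \<open>The quotient of \<open>\<delta> n\<close> by \<open>e n\<close> is bounded but
    not known to converge. Subtracting \<open>Lr * \<delta> n\<close> beforehand leaves the
    first-order terms in \<open>\<eta>\<close> and \<open>\<psi>\<close> and a vanishing
    remainder.\<close>
  define Q where "Q = (\<lambda>n s. E s * ((F n s - Lr s * \<delta> n s) / e n))"
  define Q0 where "Q0 = (\<lambda>s. E s * (Lx s \<bullet> \<eta> s + Lv s \<bullet> \<psi> s))"
  have prim: "primitive_on a b (\<lambda>s. E s * \<delta> n s) (\<lambda>s. e n * Q n s)" for n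
  proof (rule primitive_onI_deriv[OF _ ab])
    show "absolutely_continuous_on_ivl a b (\<lambda>s. E s * \<delta> n s)"
      unfolding \<delta>_def by (intro absolutely_continuous_mult E_ac absolutely_continuous_diff
          primitive_on_absolutely_continuous[OF Wp] primitive_on_absolutely_continuous[OF w_prim])
    show "AE s\<in>{a..b} in lebesgue. ((\<lambda>s. E s * \<delta> n s) has_real_derivative e n * Q n s) (at s within {a..b})"
      using E_deriv primitive_on_AE_deriv[OF Wp[of n]] primitive_on_AE_deriv[OF w_prim]
    proof eventually_elim
      case (elim s)
      show ?case
      proof
        assume s: "s \<in> {a..b}"
        have "((\<lambda>s. E s * \<delta> n s) has_real_derivative E s * F n s + - (Lr s * E s) * \<delta> n s) (at s within {a..b})"
          unfolding \<delta>_def F_def using elim s by (intro DERIV_mult' DERIV_diff) auto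
        moreover have "E s * F n s + - (Lr s * E s) * \<delta> n s = e n * Q n s"
        proof -
          have "e n * Q n s = E s * (F n s - Lr s * \<delta> n s)" using e(1)[of n] by (simp add: Q_def)
          then show ?thesis by (simp add: algebra_simps)
        qed
        ultimately show "((\<lambda>s. E s * \<delta> n s) has_real_derivative e n * Q n s) (at s within {a..b})" by simp
      qed
    qed
  qed
  have eQi: "(\<lambda>s. e n * Q n s) integrable_on {a..b}" for n
    using primitive_on_integrable[OF prim[of n]] by (simp add: integrable_on_lebesgue_on)
  have Qi: "Q n integrable_on {a..b}" for n
    using integrable_on_cmult_left[OF eQi[of n], of "inverse (e n)"] e(1)[of n] by (simp add: field_simps)
  have Qnn: "0 \<le> integral {a..b} (Q n)" for n
  proof -
    have "w b \<le> W n b"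
      by (rule minimal[OF _ _ _ Wc[of n]])
        (auto simp: ends intro!: absolutely_continuous_add \<xi> absolutely_continuous_bounded_linear[OF \<eta>] bounded_linear_scaleR_right)
    moreover have "W n a = w a"
      using Wc[of n] w_init unfolding caratheodory_solution_def by simp
    ultimately have "0 \<le> E b * \<delta> n b - E a * \<delta> n a"
      using E_pos[of b] by (simp add: \<delta>_def)
    also have "\<dots> = integral {a..b} (\<lambda>s. e n * Q n s)"
      by (rule primitive_on_diff[OF prim]) (use ab in auto)
    also have "\<dots> = e n * integral {a..b} (Q n)" by simp
    finally show ?thesis using e(1)[of n] by (simp add: zero_le_mult_iff)
  qed
  obtain M where M: "0 < M" "\<And>s. s \<in> {a..b} \<Longrightarrow> E s \<le> M" by (rule E_bound) blast
  \<comment> \<open>One \<open>A * C\<close> comes from the Lipschitz bound in \<open>r\<close>, the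
    other from \<open>Lr * \<delta> n\<close>, and \<open>c * G s\<close> from the growth
    estimate.\<close>
  have Qle: "norm (Q n s) \<le> M * (2 * A * C + c * G s)" if s: "s \<in> {a..b}" for n s
  proof -
    have d: "\<bar>\<delta> n s\<bar> \<le> C * e n" using Wb[OF s] by (simp add: \<delta>_def)
    then have Ad: "A * \<bar>\<delta> n s\<bar> \<le> A * (C * e n)" using A by (intro mult_left_mono) auto
    have "\<bar>F n s\<bar> \<le> A * \<bar>\<delta> n s\<bar> + e n * (c * G s)"
      using lipschitz[OF s, of "\<xi> s + e n *\<^sub>R \<eta> s" "V s + e n *\<^sub>R \<psi> s" "W n s" "w s"]
        growth_along[OF s _ e(2)[of n] N[OF s]] e(1)[of n]
      unfolding F_def \<delta>_def c_def by linarith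
    moreover have "\<bar>Lr s * \<delta> n s\<bar> \<le> A * \<bar>\<delta> n s\<bar>"
      using Lr_le[OF s] by (simp add: abs_mult mult_right_mono)
    ultimately have "\<bar>F n s - Lr s * \<delta> n s\<bar> \<le> A * (C * e n) + A * (C * e n) + e n * (c * G s)"
      using Ad by linarith
    also have "\<dots> = (2 * A * C + c * G s) * e n" by (simp add: algebra_simps)
    finally have "\<bar>F n s - Lr s * \<delta> n s\<bar> / e n \<le> 2 * A * C + c * G s"
      using e(1)[of n] by (simp add: divide_le_eq)
    then show ?thesis
      using M(2)[OF s] E_pos[of s] e(1)[of n] M(1)
      unfolding Q_def real_norm_def abs_mult abs_divide by (intro mult_mono) auto
  qed
  have Qlim: "(\<lambda>n. Q n s) \<longlonglongrightarrow> Q0 s" if s: "s \<in> {a..b}" for s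
  proof -
    let ?f = "\<lambda>(x, v, r). L s x v r" and ?p = "(\<xi> s, V s, w s)"
    let ?h = "\<lambda>n. (e n *\<^sub>R \<eta> s, e n *\<^sub>R \<psi> s, \<delta> n s)"
    let ?D = "\<lambda>(h, k, \<rho>). L_x L s (\<xi> s) (V s) (w s) \<bullet> h + L_v L s (\<xi> s) (V s) (w s) \<bullet> k + L_r L s (\<xi> s) (V s) (w s) * \<rho>"
    have "(\<lambda>n. (?f (?p + ?h n) - ?f ?p - ?D (?h n)) / e n) \<longlonglongrightarrow> 0"
    proof (rule has_derivative_remainder_quotient[OF has_derivative_lagrangian[OF C1] _ e(1) e_lim])
      fix n
      have "norm (?h n) \<le> norm (e n *\<^sub>R \<eta> s) + (norm (e n *\<^sub>R \<psi> s) + norm (\<delta> n s))"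
        by (intro order_trans[OF norm_Pair_le] add_left_mono norm_Pair_le)
      also have "\<dots> \<le> (norm (\<eta> s) + norm (\<psi> s)) * e n + C * e n"
        using e(1)[of n] Wb[OF s, of n] by (simp add: \<delta>_def algebra_simps)
      also have "\<dots> \<le> N * e n + C * e n"
        using N[OF s] e(1)[of n] by (intro add_right_mono mult_right_mono) auto
      finally show "norm (?h n) \<le> (N + C) * e n" by (simp add: algebra_simps)
    qed
    moreover have "(?f (?p + ?h n) - ?f ?p - ?D (?h n)) / e n
        = (F n s - Lr s * \<delta> n s) / e n - (Lx s \<bullet> \<eta> s + Lv s \<bullet> \<psi> s)" for n
      using e(1)[of n] by (simp add: F_def \<delta>_def Lx_def Lv_def Lr_def field_simps)
    ultimately have "(\<lambda>n. (F n s - Lr s * \<delta> n s) / e n - (Lx s \<bullet> \<eta> s + Lv s \<bullet> \<psi> s)) \<longlonglongrightarrow> 0" by simp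
    then have "(\<lambda>n. (F n s - Lr s * \<delta> n s) / e n) \<longlonglongrightarrow> Lx s \<bullet> \<eta> s + Lv s \<bullet> \<psi> s"
      by (rule LIM_zero_cancel)
    then show ?thesis unfolding Q_def Q0_def by (intro tendsto_intros)
  qed
  have Gi: "(\<lambda>s. M * (2 * A * C + c * G s)) integrable_on {a..b}"
    by (intro integrable_on_lebesgue_on Bochner_Integration.integrable_mult_right
        Bochner_Integration.integrable_add G_int continuous_imp_integrable_real continuous_intros) simp
  have "(\<lambda>n. integral {a..b} (Q n)) \<longlonglongrightarrow> integral {a..b} Q0"
    by (rule dominated_convergence(2)[OF Qi Gi Qle Qlim])
  then have "0 \<le> integral {a..b} Q0"
    by (rule LIMSEQ_le_const) (use Qnn in blast)
  then show ?thesis unfolding Q0_def .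
qed

lemma first_variation:
  fixes \<eta> \<psi> :: "real \<Rightarrow> real^'n"
  assumes \<eta>: "absolutely_continuous_on_ivl a b \<eta>" and ends: "\<eta> a = 0" "\<eta> b = 0"
    and \<psi>: "\<psi> \<in> borel_measurable (lebesgue_on {a..b})"
    and deriv: "AE s\<in>{a..b} in lebesgue. (\<eta> has_vector_derivative \<psi> s) (at s within {a..b})"
    and N: "\<And>s. s \<in> {a..b} \<Longrightarrow> norm (\<eta> s) + norm (\<psi> s) \<le> N" and "0 < N"
  shows "integral {a..b} (\<lambda>s. E s * (Lx s \<bullet> \<eta> s + Lv s \<bullet> \<psi> s)) = 0"
proof (rule antisym)
  have "0 \<le> integral {a..b} (\<lambda>s. E s * (Lx s \<bullet> - \<eta> s + Lv s \<bullet> - \<psi> s))"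
  proof (rule first_variation_nonneg[OF _ _ _ _ _ _ \<open>0 < N\<close>])
    show "absolutely_continuous_on_ivl a b (\<lambda>s. - \<eta> s)"
      by (intro absolutely_continuous_bounded_linear[OF \<eta>] bounded_linear_minus bounded_linear_ident)
    show "AE s\<in>{a..b} in lebesgue. ((\<lambda>s. - \<eta> s) has_vector_derivative - \<psi> s) (at s within {a..b})"
      using deriv by eventually_elim (auto intro: has_vector_derivative_minus)
  qed (use ends \<psi> N in auto)
  also have "\<dots> = integral {a..b} (\<lambda>s. - (E s * (Lx s \<bullet> \<eta> s + Lv s \<bullet> \<psi> s)))"
    by (intro Henstock_Kurzweil_Integration.integral_cong) (simp add: algebra_simps)
  finally show "integral {a..b} (\<lambda>s. E s * (Lx s \<bullet> \<eta> s + Lv s \<bullet> \<psi> s)) \<le> 0" by simp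
  show "0 \<le> integral {a..b} (\<lambda>s. E s * (Lx s \<bullet> \<eta> s + Lv s \<bullet> \<psi> s))"
    by (rule first_variation_nonneg[OF assms])
qed

end

section \<open>The Herglotz equation\<close>

text \<open>The test function is \<open>sgn (q - mean q)\<close> minus its mean, where \<open>q\<close> is \<open>Y\<close> minus the
  primitive of \<open>X\<close>.\<close>

lemma dubois_reymond:
  fixes X Y :: "real \<Rightarrow> real"
  assumes ab: "a < b" and X: "integrable (lebesgue_on {a..b}) X" and Y: "integrable (lebesgue_on {a..b}) Y"
    and weak: "\<And>\<phi>. \<lbrakk>\<phi> \<in> borel_measurable (lebesgue_on {a..b}); \<And>s. \<bar>\<phi> s\<bar> \<le> 2; integral {a..b} \<phi> = 0\<rbrakk>
      \<Longrightarrow> integral {a..b} (\<lambda>s. X s * integral {a..s} \<phi> + Y s * \<phi> s) = 0"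
  obtains c where "AE s\<in>{a..b} in lebesgue. Y s = c + integral {a..s} X"
proof -
  define P where "P = (\<lambda>t. integral {a..t} X)"
  have P: "primitive_on a b P X" using primitive_on_integral[OF X, of 0] by (simp add: P_def)
  have Pc: "continuous_on {a..b} P"
    by (intro absolutely_continuous_imp_continuous_on primitive_on_absolutely_continuous[OF P])
  have Pi: "integrable (lebesgue_on {a..b}) P" by (rule continuous_imp_integrable_real[OF Pc])
  define q where "q = (\<lambda>s. Y s - P s)"
  have qi: "integrable (lebesgue_on {a..b}) q" unfolding q_def using Y Pi by simp
  define c where "c = integral {a..b} q / (b - a)"
  have const: "integrable (lebesgue_on {a..b}) (\<lambda>s. k)" for k :: real
    by (intro continuous_imp_integrable_real continuous_intros)
  have hk: "g integrable_on {a..b}" if "integrable (lebesgue_on {a..b}) g" for g :: "real \<Rightarrow> real"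
    using that by (simp add: integrable_on_lebesgue_on)
  define r where "r = (\<lambda>s. q s - c)"
  have ri: "integrable (lebesgue_on {a..b}) r" unfolding r_def using qi const by simp
  have r0: "integral {a..b} r = 0"
    unfolding r_def using ab by (simp add: Henstock_Kurzweil_Integration.integral_diff[OF hk[OF qi] hk[OF const]] c_def)
  \<comment> \<open>As a mean of signs it is at most 1 in absolute value, whence the bound 2 on
    admissible test functions.\<close>
  define m where "m = integral {a..b} (\<lambda>s. sgn (r s)) / (b - a)"
  have sm: "(\<lambda>s. sgn (r s)) \<in> borel_measurable (lebesgue_on {a..b})"
  proof -
    have [measurable]: "r \<in> borel_measurable (lebesgue_on {a..b})" using ri by auto
    show ?thesis unfolding sgn_if by measurable
  qed
  have si: "integrable (lebesgue_on {a..b}) (\<lambda>s. sgn (r s))"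
    by (rule measurable_bounded_by_integrable_imp_lebesgue_integrable[OF sm const[of 1]]) (auto simp: sgn_real_def)
  have "\<bar>integral {a..b} (\<lambda>s. sgn (r s))\<bar> \<le> integral {a..b} (\<lambda>s. 1)"
    using integral_norm_bound_integral[OF hk[OF si] hk[OF const[of 1]]] by (auto simp: sgn_real_def)
  then have m1: "\<bar>m\<bar> \<le> 1" using ab by (simp add: m_def abs_divide divide_le_eq)
  define \<phi> where "\<phi> = (\<lambda>s. sgn (r s) - m)"
  have \<phi>m: "\<phi> \<in> borel_measurable (lebesgue_on {a..b})" unfolding \<phi>_def using sm by measurable
  have \<phi>i: "integrable (lebesgue_on {a..b}) \<phi>" unfolding \<phi>_def using si const by simp
  have \<phi>2: "\<bar>\<phi> s\<bar> \<le> 2" for s using m1 by (auto simp: \<phi>_def sgn_real_def)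
  have \<phi>0: "integral {a..b} \<phi> = 0"
    unfolding \<phi>_def using ab by (simp add: Henstock_Kurzweil_Integration.integral_diff[OF hk[OF si] hk[OF const]] m_def)
  define H where "H = (\<lambda>t. integral {a..t} \<phi>)"
  have H: "primitive_on a b H \<phi>" using primitive_on_integral[OF \<phi>i, of 0] by (simp add: H_def)
  \<comment> \<open>Integration by parts; the boundary terms vanish since \<open>H\<close> is zero
    at both ends.\<close>
  have PH: "primitive_on a b (\<lambda>s. P s * H s) (\<lambda>s. X s * H s + P s * \<phi> s)"
  proof (rule primitive_onI_deriv[OF _ ab])
    show "absolutely_continuous_on_ivl a b (\<lambda>s. P s * H s)"
      by (intro absolutely_continuous_mult primitive_on_absolutely_continuous[OF P] primitive_on_absolutely_continuous[OF H])
    show "AE s\<in>{a..b} in lebesgue. ((\<lambda>s. P s * H s) has_real_derivative X s * H s + P s * \<phi> s) (at s within {a..b})"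
      using primitive_on_AE_deriv[OF P] primitive_on_AE_deriv[OF H]
      by eventually_elim (auto intro!: derivative_eq_intros)
  qed
  have r\<phi>: "integrable (lebesgue_on {a..b}) (\<lambda>s. r s * \<phi> s)"
  proof (rule measurable_bounded_by_integrable_imp_lebesgue_integrable)
    show "(\<lambda>s. r s * \<phi> s) \<in> borel_measurable (lebesgue_on {a..b})" using ri \<phi>m by measurable
    show "integrable (lebesgue_on {a..b}) (\<lambda>s. \<bar>r s\<bar> * 2)" using ri by simp
  qed (use \<phi>2 in \<open>auto simp: abs_mult intro: mult_left_mono\<close>)
  have "integral {a..b} (\<lambda>s. r s * \<phi> s) = integral {a..b} (\<lambda>s. (X s * H s + Y s * \<phi> s) - (X s * H s + P s * \<phi> s) - c * \<phi> s)"
    by (intro Henstock_Kurzweil_Integration.integral_cong) (simp add: r_def q_def algebra_simps)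
  also have "\<dots> = 0"
  proof -
    have 1: "(\<lambda>s. X s * H s + P s * \<phi> s) integrable_on {a..b}" by (rule hk[OF primitive_on_integrable[OF PH]])
    have 3: "(\<lambda>s. c * \<phi> s) integrable_on {a..b}" using \<phi>i by (intro hk) simp
    have "(\<lambda>s. (r s * \<phi> s + (X s * H s + P s * \<phi> s)) + c * \<phi> s) integrable_on {a..b}"
      by (intro Henstock_Kurzweil_Integration.integrable_add hk[OF r\<phi>] 1 3)
    then have 2: "(\<lambda>s. X s * H s + Y s * \<phi> s) integrable_on {a..b}"
      by (rule integrable_eq) (simp add: r_def q_def algebra_simps)
    have "integral {a..b} (\<lambda>s. X s * H s + P s * \<phi> s) = P b * H b - P a * H a"
      by (rule primitive_on_diff[OF PH, symmetric]) (use ab in auto)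
    also have "\<dots> = 0" by (simp add: H_def \<phi>0)
    finally have "integral {a..b} (\<lambda>s. X s * H s + P s * \<phi> s) = 0" .
    moreover have "integral {a..b} (\<lambda>s. X s * H s + Y s * \<phi> s) = 0"
      using weak[OF \<phi>m \<phi>2 \<phi>0] by (simp add: H_def)
    moreover have "integral {a..b} (\<lambda>s. c * \<phi> s) = 0" by (simp add: \<phi>0)
    ultimately show ?thesis
      by (simp only: Henstock_Kurzweil_Integration.integral_diff[OF integrable_diff[OF 2 1] 3]
          Henstock_Kurzweil_Integration.integral_diff[OF 2 1])
  qed
  finally have "integral {a..b} (\<lambda>s. r s * \<phi> s) = 0" .
  \<comment> \<open>The mean \<open>m\<close> contributes nothing because \<open>r\<close> has
    integral zero.\<close>
  moreover have "integral {a..b} (\<lambda>s. r s * \<phi> s) = integral {a..b} (\<lambda>s. \<bar>r s\<bar>)"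
  proof -
    have "integral {a..b} (\<lambda>s. r s * \<phi> s) = integral {a..b} (\<lambda>s. \<bar>r s\<bar> - m * r s)"
      by (intro Henstock_Kurzweil_Integration.integral_cong) (simp add: \<phi>_def algebra_simps abs_sgn)
    also have "\<dots> = integral {a..b} (\<lambda>s. \<bar>r s\<bar>)"
      using ri by (subst Henstock_Kurzweil_Integration.integral_diff) (auto intro!: hk simp: r0)
    finally show ?thesis .
  qed
  ultimately have "integral\<^sup>L (lebesgue_on {a..b}) (\<lambda>s. \<bar>r s\<bar>) = 0"
    using ri by (subst lebesgue_integral_eq_integral) auto
  then have "AE s in lebesgue_on {a..b}. \<bar>r s\<bar> = 0"
    using ri by (subst (asm) integral_nonneg_eq_0_iff_AE) auto
  then have "AE s\<in>{a..b} in lebesgue. r s = 0"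
    by (subst (asm) AE_restrict_space_iff) auto
  then have "AE s\<in>{a..b} in lebesgue. Y s = c + integral {a..s} X"
    by eventually_elim (auto simp: r_def q_def P_def)
  then show ?thesis by (rule that)
qed

context herglotz_minimizer
begin

lemma Lx_int: "integrable (lebesgue_on {a..b}) (\<lambda>s. E s * Lx s $ i)"
  and Lv_int: "integrable (lebesgue_on {a..b}) (\<lambda>s. E s * Lv s $ i)"
proof -
  have m: "(\<lambda>s. f s $ i) \<in> borel_measurable (lebesgue_on {a..b})"
    if "f \<in> borel_measurable (lebesgue_on {a..b})" for f :: "real \<Rightarrow> real^'n"
    by (rule measurable_compose[OF that]) measurable
  show "integrable (lebesgue_on {a..b}) (\<lambda>s. E s * Lx s $ i)"
    by (rule integrable_E_mult[OF m[OF Lx_meas], of A 0])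
      (use Lx_le component_le_norm_cart order_trans in fastforce)
  show "integrable (lebesgue_on {a..b}) (\<lambda>s. E s * Lv s $ i)"
    by (rule integrable_E_mult[OF m[OF Lv_meas], of A 0])
      (use Lv_le component_le_norm_cart order_trans in fastforce)
qed

text \<open>Test curves move along one coordinate axis only, with a primitive of
  \<open>\<phi>\<close> as coefficient; it vanishes at \<open>b\<close> because
  \<open>\<phi>\<close> has integral zero.\<close>

lemma herglotz_component:
  obtains c where "AE s\<in>{a..b} in lebesgue. E s * Lv s $ i = c + integral {a..s} (\<lambda>s. E s * Lx s $ i)"
proof (rule dubois_reymond[OF ab Lx_int Lv_int])
  fix \<phi> :: "real \<Rightarrow> real"
  assume \<phi>: "\<phi> \<in> borel_measurable (lebesgue_on {a..b})" "\<And>s. \<bar>\<phi> s\<bar> \<le> 2" "integral {a..b} \<phi> = 0"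
  have \<phi>i: "integrable (lebesgue_on {a..b}) \<phi>"
    using \<phi>(2) by (intro measurable_bounded_by_integrable_imp_lebesgue_integrable[OF \<phi>(1), of "\<lambda>_. 2"])
      (auto intro!: continuous_imp_integrable_real continuous_intros)
  define H where "H = (\<lambda>t. integral {a..t} \<phi>)"
  have H: "primitive_on a b H \<phi>" using primitive_on_integral[OF \<phi>i, of 0] by (simp add: H_def)
  have Hac: "absolutely_continuous_on_ivl a b H" by (rule primitive_on_absolutely_continuous[OF H])
  obtain B where B: "B > 0" "\<And>s. s \<in> {a..b} \<Longrightarrow> \<bar>H s\<bar> \<le> B" using absolutely_continuous_bounded[OF Hac] by blast
  have "integral {a..b} (\<lambda>s. E s * (Lx s \<bullet> H s *\<^sub>R axis i 1 + Lv s \<bullet> \<phi> s *\<^sub>R axis i 1)) = 0"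
  proof (rule first_variation[of _ _ "B + 2"])
    show "absolutely_continuous_on_ivl a b (\<lambda>s. H s *\<^sub>R (axis i 1 :: real^'n))"
      by (rule absolutely_continuous_bounded_linear[OF Hac bounded_linear_scaleR_left])
    show "(\<lambda>s. \<phi> s *\<^sub>R (axis i 1 :: real^'n)) \<in> borel_measurable (lebesgue_on {a..b})"
      using \<phi>(1) by (intro borel_measurable_scaleR borel_measurable_const)
    show "AE s\<in>{a..b} in lebesgue. ((\<lambda>s. H s *\<^sub>R (axis i 1 :: real^'n)) has_vector_derivative \<phi> s *\<^sub>R axis i 1) (at s within {a..b})"
      using primitive_on_AE_deriv[OF H]
      by eventually_elim (auto simp: has_real_derivative_iff_has_vector_derivative
          intro!: bounded_linear.has_vector_derivative[OF bounded_linear_scaleR_left])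
    fix s assume s: "s \<in> {a..b}"
    show "norm (H s *\<^sub>R (axis i 1 :: real^'n)) + norm (\<phi> s *\<^sub>R (axis i 1 :: real^'n)) \<le> B + 2"
      using B(2)[OF s] \<phi>(2)[of s] by simp
  qed (use \<phi>(3) B(1) in \<open>auto simp: H_def\<close>)
  then show "integral {a..b} (\<lambda>s. E s * Lx s $ i * integral {a..s} \<phi> + E s * Lv s $ i * \<phi> s) = 0"
    by (simp add: inner_axis H_def algebra_simps)
qed (use that in blast)

text \<open>Multiplying the integrated identity by \<open>D = 1 / E\<close> gives the absolutely
  continuous representative \<open>p\<close>. The product rule differentiates it almost everywhere,
  and the derivative of \<open>D\<close> produces the term
  \<open>Lr s *\<^sub>R Lv s\<close>.\<close>

theorem herglotz_equation:
  "\<exists>p. absolutely_continuous_on_ivl a b p \<and>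
    (AE s\<in>{a..b} in lebesgue. Lv s = p s) \<and>
    (AE s\<in>{a..b} in lebesgue. (p has_vector_derivative (Lx s + Lr s *\<^sub>R Lv s)) (at s within {a..b}))"
proof -
  have "\<forall>i. \<exists>c. AE s\<in>{a..b} in lebesgue. E s * Lv s $ i = c + integral {a..s} (\<lambda>s. E s * Lx s $ i)"
    using herglotz_component by blast
  from choice[OF this] obtain c
    where c: "\<And>i. AE s\<in>{a..b} in lebesgue. E s * Lv s $ i = c i + integral {a..s} (\<lambda>s. E s * Lx s $ i)"
    by blast
  define D where "D = (\<lambda>s. exp (integral {a..s} Lr))"
  have DE: "D s * E s = 1" for s by (simp add: D_def E_def exp_minus)
  have Dac: "absolutely_continuous_on_ivl a b D"
    unfolding D_def by (intro absolutely_continuous_exp primitive_on_absolutely_continuous[OF Lr_prim])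
  have Dd: "AE s\<in>{a..b} in lebesgue. (D has_real_derivative Lr s * D s) (at s within {a..b})"
    using primitive_on_AE_deriv[OF Lr_prim]
    by eventually_elim (auto simp: D_def intro!: derivative_eq_intros)
  define I where "I = (\<lambda>i s. c i + integral {a..s} (\<lambda>s. E s * Lx s $ i))"
  have I: "primitive_on a b (I i) (\<lambda>s. E s * Lx s $ i)" for i
    unfolding I_def by (rule primitive_on_integral[OF Lx_int])
  define p :: "real \<Rightarrow> real^'n" where "p = (\<lambda>s. \<chi> i. D s * I i s)"
  have ac: "absolutely_continuous_on_ivl a b p"
    unfolding p_def
    by (rule absolutely_continuous_vec)
      (simp add: absolutely_continuous_mult[OF Dac primitive_on_absolutely_continuous[OF I]])
  have "AE s in lebesgue. \<forall>i. s \<in> {a..b} \<longrightarrow> E s * Lv s $ i = I i s"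
    unfolding AE_all_countable I_def using c by blast
  then have eq: "AE s\<in>{a..b} in lebesgue. Lv s = p s"
  proof eventually_elim
    case (elim s)
    show ?case
    proof
      assume "s \<in> {a..b}"
      then have "I i s = E s * Lv s $ i" for i using elim by simp
      then have "p s = (\<chi> i. (D s * E s) * Lv s $ i)" by (simp add: p_def mult.assoc)
      then show "Lv s = p s" by (simp add: DE)
    qed
  qed
  have Id: "AE s in lebesgue. \<forall>i. s \<in> {a..b} \<longrightarrow> (I i has_real_derivative E s * Lx s $ i) (at s within {a..b})"
    unfolding AE_all_countable using primitive_on_AE_deriv[OF I] by blast
  have "AE s\<in>{a..b} in lebesgue. (p has_vector_derivative (Lx s + Lr s *\<^sub>R Lv s)) (at s within {a..b})"
    using Id Dd eq
  proof eventually_elim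
    case (elim s)
    show ?case
    proof
      assume s: "s \<in> {a..b}"
      show "(p has_vector_derivative (Lx s + Lr s *\<^sub>R Lv s)) (at s within {a..b})"
      proof (rule has_vector_derivative_vecI)
        fix i
        have "((\<lambda>t. D t * I i t) has_real_derivative D s * (E s * Lx s $ i) + (Lr s * D s) * I i s) (at s within {a..b})"
          using elim s by (intro DERIV_mult') auto
        moreover have "D s * (E s * Lx s $ i) + (Lr s * D s) * I i s = (Lx s + Lr s *\<^sub>R Lv s) $ i"
        proof -
          have "Lv s $ i = D s * I i s" using elim s by (simp add: p_def)
          moreover have "D s * (E s * Lx s $ i) = Lx s $ i" using DE[of s] by (simp flip: mult.assoc)
          ultimately show ?thesis by simp
        qed
        ultimately show "((\<lambda>t. p t $ i) has_real_derivative (Lx s + Lr s *\<^sub>R Lv s) $ i) (at s within {a..b})"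
          by (simp add: p_def)
      qed
    qed
  qed
  with ac eq show ?thesis by blast
qed

end

theorem theorem2p3:
  fixes L :: "real \<Rightarrow> real^'n::finite \<Rightarrow> real^'n \<Rightarrow> real \<Rightarrow> real"
    and a b u :: real
    and x y :: "real^'n"
    and \<xi> :: "real \<Rightarrow> real^'n"
    and u\<^sub>\<xi> :: "real \<Rightarrow> real"
  assumes "C1_lagrangian L"
    and "cond_L1 L" and "cond_L2 L" and "cond_L3 L" and "cond_L4' L"
    and "a < b"
    and "is_arg_min (J L a b u) (\<lambda>\<eta>. \<eta> \<in> admissible L a b x y u) \<xi>"
    and "caratheodory_solution L a b u \<xi> u\<^sub>\<xi>"
  shows "(\<exists>p. absolutely_continuous_on_ivl a b p \<and>
            (AE s\<in>{a..b} in lebesgue. L_v L s (\<xi> s) (velocity a b \<xi> s) (u\<^sub>\<xi> s) = p s) \<and>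
            (AE s\<in>{a..b} in lebesgue.
               (p has_vector_derivative
                  (L_x L s (\<xi> s) (velocity a b \<xi> s) (u\<^sub>\<xi> s)
                   + L_r L s (\<xi> s) (velocity a b \<xi> s) (u\<^sub>\<xi> s)
                       *\<^sub>R L_v L s (\<xi> s) (velocity a b \<xi> s) (u\<^sub>\<xi> s)))
               (at s within {a..b})))
       \<and> (AE s\<in>{a..b} in lebesgue.
            (u\<^sub>\<xi> has_real_derivative L s (\<xi> s) (velocity a b \<xi> s) (u\<^sub>\<xi> s)) (at s within {a..b}))
       \<and> u\<^sub>\<xi> a = u"
proof -
  obtain A where "herglotz_lagrangian L a b A"
    using herglotz_lagrangianI assms(1,3-6) by blast
  then interpret herglotz_lagrangian L a b A .
  have adm: "\<xi> \<in> admissible L a b x y u"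
    and min: "\<And>\<eta>. \<eta> \<in> admissible L a b x y u \<Longrightarrow> J L a b u \<xi> \<le> J L a b u \<eta>"
    using assms(7) by (auto simp: is_arg_min_linorder)
  then have \<xi>: "absolutely_continuous_on_ivl a b \<xi>" "\<xi> a = x" "\<xi> b = y"
    by (auto simp: admissible_def curves_def)
  interpret herglotz_minimizer L a b A \<xi> u u\<^sub>\<xi>
  proof unfold_locales
    fix \<zeta> w'
    assume *: "absolutely_continuous_on_ivl a b \<zeta>" "\<zeta> a = \<xi> a" "\<zeta> b = \<xi> b" "caratheodory_solution L a b u \<zeta> w'"
    then have "\<zeta> \<in> admissible L a b x y u" using \<xi> by (auto simp: admissible_def curves_def)
    \<comment> \<open>Both actions are end values less the same \<open>u\<close>, so the comparison
      of actions is one of end values.\<close>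
    then show "u\<^sub>\<xi> b \<le> w' b" using min[of \<zeta>] J_eq[OF *(4)] J_eq[OF assms(8)] by simp
  qed (use \<xi> assms(8) in auto)
  show ?thesis
    using herglotz_equation assms(8) unfolding Lx_def Lv_def Lr_def caratheodory_solution_def by blast
qed

end
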